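(* Let $P_b>3$, $r_a>0$, and let $\psi\in W^{2-1/P_b,P_b}(B'_{2r_a})$ satisfy $\psi(0)=0$ and $\nabla\psi(0)=0$, where $B'_\rho\subset\mathbb R^2$ is the disk of radius $\rho$ about $0$. Let $\chi\in C_c^\infty(B_2')$ satisfy $\chi=1$ on $B_1'$, and for $0<r<r_a$ set $$\psi_r(y')=\frac{\psi(ry')}{r},\qquad \widehat\psi_r=\chi\psi_r .$$ Then for every $0<r<r_a$, $$\|\widehat\psi_r\|_{\mathcal M^{4/3,3/2}(\mathbb R^2)}+\|\widehat\psi_r\|_{\mathcal M^{16/15,15/14}(\mathbb R^2)}+\|\nabla\widehat\psi_r\|_{L^\infty(\mathbb R^2)}\le C\,r^{\gamma_b}\,\|\psi\|_{W^{2-1/P_b,P_b}(B'_{2r})},\qquad \gamma_b=1-\frac3{P_b},$$ where $C$ depends only on $P_b$ and $\chi$.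
   Context: For $s\ge1$ and $1<p<\infty$ the boundary multiplier norm is $$\|\varphi\|_{\mathcal M^{s,p}(\mathbb R^2)}=\sup_{\|v\|_{W^{s-1,p}(\mathbb R^2)}=1}\|\nabla\varphi\cdot v\|_{W^{s-1,p}(\mathbb R^2)} .$$ Fractional Sobolev spaces $W^{s,p}$ are Sobolev--Slobodeckij spaces. Since $P_b>3$, $W^{2-1/P_b,P_b}$ functions on a disk are of class $C^{1,\gamma_b}$, so $\psi(0)$ and $\nabla\psi(0)$ are defined. *)

theory Defs
  imports "HOL-Analysis.Analysis" "HOL-Probability.Essential_Supremum"
begin

text \<open>
  A partial derivative of order \<open>k\<close> is indexed by a list of \<open>k\<close> basis vectors: \<open>[i, j]\<close> stands
  for \<open>D_i D_j\<close>. The lists of length \<open>k\<close> enumerate the entries of the \<open>k\<close>-th derivative tensor, so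
  for \<open>k \<ge> 2\<close> a mixed derivative occurs once for every ordering of the directions; for
  \<open>k \<le> 1\<close> they are exactly the multi-indices of order \<open>k\<close>.
\<close>

definition deriv_indices :: "nat \<Rightarrow> 'a::euclidean_space list set" where
  "deriv_indices k = {\<alpha>. set \<alpha> \<subseteq> Basis \<and> length \<alpha> = k}"

fun partial_deriv :: "'a::euclidean_space list \<Rightarrow> ('a \<Rightarrow> real) \<Rightarrow> 'a \<Rightarrow> real" where
  "partial_deriv [] f = f"
| "partial_deriv (i # \<alpha>) f = (\<lambda>x. frechet_derivative (partial_deriv \<alpha> f) (at x) i)"

text \<open>
  \<open>C\<^sub>c\<^sup>\<infinity>(\<Omega>)\<close>, for functions on the whole space (extended by zero). Total differentiability of all
  iterated partial derivatives forces them to be continuous, hence is smoothness.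
\<close>

definition test_function :: "'a::euclidean_space set \<Rightarrow> ('a \<Rightarrow> real) \<Rightarrow> bool" where
  "test_function \<Omega> f \<longleftrightarrow>
     (\<forall>k. \<forall>\<alpha>\<in>deriv_indices k. partial_deriv \<alpha> f differentiable_on UNIV) \<and>
     compact (closure {x. f x \<noteq> 0}) \<and> closure {x. f x \<noteq> 0} \<subseteq> \<Omega>"

definition loc_integrable_on ::
  "('a::euclidean_space \<Rightarrow> 'b::euclidean_space) \<Rightarrow> 'a set \<Rightarrow> bool" where
  "loc_integrable_on u \<Omega> \<longleftrightarrow> (\<forall>K. compact K \<and> K \<subseteq> \<Omega> \<longrightarrow> integrable (lebesgue_on K) u)"

definition has_weak_deriv ::
  "'a::euclidean_space set \<Rightarrow> 'a list \<Rightarrow> ('a \<Rightarrow> 'b::euclidean_space) \<Rightarrow> ('a \<Rightarrow> 'b) \<Rightarrow> bool" where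
  "has_weak_deriv \<Omega> \<alpha> u w \<longleftrightarrow>
     loc_integrable_on u \<Omega> \<and> loc_integrable_on w \<Omega> \<and>
     (\<forall>\<phi>. test_function \<Omega> \<phi> \<longrightarrow>
        (\<integral>x. partial_deriv \<alpha> \<phi> x *\<^sub>R u x \<partial>lebesgue_on \<Omega>) =
        (-1) ^ length \<alpha> *\<^sub>R (\<integral>x. \<phi> x *\<^sub>R w x \<partial>lebesgue_on \<Omega>))"

text \<open>
  A representative of the weak derivative, which is determined almost everywhere on open \<open>\<Omega>\<close>;
  meaningful only if a weak derivative exists.
\<close>

definition weak_deriv ::
  "'a::euclidean_space set \<Rightarrow> 'a list \<Rightarrow> ('a \<Rightarrow> 'b::euclidean_space) \<Rightarrow> 'a \<Rightarrow> 'b" where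
  "weak_deriv \<Omega> \<alpha> u = (SOME w. has_weak_deriv \<Omega> \<alpha> u w)"

definition weakly_differentiable_on ::
  "('a::euclidean_space \<Rightarrow> real) \<Rightarrow> 'a set \<Rightarrow> bool" where
  "weakly_differentiable_on u \<Omega> \<longleftrightarrow> (\<forall>i\<in>Basis. \<exists>w. has_weak_deriv \<Omega> [i] u w)"

definition weak_gradient :: "'a::euclidean_space set \<Rightarrow> ('a \<Rightarrow> real) \<Rightarrow> 'a \<Rightarrow> 'a" where
  "weak_gradient \<Omega> u x = (\<Sum>i\<in>Basis. weak_deriv \<Omega> [i] u x *\<^sub>R i)"

definition ennreal_root :: "real \<Rightarrow> ennreal \<Rightarrow> ennreal" where
  "ennreal_root p a = (if a = \<infinity> then \<infinity> else ennreal (enn2real a powr (1 / p)))"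

text \<open>The \<open>p\<close>-th powers of the \<open>L\<^sup>p\<close> norm and of the Gagliardo--Slobodeckij seminorm of order
  \<open>\<sigma> \<in> (0,1)\<close>.\<close>

definition lp_energy ::
  "real \<Rightarrow> 'a::euclidean_space set \<Rightarrow> ('a \<Rightarrow> 'b::euclidean_space) \<Rightarrow> ennreal" where
  "lp_energy p \<Omega> u = (\<integral>\<^sup>+x. ennreal (norm (u x) powr p) \<partial>lebesgue_on \<Omega>)"

definition slobodeckij_energy ::
  "real \<Rightarrow> real \<Rightarrow> 'a::euclidean_space set \<Rightarrow> ('a \<Rightarrow> 'b::euclidean_space) \<Rightarrow> ennreal" where
  "slobodeckij_energy \<sigma> p \<Omega> u =
     (\<integral>\<^sup>+x. (\<integral>\<^sup>+y. ennreal (norm (u x - u y) powr p / norm (x - y) powr (real DIM('a) + \<sigma> * p))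
        \<partial>lebesgue_on \<Omega>) \<partial>lebesgue_on \<Omega>)"

definition sobolev_energy ::
  "real \<Rightarrow> real \<Rightarrow> 'a::euclidean_space set \<Rightarrow> ('a \<Rightarrow> 'b::euclidean_space) \<Rightarrow> ennreal" where
  "sobolev_energy s p \<Omega> u =
     (\<Sum>k\<le>nat \<lfloor>s\<rfloor>. \<Sum>\<alpha>\<in>deriv_indices k. lp_energy p \<Omega> (weak_deriv \<Omega> \<alpha> u)) +
     (if frac s = 0 then 0
      else \<Sum>\<alpha>\<in>deriv_indices (nat \<lfloor>s\<rfloor>). slobodeckij_energy (frac s) p \<Omega> (weak_deriv \<Omega> \<alpha> u))"

text \<open>
  The Sobolev--Slobodeckij space \<open>W\<^sup>s\<^sup>,\<^sup>p(\<Omega>)\<close> for \<open>s \<ge> 0\<close>, \<open>1 \<le> p < \<infinity>\<close> and open \<open>\<Omega>\<close>, at the level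
  of functions rather than almost-everywhere classes. The values of a function outside \<open>\<Omega>\<close> play
  no role.
\<close>

definition sobolev_space ::
  "real \<Rightarrow> real \<Rightarrow> 'a::euclidean_space set \<Rightarrow> ('a \<Rightarrow> 'b::euclidean_space) set" where
  "sobolev_space s p \<Omega> =
     {u. u \<in> borel_measurable (lebesgue_on \<Omega>) \<and>
         (\<forall>k\<le>nat \<lfloor>s\<rfloor>. \<forall>\<alpha>\<in>deriv_indices k. \<exists>w. has_weak_deriv \<Omega> \<alpha> u w) \<and>
         sobolev_energy s p \<Omega> u < \<infinity>}"

definition sobolev_norm ::
  "real \<Rightarrow> real \<Rightarrow> 'a::euclidean_space set \<Rightarrow> ('a \<Rightarrow> 'b::euclidean_space) \<Rightarrow> ennreal" where
  "sobolev_norm s p \<Omega> u =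
     (if u \<in> sobolev_space s p \<Omega> then ennreal_root p (sobolev_energy s p \<Omega> u) else \<infinity>)"

text \<open>
  The boundary multiplier norm on the whole space. The functions \<open>v\<close> are vector fields, and
  \<open>\<nabla>\<phi> \<cdot> v\<close> is the Euclidean inner product with the weak gradient.
\<close>

definition multiplier_norm :: "real \<Rightarrow> real \<Rightarrow> ('a::euclidean_space \<Rightarrow> real) \<Rightarrow> ennreal" where
  "multiplier_norm s p \<phi> =
     (if weakly_differentiable_on \<phi> UNIV
      then SUP v\<in>{v::'a \<Rightarrow> 'a. sobolev_norm (s - 1) p UNIV v = 1}.
             sobolev_norm (s - 1) p UNIV (\<lambda>x. weak_gradient UNIV \<phi> x \<bullet> v x)
      else \<infinity>)"

definition grad_linf_norm :: "('a::euclidean_space \<Rightarrow> real) \<Rightarrow> ennreal" where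
  "grad_linf_norm \<phi> =
     (if weakly_differentiable_on \<phi> UNIV
      then esssup lebesgue (\<lambda>x. ennreal (norm (weak_gradient UNIV \<phi> x)))
      else \<infinity>)"

definition rescaled :: "real \<Rightarrow> ('a::real_vector \<Rightarrow> real) \<Rightarrow> 'a \<Rightarrow> real" where
  "rescaled r \<psi> y = \<psi> (r *\<^sub>R y) / r"

end

theory Submission
  imports Defs
begin

text \<open>The two sides scale alike: the gradient of \<open>rescaled r \<psi>\<close> is \<open>\<nabla>\<psi>(r \<cdot>)\<close>, and its Slobodeckij energy on
the disk of radius \<open>2\<close> is \<open>(r powr (1 - 3 / P)) powr P = r powr (P - 3)\<close> times that
of \<open>\<nabla>\<psi>\<close> on the disk of radius \<open>2 r\<close>. So for every number \<open>N\<close> above the norm of \<open>\<psi>\<close> the function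
\<open>u = rescaled r \<psi> / A\<close> with \<open>A = r powr (1 - 3 / P) * N\<close> has a weak gradient of energy at most \<open>1\<close>, and it
suffices to bound the three norms of \<open>\<eta> u\<close> by one constant. Letting \<open>N\<close> decrease to the norm gives
the theorem. If \<open>\<psi>\<close> is not in the Sobolev space over the disk of radius \<open>2 r\<close>, then the right-hand side is
infinite.

The order of the weak gradient of \<open>u\<close> is \<open>1 - 1 / P\<close>, and its product with \<open>P\<close> exceeds the dimension \<open>2\<close>.
Hence the mollifications of the gradient at the scales \<open>t\<close> and \<open>t / 2\<close> differ by at most a multiple of
\<open>t powr (1 - 3 / P)\<close>, so they converge uniformly to a Hoelder continuous function, and \<open>u\<close> is
continuously differentiable (\<open>fractional_weak_gradient_C1\<close>). Since \<open>u\<close> and its gradient vanish at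
\<open>0\<close>, both are bounded by a constant on the support of \<open>\<eta>\<close>. This settles the supremum norm of the gradient
\<open>F\<close> of \<open>\<eta> u\<close>.

For the multiplier norms of order \<open>\<sigma>\<close>, the difference of \<open>F \<bullet> v\<close> at \<open>x\<close> and \<open>y\<close> is
\<open>F x \<bullet> (v x - v y) + (F x - F y) \<bullet> v y\<close>. The first part is controlled by the bound on \<open>F\<close>. The second leads to the
integral of \<open>|v|\<^sup>q\<close> against the density \<open>D y = \<integral>|F x - F y|\<^sup>q / |x - y| powr (2 + \<sigma> q) dx\<close>. For \<open>P\<close> close to \<open>3\<close>
the Hoelder exponent \<open>1 - 3 / P\<close> is below \<open>\<sigma>\<close>, so \<open>D\<close> need not be bounded. But \<open>F\<close> also inherits the
energy of order \<open>1 - 1 / P\<close>, which exceeds \<open>\<sigma>\<close>. Using the energy near the diagonal and the Hoelder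
bound away from it, the integral of \<open>D\<close> over a disk of radius \<open>\<rho> \<le> 1\<close> is at most a multiple of
\<open>\<rho> powr (2 - \<sigma> q + \<epsilon>)\<close> with \<open>\<epsilon> > 0\<close> (\<open>difference_density_growth\<close>). This growth is all that a trace
inequality of Adams type needs: the integral of \<open>|v|\<^sup>q\<close> against such a density is bounded by the
Sobolev--Slobodeckij norm of order \<open>\<sigma>\<close> (\<open>trace_inequality\<close>).

Weak derivatives are determined only up to null sets, so the classical gradient has to be identified
with the weak one (\<open>C1_has_weak_deriv\<close>, \<open>fundamental_lemma\<close>). Mollifiers are built from the
cut-off function \<open>\<eta>\<close>.\<close>

text \<open>First-order partial derivatives stay folded; \<open>partial_deriv_single\<close> unfolds them on demand.\<close>

declare partial_deriv.simps(2) [simp del]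

section \<open>Smooth functions and test functions\<close>

definition smooth :: "('a::euclidean_space \<Rightarrow> real) \<Rightarrow> bool" where
  "smooth f \<longleftrightarrow> (\<forall>\<alpha>. set \<alpha> \<subseteq> Basis \<longrightarrow> partial_deriv \<alpha> f differentiable_on UNIV)"

lemma test_function_alt:
  "test_function \<Omega> f \<longleftrightarrow>
     smooth f \<and> compact (closure {x. f x \<noteq> 0}) \<and> closure {x. f x \<noteq> 0} \<subseteq> \<Omega>"
  unfolding test_function_def smooth_def deriv_indices_def by auto

lemma partial_deriv_append: "partial_deriv (\<alpha> @ \<beta>) f = partial_deriv \<alpha> (partial_deriv \<beta> f)"
  by (induction \<alpha>) (auto simp: partial_deriv.simps(2))

lemma partial_deriv_single: "partial_deriv [i] f x = frechet_derivative f (at x) i"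
  by (simp add: partial_deriv.simps(2))

lemma smooth_differentiable: "smooth f \<Longrightarrow> f differentiable at x"
  unfolding smooth_def differentiable_on_def by (metis empty_subsetI list.set(1)
      partial_deriv.simps(1) UNIV_I)

lemma smooth_partial_deriv: "smooth f \<Longrightarrow> set \<alpha> \<subseteq> Basis \<Longrightarrow> smooth (partial_deriv \<alpha> f)"
  unfolding smooth_def by (metis partial_deriv_append le_sup_iff set_append)

lemma smooth_unfold:
  "smooth f \<longleftrightarrow> f differentiable_on UNIV \<and> (\<forall>i\<in>Basis. smooth (partial_deriv [i] f))"
proof safe
  assume f: "smooth f"
  then show "f differentiable_on UNIV"
    by (auto simp: differentiable_on_def smooth_differentiable)
  show "smooth (partial_deriv [i] f)" if "i \<in> Basis" for i
    using smooth_partial_deriv[OF f, of "[i]"] that by simp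
next
  assume f: "f differentiable_on UNIV" and i: "\<forall>i\<in>Basis. smooth (partial_deriv [i] f)"
  show "smooth f"
    unfolding smooth_def
  proof (intro allI impI)
    fix \<alpha> :: "'a list" assume \<alpha>: "set \<alpha> \<subseteq> Basis"
    show "partial_deriv \<alpha> f differentiable_on UNIV"
    proof (cases \<alpha> rule: rev_cases)
      case Nil
      then show ?thesis using f by simp
    next
      case (snoc \<beta> j)
      then have "smooth (partial_deriv [j] f)" "set \<beta> \<subseteq> Basis" using i \<alpha> by auto
      then show ?thesis unfolding snoc partial_deriv_append smooth_def by blast
    qed
  qed
qed

text \<open>Smoothness is the greatest fixed point of \<open>smooth_unfold\<close>: a class of differentiable functions
  that is closed under partial differentiation consists of smooth functions.\<close>

lemma smooth_coinduct:
  assumes "Q f"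
    and step: "\<And>g. Q g \<Longrightarrow> g differentiable_on UNIV \<and> (\<forall>i\<in>Basis. Q (partial_deriv [i] g))"
  shows "smooth f"
proof -
  have "\<forall>f. Q f \<longrightarrow> set \<alpha> \<subseteq> Basis \<longrightarrow> partial_deriv \<alpha> f differentiable_on UNIV" for \<alpha> :: "'a list"
  proof (induction \<alpha> rule: rev_induct)
    case Nil
    then show ?case using step by auto
  next
    case (snoc j \<alpha>)
    show ?case
    proof (intro allI impI)
      fix f assume "Q f" and "set (\<alpha> @ [j]) \<subseteq> Basis"
      then have "Q (partial_deriv [j] f)" "set \<alpha> \<subseteq> Basis" using step by auto
      then show "partial_deriv (\<alpha> @ [j]) f differentiable_on UNIV"
        unfolding partial_deriv_append using snoc.IH by blast
    qed
  qed
  then show ?thesis unfolding smooth_def using assms(1) by blast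
qed

lemma partial_deriv_eqI:
  "(f has_derivative f') (at x) \<Longrightarrow> partial_deriv [i] f x = f' i"
  by (simp add: partial_deriv.simps(2) frechet_derivative_at[symmetric])

lemma smooth_has_derivative:
  assumes "smooth f"
  shows "(f has_derivative (\<lambda>h. \<Sum>i\<in>Basis. (h \<bullet> i) * partial_deriv [i] f x)) (at x)"
proof -
  obtain f' where f': "(f has_derivative f') (at x)"
    using smooth_differentiable[OF assms] unfolding differentiable_def by blast
  then interpret f': bounded_linear f' by (rule has_derivative_bounded_linear)
  have "f' h = (\<Sum>i\<in>Basis. (h \<bullet> i) * partial_deriv [i] f x)" for h
  proof -
    have "f' h = f' (\<Sum>i\<in>Basis. (h \<bullet> i) *\<^sub>R i)" by (simp add: euclidean_representation)
    also have "\<dots> = (\<Sum>i\<in>Basis. (h \<bullet> i) * f' i)" by (simp add: f'.sum f'.scaleR)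
    finally show ?thesis using partial_deriv_eqI[OF f'] by simp
  qed
  then have "f' = (\<lambda>h. \<Sum>i\<in>Basis. (h \<bullet> i) * partial_deriv [i] f x)" by blast
  with f' show ?thesis by simp
qed

lemma smooth_continuous_on: "smooth f \<Longrightarrow> continuous_on S f"
  using smooth_differentiable differentiable_imp_continuous_within
  by (metis continuous_at_imp_continuous_on)

text \<open>Products of smooth functions are not closed under differentiation, but finite sums of
  products are.\<close>

inductive sum_of_products :: "('a::euclidean_space \<Rightarrow> real) \<Rightarrow> bool" where
  prod: "smooth f \<Longrightarrow> smooth g \<Longrightarrow> sum_of_products (\<lambda>x. f x * g x)"
| add: "sum_of_products f \<Longrightarrow> sum_of_products g \<Longrightarrow> sum_of_products (\<lambda>x. f x + g x)"

lemma sum_of_products_step: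
  assumes "sum_of_products f"
  shows "f differentiable_on UNIV \<and> (\<forall>i\<in>Basis. sum_of_products (partial_deriv [i] f))"
  using assms
proof induction
  case (prod f g)
  have f: "(f has_derivative frechet_derivative f (at x)) (at x)"
    and g: "(g has_derivative frechet_derivative g (at x)) (at x)" for x
    using prod smooth_differentiable frechet_derivative_works by blast+
  note fg = has_derivative_mult[OF f g]
  have "partial_deriv [i] (\<lambda>x. f x * g x)
      = (\<lambda>x. f x * partial_deriv [i] g x + partial_deriv [i] f x * g x)" for i
    using partial_deriv_eqI[OF fg] by (intro ext) (simp add: partial_deriv_single)
  moreover have "sum_of_products (\<lambda>x. f x * partial_deriv [i] g x + partial_deriv [i] f x * g x)"
    if "i \<in> Basis" for i
    using prod that by (intro sum_of_products.intros smooth_partial_deriv) auto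
  ultimately show ?case
    using fg by (auto simp: differentiable_on_def differentiable_def)
next
  case (add f g)
  have f: "(f has_derivative frechet_derivative f (at x)) (at x)"
    and g: "(g has_derivative frechet_derivative g (at x)) (at x)" for x
    using add.IH frechet_derivative_works unfolding differentiable_on_def by blast+
  note fg = has_derivative_add[OF f g]
  have "partial_deriv [i] (\<lambda>x. f x + g x)
      = (\<lambda>x. partial_deriv [i] f x + partial_deriv [i] g x)" for i
    using partial_deriv_eqI[OF fg] by (intro ext) (simp add: partial_deriv_single)
  then show ?case
    using fg add by (auto simp: differentiable_on_def differentiable_def intro: sum_of_products.add)
qed

lemma smooth_mult: "smooth f \<Longrightarrow> smooth g \<Longrightarrow> smooth (\<lambda>x. f x * g x)"
  by (rule smooth_coinduct[where Q = sum_of_products])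
     (auto intro: sum_of_products.prod dest: sum_of_products_step)

lemma smooth_affine:
  assumes "smooth f"
  shows "smooth (\<lambda>x. k * f (c *\<^sub>R x + b))"
proof (rule smooth_coinduct[where Q = "\<lambda>h. \<exists>k g. smooth g \<and> h = (\<lambda>x. k * g (c *\<^sub>R x + b))"])
  show "\<exists>k' g. smooth g \<and> (\<lambda>x. k * f (c *\<^sub>R x + b)) = (\<lambda>x. k' * g (c *\<^sub>R x + b))"
    using assms by blast
next
  fix h assume "\<exists>k g. smooth g \<and> h = (\<lambda>x. k * g (c *\<^sub>R x + b))"
  then obtain k g where g: "smooth g" and h: "h = (\<lambda>x. k * g (c *\<^sub>R x + b))" by blast
  have g': "(g has_derivative frechet_derivative g (at x)) (at x)" for x
    using g smooth_differentiable frechet_derivative_works by blast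
  have d: "(h has_derivative (\<lambda>v. k * frechet_derivative g (at (c *\<^sub>R x + b)) (c *\<^sub>R v))) (at x)" for x
  proof -
    have "((\<lambda>x. c *\<^sub>R x + b) has_derivative (\<lambda>v. c *\<^sub>R v)) (at x)"
      by (auto intro!: derivative_eq_intros)
    from diff_chain_at[OF this g'] show ?thesis
      unfolding h by (auto intro!: derivative_eq_intros simp: o_def)
  qed
  have "partial_deriv [i] h = (\<lambda>x. (k * c) * partial_deriv [i] g (c *\<^sub>R x + b))" for i
    using partial_deriv_eqI[OF d] has_derivative_bounded_linear[OF g']
    by (intro ext) (simp add: linear_simps partial_deriv_single)
  then show "h differentiable_on UNIV \<and> (\<forall>i\<in>Basis. \<exists>k g. smooth g \<and>
      partial_deriv [i] h = (\<lambda>x. k * g (c *\<^sub>R x + b)))"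
    using d smooth_partial_deriv[OF g, of "[_]"]
    by (fastforce simp: differentiable_on_def differentiable_def)
qed

lemma partial_deriv_affine:
  assumes "smooth f"
  shows "partial_deriv [i] (\<lambda>x. k * f (c *\<^sub>R x + b)) x = k * c * partial_deriv [i] f (c *\<^sub>R x + b)"
proof -
  have f': "(f has_derivative frechet_derivative f (at x)) (at x)" for x
    using assms smooth_differentiable frechet_derivative_works by blast
  have "((\<lambda>x. c *\<^sub>R x + b) has_derivative (\<lambda>v. c *\<^sub>R v)) (at x)"
    by (auto intro!: derivative_eq_intros)
  from diff_chain_at[OF this f']
  have "((\<lambda>x. k * f (c *\<^sub>R x + b)) has_derivative
      (\<lambda>v. k * frechet_derivative f (at (c *\<^sub>R x + b)) (c *\<^sub>R v))) (at x)"
    by (auto intro!: derivative_eq_intros simp: o_def)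
  from partial_deriv_eqI[OF this] has_derivative_bounded_linear[OF f'] show ?thesis
    by (simp add: linear_simps partial_deriv_single)
qed

lemma test_function_smooth: "test_function \<Omega> f \<Longrightarrow> smooth f"
  by (simp add: test_function_alt)

lemma test_function_mono: "test_function \<Omega> f \<Longrightarrow> \<Omega> \<subseteq> \<Omega>' \<Longrightarrow> test_function \<Omega>' f"
  unfolding test_function_alt by blast

lemma test_function_outside:
  assumes "test_function \<Omega> f" "x \<notin> \<Omega>"
  shows "f x = 0"
  using assms closure_subset[of "{x. f x \<noteq> 0}"] unfolding test_function_alt by blast

lemma test_functionI:
  assumes "smooth f" "compact K" "K \<subseteq> \<Omega>" "\<And>x. x \<notin> K \<Longrightarrow> f x = 0"
  shows "test_function \<Omega> f"
proof -
  have K: "closure {x. f x \<noteq> 0} \<subseteq> K"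
    using assms(4) by (intro closure_minimal compact_imp_closed assms) auto
  then have "compact (closure {x. f x \<noteq> 0})"
    using assms(2) by (metis closed_closure compact_Int_closed inf.absorb2)
  with K assms show ?thesis unfolding test_function_alt by blast
qed

lemma test_function_support:
  assumes "test_function \<Omega> f"
  obtains K where "compact K" "K \<subseteq> \<Omega>" "\<And>x. x \<notin> K \<Longrightarrow> f x = 0"
    "\<And>x \<alpha>. x \<notin> K \<Longrightarrow> set \<alpha> \<subseteq> Basis \<Longrightarrow> partial_deriv \<alpha> f x = 0"
proof (rule that[of "closure {x. f x \<noteq> 0}"])
  let ?K = "closure {x. f x \<noteq> 0}"
  show "compact ?K" "?K \<subseteq> \<Omega>" using assms by (auto simp: test_function_alt)
  have *: "\<forall>x. x \<notin> ?K \<longrightarrow> partial_deriv \<alpha> f x = 0" for \<alpha>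
  proof (induction \<alpha>)
    case Nil
    then show ?case using closure_subset[of "{x. f x \<noteq> 0}"] by (auto simp: subset_iff)
  next
    case (Cons i \<alpha>)
    have "(partial_deriv \<alpha> f has_derivative (\<lambda>h. 0)) (at x)" if "x \<notin> ?K" for x
      by (rule has_derivative_transform_within_open[where f = "\<lambda>x. 0" and s = "- ?K"])
         (use that Cons in auto)
    from frechet_derivative_at[OF this] show ?case
      unfolding partial_deriv.simps(2) by metis
  qed
  show "f x = 0" if "x \<notin> ?K" for x using *[of "[]", THEN spec, of x] that unfolding partial_deriv.simps(1) by (rule mp)
  show "partial_deriv \<alpha> f x = 0" if "x \<notin> ?K" for x \<alpha> using *[of \<alpha>, THEN spec, of x] that(1) by (rule mp)
qed

lemma test_function_compact_support:
  assumes "test_function \<Omega> f"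
  obtains K where "compact K" "K \<subseteq> \<Omega>" "\<And>x. x \<notin> K \<Longrightarrow> f x = 0"
  by (rule test_function_support[OF assms]) (rule that)

lemma test_function_partial_deriv:
  assumes "test_function \<Omega> f" "set \<alpha> \<subseteq> Basis"
  shows "test_function \<Omega> (partial_deriv \<alpha> f)"
proof -
  obtain K where K: "compact K" "K \<subseteq> \<Omega>" "\<And>x. x \<notin> K \<Longrightarrow> f x = 0"
    "\<And>x \<alpha>. x \<notin> K \<Longrightarrow> set \<alpha> \<subseteq> Basis \<Longrightarrow> partial_deriv \<alpha> f x = 0"
    by (rule test_function_support[OF assms(1)]) (rule that)
  show ?thesis
    using K assms(2) smooth_partial_deriv[OF test_function_smooth[OF assms(1)]]
    by (intro test_functionI[where K = K]) auto
qed

lemma test_function_mult: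
  assumes "smooth f" "test_function \<Omega> g"
  shows "test_function \<Omega> (\<lambda>x. f x * g x)"
proof -
  obtain K where K: "compact K" "K \<subseteq> \<Omega>" "\<And>x. x \<notin> K \<Longrightarrow> g x = 0"
    by (rule test_function_compact_support[OF assms(2)]) (rule that)
  show ?thesis
    using K assms(1) smooth_mult[OF assms(1) test_function_smooth[OF assms(2)]]
    by (intro test_functionI[where K = K]) auto
qed

lemma test_function_affine:
  fixes f :: "'a::euclidean_space \<Rightarrow> real"
  assumes "test_function \<Omega> f" "c \<noteq> 0"
  shows "test_function {x. c *\<^sub>R x + b \<in> \<Omega>} (\<lambda>x. k * f (c *\<^sub>R x + b))"
proof -
  obtain K where K: "compact K" "K \<subseteq> \<Omega>" "\<And>x. x \<notin> K \<Longrightarrow> f x = 0"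
    by (rule test_function_compact_support[OF assms(1)]) (rule that)
  let ?T = "\<lambda>x::'a. (1 / c) *\<^sub>R (x - b)"
  show ?thesis
  proof (rule test_functionI)
    show "smooth (\<lambda>x. k * f (c *\<^sub>R x + b))"
      by (rule smooth_affine[OF test_function_smooth[OF assms(1)]])
    show "compact (?T ` K)"
      by (rule compact_continuous_image[OF _ K(1)]) (intro continuous_intros)
    show "?T ` K \<subseteq> {x. c *\<^sub>R x + b \<in> \<Omega>}" using K(2) assms(2) by auto
    show "k * f (c *\<^sub>R x + b) = 0" if "x \<notin> ?T ` K" for x
    proof -
      have "x = ?T (c *\<^sub>R x + b)" using assms(2) by simp
      with that have "c *\<^sub>R x + b \<notin> K" by blast
      then show ?thesis using K(3) by simp
    qed
  qed
qed

lemma test_function_bounded: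
  assumes "test_function \<Omega> f"
  obtains M where "M > 0" "\<And>x. \<bar>f x\<bar> \<le> M"
proof -
  obtain K where K: "compact K" "K \<subseteq> \<Omega>" "\<And>x. x \<notin> K \<Longrightarrow> f x = 0"
    by (rule test_function_compact_support[OF assms]) (rule that)
  have "compact (f ` K)"
    using K smooth_continuous_on[OF test_function_smooth[OF assms]] by (intro compact_continuous_image)
  then obtain M where "\<forall>y\<in>f ` K. norm y \<le> M" "M > 0"
    using compact_imp_bounded bounded_pos by blast
  then have "\<bar>f x\<bar> \<le> M" for x using K(3)[of x] by (cases "x \<in> K") auto
  with \<open>M > 0\<close> that show ?thesis by blast
qed

lemma test_function_lipschitz:
  assumes "test_function \<Omega> f"
  obtains L where "L > 0" "\<And>x y. \<bar>f x - f y\<bar> \<le> L * norm (x - y)"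
proof -
  have "\<forall>i\<in>Basis. \<exists>M. \<forall>x. \<bar>partial_deriv [i] f x\<bar> \<le> M"
  proof
    fix i :: 'a assume "i \<in> Basis"
    then have "test_function \<Omega> (partial_deriv [i] f)"
      by (intro test_function_partial_deriv assms) simp
    from test_function_bounded[OF this] show "\<exists>M. \<forall>x. \<bar>partial_deriv [i] f x\<bar> \<le> M" by metis
  qed
  then obtain M where M: "\<And>i x. i \<in> Basis \<Longrightarrow> \<bar>partial_deriv [i] f x\<bar> \<le> M i" by metis
  let ?L = "\<Sum>i\<in>Basis. M i"
  have L0: "?L \<ge> 0" by (intro sum_nonneg) (meson M abs_ge_zero order_trans)
  have on: "onorm (\<lambda>h. \<Sum>i\<in>Basis. (h \<bullet> i) * partial_deriv [i] f x) \<le> ?L" for x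
  proof (rule onorm_le)
    fix h :: 'a
    have "norm (\<Sum>i\<in>Basis. (h \<bullet> i) * partial_deriv [i] f x) \<le> (\<Sum>i\<in>Basis. norm h * M i)"
      by (rule order_trans[OF norm_sum])
         (auto intro!: sum_mono mult_mono M simp: abs_mult Basis_le_norm)
    then show "norm (\<Sum>i\<in>Basis. (h \<bullet> i) * partial_deriv [i] f x) \<le> ?L * norm h"
      by (simp add: sum_distrib_left mult.commute)
  qed
  have "norm (f x - f y) \<le> ?L * norm (x - y)" for x y
    using smooth_has_derivative[OF test_function_smooth[OF assms]] on
    by (intro differentiable_bound[where S = UNIV]) auto
  then have "\<bar>f x - f y\<bar> \<le> (?L + 1) * norm (x - y)" for x y
    by (smt (verit) mult_right_mono norm_ge_zero real_norm_def)
  with L0 that show ?thesis by (metis add_nonneg_pos zero_less_one)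
qed

text \<open>The partial derivatives of a test function are Lipschitz, so the remainder of the linearization is
quadratic, uniformly in the base point.\<close>

lemma test_function_linearization:
  assumes "test_function \<Omega> f"
  obtains M where "M > 0"
    "\<And>x h. \<bar>f (x + h) - f x - (\<Sum>i\<in>Basis. (h \<bullet> i) * partial_deriv [i] f x)\<bar> \<le> M * (norm h)\<^sup>2"
proof -
  have "\<forall>i\<in>Basis. \<exists>L. \<forall>x y. \<bar>partial_deriv [i] f x - partial_deriv [i] f y\<bar> \<le> L * norm (x - y)"
  proof
    fix i :: 'a assume "i \<in> Basis"
    then have "test_function \<Omega> (partial_deriv [i] f)"
      by (intro test_function_partial_deriv assms) simp
    from test_function_lipschitz[OF this]
    show "\<exists>L. \<forall>x y. \<bar>partial_deriv [i] f x - partial_deriv [i] f y\<bar> \<le> L * norm (x - y)" by metis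
  qed
  then obtain L where L: "\<And>i x y. i \<in> Basis \<Longrightarrow>
      \<bar>partial_deriv [i] f x - partial_deriv [i] f y\<bar> \<le> L i * norm (x - y)" by metis
  let ?L = "\<Sum>i\<in>Basis. \<bar>L i\<bar>"
  let ?D = "\<lambda>x h. \<Sum>i\<in>Basis. (h \<bullet> i) * partial_deriv [i] f x"
  have L0: "?L \<ge> 0" by (intro sum_nonneg) auto
  have on: "onorm (?D y - ?D x) \<le> ?L * norm (y - x)" for x y
  proof (rule onorm_le)
    fix h :: 'a
    have "norm ((?D y - ?D x) h) = norm (\<Sum>i\<in>Basis. (h \<bullet> i) * (partial_deriv [i] f y - partial_deriv [i] f x))"
      by (simp add: sum_subtractf right_diff_distrib)
    also have "\<dots> \<le> (\<Sum>i\<in>Basis. norm h * (\<bar>L i\<bar> * norm (y - x)))"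
    proof (rule order_trans[OF norm_sum], rule sum_mono)
      fix i :: 'a assume i: "i \<in> Basis"
      have "\<bar>partial_deriv [i] f y - partial_deriv [i] f x\<bar> \<le> \<bar>L i\<bar> * norm (y - x)"
        by (rule order_trans[OF L[OF i]]) (auto intro: mult_right_mono)
      then show "norm ((h \<bullet> i) * (partial_deriv [i] f y - partial_deriv [i] f x))
          \<le> norm h * (\<bar>L i\<bar> * norm (y - x))"
        using Basis_le_norm[OF i, of h] by (auto simp: abs_mult intro!: mult_mono)
    qed
    also have "\<dots> = ?L * norm (y - x) * norm h"
      by (simp add: sum_distrib_left sum_distrib_right algebra_simps)
    finally show "norm ((?D y - ?D x) h) \<le> ?L * norm (y - x) * norm h" .
  qed
  have *: "\<bar>f (x + h) - f x - ?D x h\<bar> \<le> ?L * (norm h)\<^sup>2" for x h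
  proof -
    have "norm (f (x + h) - f x - ?D x ((x + h) - x)) \<le> norm ((x + h) - x) * (?L * norm h)"
    proof (rule differentiable_bound_linearization[where S = "cball x (norm h)" and f = f and f' = ?D and a = x
        and b = "x + h"])
      show "x + t *\<^sub>R (x + h - x) \<in> cball x (norm h)" if "t \<in> {0..1}" for t
        using that by (simp add: dist_norm mult_left_le_one_le)
      show "(f has_derivative ?D y) (at y within cball x (norm h))" for y
        using smooth_has_derivative[OF test_function_smooth[OF assms]] has_derivative_at_withinI by blast
      show "onorm (?D y - ?D x) \<le> ?L * norm h" if "y \<in> cball x (norm h)" for y
        using that by (intro order_trans[OF on] mult_left_mono L0) (auto simp: dist_norm norm_minus_commute)
    qed auto
    also have "(x + h) - x = h" by simp
    also have "norm h * (?L * norm h) = ?L * (norm h)\<^sup>2"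
      by (simp only: power2_eq_square mult.commute mult.left_commute)
    finally show ?thesis unfolding real_norm_def .
  qed
  have "\<bar>f (x + h) - f x - ?D x h\<bar> \<le> (?L + 1) * (norm h)\<^sup>2" for x h
    by (rule order_trans[OF *]) (auto intro: mult_right_mono)
  moreover have "?L + 1 > 0" using L0 by linarith
  ultimately show ?thesis using that by blast
qed

section \<open>Convolution with a test function\<close>

definition conv :: "('a::euclidean_space \<Rightarrow> real) \<Rightarrow> ('a \<Rightarrow> real) \<Rightarrow> 'a \<Rightarrow> real" where
  "conv \<phi> f x = (\<integral>a. \<phi> (x - a) * f a \<partial>lebesgue)"

lemma smooth_borel: "smooth f \<Longrightarrow> f \<in> borel_measurable borel"
  by (simp add: borel_measurable_continuous_onI smooth_continuous_on)

lemma borel_imp_lebesgue: "f \<in> borel_measurable borel \<Longrightarrow> f \<in> borel_measurable lebesgue"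
  by (simp add: measurable_completion)

lemma integrable_bounded_mult:
  fixes f :: "'a \<Rightarrow> 'b::{second_countable_topology, banach}"
  assumes "integrable M f" "g \<in> borel_measurable M" "\<And>x. \<bar>g x\<bar> \<le> c"
  shows "integrable M (\<lambda>x. g x *\<^sub>R f x)"
proof (rule Bochner_Integration.integrable_bound)
  show "integrable M (\<lambda>x. c * norm (f x))" using assms(1) by simp
  show "(\<lambda>x. g x *\<^sub>R f x) \<in> borel_measurable M" using borel_measurable_integrable[OF assms(1)] assms(2) by measurable
  have "norm (g x *\<^sub>R f x) \<le> norm (c * norm (f x))" for x
    using mult_right_mono[OF order_trans[OF assms(3) abs_ge_self] norm_ge_zero, of x "f x"]
    by (simp add: abs_mult)
  then show "AE x in M. norm (g x *\<^sub>R f x) \<le> norm (c * norm (f x))" by simp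
qed

lemma conv_integrable:
  assumes "test_function UNIV \<phi>" "integrable lebesgue f"
  shows "integrable lebesgue (\<lambda>a. \<phi> (x - a) * f a)"
proof -
  obtain M where M: "M > 0" "\<And>x. \<bar>\<phi> x\<bar> \<le> M"
    by (rule test_function_bounded[OF assms(1)]) (rule that)
  have "(\<lambda>a. \<phi> (x - a)) \<in> borel_measurable borel"
    by (rule measurable_compose[OF _ smooth_borel[OF test_function_smooth[OF assms(1)]]]) simp
  then have "(\<lambda>a. \<phi> (x - a)) \<in> borel_measurable lebesgue" by (rule borel_imp_lebesgue)
  then show ?thesis
    using integrable_bounded_mult[OF assms(2), where g = "\<lambda>a. \<phi> (x - a)" and c = M] M(2)
    by simp
qed

lemma has_derivativeI_quadratic:
  fixes F :: "'a::real_normed_vector \<Rightarrow> 'b::real_normed_vector"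
  assumes "bounded_linear D" and *: "\<And>h. norm (F (x + h) - F x - D h) \<le> M * (norm h)\<^sup>2"
  shows "(F has_derivative D) (at x)"
  unfolding has_derivative_at
proof
  show "(\<lambda>h. norm (F (x + h) - F x - D h) / norm h) \<midarrow>0\<rightarrow> 0"
  proof (rule Lim_null_comparison)
    show "\<forall>\<^sub>F h in at 0. norm (norm (F (x + h) - F x - D h) / norm h) \<le> M * norm h"
    proof (intro always_eventually allI)
      fix h
      show "norm (norm (F (x + h) - F x - D h) / norm h) \<le> M * norm h"
        using *[of h] by (cases "h = 0") (auto simp: divide_simps power2_eq_square)
    qed
    show "((\<lambda>h. M * norm h) \<longlongrightarrow> 0) (at 0)"
      by (auto intro!: tendsto_eq_intros)
  qed
qed (rule assms)

text \<open>Differentiation under the integral sign: a test function is approximated by its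
  linearization with a quadratic error that is uniform in the base point, so the error integrates
  against any integrable function.\<close>

lemma conv_has_derivative:
  assumes \<phi>: "test_function UNIV \<phi>" and f: "integrable lebesgue f"
  shows "(conv \<phi> f has_derivative (\<lambda>h. \<Sum>i\<in>Basis. (h \<bullet> i) * conv (partial_deriv [i] \<phi>) f x)) (at x)"
proof -
  obtain M where M: "M > 0"
    "\<And>x h. \<bar>\<phi> (x + h) - \<phi> x - (\<Sum>i\<in>Basis. (h \<bullet> i) * partial_deriv [i] \<phi> x)\<bar> \<le> M * (norm h)\<^sup>2"
    by (rule test_function_linearization[OF \<phi>]) (rule that)
  have \<phi>': "test_function UNIV (partial_deriv [i] \<phi>)" if "i \<in> Basis" for i
    using test_function_partial_deriv[OF \<phi>, of "[i]"] that by simp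
  show ?thesis
  proof (rule has_derivativeI_quadratic)
    show "bounded_linear (\<lambda>h. \<Sum>i\<in>Basis. (h \<bullet> i) * conv (partial_deriv [i] \<phi>) f x)"
      by (intro bounded_linear_sum bounded_linear_mult_const bounded_linear_inner_left)
    fix h :: 'a
    let ?E = "\<lambda>a. \<phi> (x - a + h) - \<phi> (x - a) - (\<Sum>i\<in>Basis. (h \<bullet> i) * partial_deriv [i] \<phi> (x - a))"
    have "(\<integral>a. ?E a * f a \<partial>lebesgue) = (\<integral>a. \<phi> (x + h - a) * f a - \<phi> (x - a) * f a
        - (\<Sum>i\<in>Basis. (h \<bullet> i) * (partial_deriv [i] \<phi> (x - a) * f a)) \<partial>lebesgue)"
      by (simp only: left_diff_distrib sum_distrib_right mult.assoc diff_add_eq)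
    also have "\<dots> = (\<integral>a. \<phi> (x + h - a) * f a \<partial>lebesgue) - (\<integral>a. \<phi> (x - a) * f a \<partial>lebesgue)
        - (\<integral>a. (\<Sum>i\<in>Basis. (h \<bullet> i) * (partial_deriv [i] \<phi> (x - a) * f a)) \<partial>lebesgue)"
      by (intro Bochner_Integration.integral_diff[THEN trans] arg_cong2[where f = minus] refl
          Bochner_Integration.integrable_diff Bochner_Integration.integrable_sum
          Bochner_Integration.integrable_mult_right conv_integrable[OF \<phi> f] conv_integrable[OF \<phi>' f])
    also have "(\<integral>a. (\<Sum>i\<in>Basis. (h \<bullet> i) * (partial_deriv [i] \<phi> (x - a) * f a)) \<partial>lebesgue)
        = (\<Sum>i\<in>Basis. \<integral>a. (h \<bullet> i) * (partial_deriv [i] \<phi> (x - a) * f a) \<partial>lebesgue)"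
      by (intro Bochner_Integration.integral_sum Bochner_Integration.integrable_mult_right
          conv_integrable[OF \<phi>' f])
    also have "(\<integral>a. \<phi> (x + h - a) * f a \<partial>lebesgue) - (\<integral>a. \<phi> (x - a) * f a \<partial>lebesgue) - \<dots>
        = conv \<phi> f (x + h) - conv \<phi> f x - (\<Sum>i\<in>Basis. (h \<bullet> i) * conv (partial_deriv [i] \<phi>) f x)"
      by (simp only: conv_def integral_mult_right_zero)
    finally have "conv \<phi> f (x + h) - conv \<phi> f x - (\<Sum>i\<in>Basis. (h \<bullet> i) * conv (partial_deriv [i] \<phi>) f x)
        = (\<integral>a. ?E a * f a \<partial>lebesgue)" (is "?L = _") by (rule sym)
    then have "norm ?L \<le> (\<integral>a. norm (?E a * f a) \<partial>lebesgue)"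
      using integral_norm_bound[of lebesgue "\<lambda>a. ?E a * f a"] by (simp only:)
    also have "\<dots> \<le> (\<integral>a. M * (norm h)\<^sup>2 * norm (f a) \<partial>lebesgue)"
    proof (rule integral_mono')
      show "integrable lebesgue (\<lambda>a. M * (norm h)\<^sup>2 * norm (f a))" using f by simp
      show "norm (?E a * f a) \<le> M * (norm h)\<^sup>2 * norm (f a)" for a
        unfolding norm_mult using M(2)[of "x - a" h] by (intro mult_right_mono) auto
    qed (use M(1) in auto)
    also have "\<dots> = (M * (\<integral>a. norm (f a) \<partial>lebesgue)) * (norm h)\<^sup>2" by simp
    finally show "norm ?L \<le> (M * (\<integral>a. norm (f a) \<partial>lebesgue)) * (norm h)\<^sup>2" .
  qed
qed

lemma conv_smooth:
  assumes "test_function UNIV \<phi>" "integrable lebesgue f"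
  shows "smooth (conv \<phi> f)"
proof (rule smooth_coinduct[where Q = "\<lambda>g. \<exists>\<phi>. test_function UNIV \<phi> \<and> g = conv \<phi> f"])
  show "\<exists>\<phi>'. test_function UNIV \<phi>' \<and> conv \<phi> f = conv \<phi>' f" using assms by blast
next
  fix g assume "\<exists>\<phi>. test_function UNIV \<phi> \<and> g = conv \<phi> f"
  then obtain \<phi> where \<phi>: "test_function UNIV \<phi>" and g: "g = conv \<phi> f" by blast
  note d = conv_has_derivative[OF \<phi> assms(2)]
  have "partial_deriv [i] g = conv (partial_deriv [i] \<phi>) f" if i: "i \<in> Basis" for i
  proof
    fix x
    have "partial_deriv [i] g x = (\<Sum>j\<in>Basis. (i \<bullet> j) * conv (partial_deriv [j] \<phi>) f x)"
      unfolding g by (rule partial_deriv_eqI[OF d])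
    also have "\<dots> = (\<Sum>j\<in>Basis. if j = i then conv (partial_deriv [j] \<phi>) f x else 0)"
      using i by (intro sum.cong) (auto simp: inner_Basis)
    finally show "partial_deriv [i] g x = conv (partial_deriv [i] \<phi>) f x" using i by simp
  qed
  moreover have "test_function UNIV (partial_deriv [i] \<phi>)" if "i \<in> Basis" for i
    using test_function_partial_deriv[OF \<phi>, of "[i]"] that by simp
  moreover have "g differentiable_on UNIV"
    unfolding g differentiable_on_def differentiable_def using d by blast
  ultimately show "g differentiable_on UNIV \<and>
      (\<forall>i\<in>Basis. \<exists>\<phi>. test_function UNIV \<phi> \<and> partial_deriv [i] g = conv \<phi> f)"
    by blast
qed

section \<open>Mollifiers and the fundamental lemma of the calculus of variations\<close>

text \<open>The radius of the support is that of the cut-off function from which a mollifier is built.\<close>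

definition mollifier :: "('a::euclidean_space \<Rightarrow> real) \<Rightarrow> bool" where
  "mollifier \<rho> \<longleftrightarrow> test_function (ball 0 2) \<rho> \<and> (\<forall>x. \<rho> x \<ge> 0) \<and> (\<integral>x. \<rho> x \<partial>lebesgue) = 1"

definition dilated :: "real \<Rightarrow> ('a::euclidean_space \<Rightarrow> real) \<Rightarrow> 'a \<Rightarrow> real" where
  "dilated t \<rho> x = \<rho> (x /\<^sub>R t) / t ^ DIM('a)"

lemma test_function_integrable: "test_function \<Omega> f \<Longrightarrow> integrable lebesgue f"
proof -
  assume f: "test_function \<Omega> f"
  obtain K where K: "compact K" "K \<subseteq> \<Omega>" "\<And>x. x \<notin> K \<Longrightarrow> f x = 0"
    by (rule test_function_compact_support[OF f]) (rule that)
  have "integrable lborel (\<lambda>x. indicator K x *\<^sub>R f x)"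
    using K(1) smooth_continuous_on[OF test_function_smooth[OF f]] by (intro borel_integrable_compact) auto
  moreover have "(\<lambda>x. indicator K x *\<^sub>R f x) = f" using K(3) by (intro ext) (metis indicator_simps mult_zero_left mult_1 real_scaleR_def)
  ultimately show ?thesis
    using smooth_borel[OF test_function_smooth[OF f]] by (simp add: integrable_completion)
qed

text \<open>The bump may change sign, so its square is normalised: it is nonnegative and equals \<open>1\<close> on the unit
ball, hence has a positive integral.\<close>

lemma mollifier_from_bump:
  fixes \<eta> :: "'a::euclidean_space \<Rightarrow> real"
  assumes \<eta>: "test_function (ball 0 2) \<eta>" and one: "\<forall>y\<in>ball 0 1. \<eta> y = 1"
  shows "\<exists>\<rho> :: 'a \<Rightarrow> real. mollifier \<rho>"
proof -
  let ?g = "\<lambda>x. \<eta> x * \<eta> x"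
  have g: "test_function (ball 0 2) ?g" by (rule test_function_mult[OF test_function_smooth[OF \<eta>] \<eta>])
  have "0 < measure lebesgue (ball (0::'a) 1)"
    by (simp add: content_ball_pos)
  also have "\<dots> = (\<integral>x. indicator (ball (0::'a) 1) x \<partial>lebesgue)" by simp
  also have "\<dots> \<le> (\<integral>x. ?g x \<partial>lebesgue)"
    using one by (intro integral_mono' test_function_integrable[OF g]) (auto simp: indicator_def)
  finally have pos: "0 < (\<integral>x. ?g x \<partial>lebesgue)" .
  have "test_function (ball 0 2) (\<lambda>x. (1 / (\<integral>x. ?g x \<partial>lebesgue)) * ?g x)"
    using test_function_affine[OF g, of 1 0] by (simp only: scaleR_one add_0_right Collect_mem_eq one_neq_zero not_False_eq_True)
  then have "mollifier (\<lambda>x. (1 / (\<integral>x. ?g x \<partial>lebesgue)) * ?g x)"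
    unfolding mollifier_def using pos by simp
  then show ?thesis by blast
qed

lemma lebesgue_integral_affine:
  fixes f :: "'a::euclidean_space \<Rightarrow> real"
  assumes "c \<noteq> 0" "f \<in> borel_measurable borel"
  shows "(\<integral>x. f (c *\<^sub>R x + b) \<partial>lebesgue) = (\<integral>x. f x \<partial>lebesgue) / \<bar>c\<bar> ^ DIM('a)"
proof -
  have "(\<integral>x. f x \<partial>lborel) = \<bar>c\<bar> ^ DIM('a) * (\<integral>x. f (b + c *\<^sub>R x) \<partial>lborel)"
    using assms by (subst lborel_affine[OF assms(1), of b])
      (simp add: integral_density integral_distr)
  then show ?thesis using assms by (simp add: integral_completion add.commute)
qed

lemma dilated_test_function:
  assumes "mollifier \<rho>" "t > 0"
  shows "test_function (ball 0 (2 * t)) (dilated t \<rho>)"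
proof -
  have "test_function {x. (1 / t) *\<^sub>R x + 0 \<in> ball 0 2} (\<lambda>x. (1 / t ^ DIM('a)) * \<rho> ((1 / t) *\<^sub>R x + 0))"
    using assms by (intro test_function_affine) (auto simp: mollifier_def)
  moreover have "{x::'a. (1 / t) *\<^sub>R x + 0 \<in> ball 0 2} = ball 0 (2 * t)"
    using assms(2) by (auto simp: field_simps)
  ultimately show ?thesis by (simp add: dilated_def[abs_def] divide_inverse mult.commute)
qed

lemma dilated_nonneg: "mollifier \<rho> \<Longrightarrow> t > 0 \<Longrightarrow> dilated t \<rho> x \<ge> 0"
  by (simp add: dilated_def mollifier_def)

lemma dilated_integral:
  assumes "mollifier \<rho>" "t > 0"
  shows "(\<integral>a. dilated t \<rho> (x - a) \<partial>lebesgue) = 1"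
proof -
  have \<rho>: "smooth \<rho>" using assms by (auto simp: mollifier_def test_function_smooth)
  have "(\<integral>a. \<rho> ((-1 / t) *\<^sub>R a + x /\<^sub>R t) / t ^ DIM('a) \<partial>lebesgue) = 1"
    using assms \<rho> by (subst Bochner_Integration.integral_divide_zero, subst lebesgue_integral_affine)
      (auto simp: smooth_borel mollifier_def power_divide)
  then show ?thesis by (simp add: dilated_def divide_inverse scaleR_diff_right)
qed

lemma dilated_integrable:
  assumes "mollifier \<rho>" "t > 0"
  shows "integrable lebesgue (\<lambda>a. dilated t \<rho> (x - a))"
  using dilated_integral[OF assms] not_integrable_integral_eq by fastforce

lemma dilated_outside:
  assumes "mollifier \<rho>" "t > 0" "norm x \<ge> 2 * t"
  shows "dilated t \<rho> x = 0"
  using test_function_outside[OF dilated_test_function[OF assms(1,2)]] assms(3) by simp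

text \<open>A mollified value is a weighted average over the ball of radius \<open>2 t\<close>, the dilated support.\<close>

lemma conv_average_bound:
  assumes \<rho>: "mollifier \<rho>" and t: "t > 0" and f: "integrable lebesgue f"
    and *: "\<And>a. dist x a < 2 * t \<Longrightarrow> \<bar>f a - c\<bar> \<le> e"
  shows "\<bar>conv (dilated t \<rho>) f x - c\<bar> \<le> e"
proof -
  let ?d = "dilated t \<rho>"
  have d: "test_function UNIV ?d"
    using dilated_test_function[OF \<rho> t] test_function_mono by blast
  note i = conv_integrable[OF d f, of x] dilated_integrable[OF \<rho> t, of x]
  have "conv ?d f x - c = (\<integral>a. ?d (x - a) * f a \<partial>lebesgue) - (\<integral>a. ?d (x - a) * c \<partial>lebesgue)"
    by (simp add: conv_def dilated_integral[OF \<rho> t])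
  also have "\<dots> = (\<integral>a. ?d (x - a) * (f a - c) \<partial>lebesgue)"
    using i by (simp add: right_diff_distrib Bochner_Integration.integral_diff)
  also have "\<bar>\<dots>\<bar> \<le> (\<integral>a. ?d (x - a) * e \<partial>lebesgue)"
  proof (rule order_trans[OF integral_abs_bound integral_mono'])
    show "integrable lebesgue (\<lambda>a. ?d (x - a) * e)" using i by simp
    show "\<bar>?d (x - a) * (f a - c)\<bar> \<le> ?d (x - a) * e" for a
    proof (cases "dist x a < 2 * t")
      case True
      then show ?thesis using *[OF True] dilated_nonneg[OF \<rho> t, of "x - a"]
        by (simp add: abs_mult mult_left_mono)
    next
      case False
      then show ?thesis using dilated_outside[OF \<rho> t, of "x - a"] by (simp add: dist_norm)
    qed
    then show "0 \<le> ?d (x - a) * e" for a by (rule order_trans[OF abs_ge_zero])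
  qed
  also have "\<dots> = e" by (simp add: dilated_integral[OF \<rho> t])
  finally show ?thesis .
qed

lemma loc_integrable_onD:
  assumes "loc_integrable_on u \<Omega>" "compact K" "K \<subseteq> \<Omega>"
  shows "integrable lebesgue (\<lambda>x. indicator K x *\<^sub>R u x)"
proof -
  have "K \<inter> space lebesgue \<in> sets lebesgue" using fmeasurableD[OF lmeasurable_compact[OF assms(2)]] by simp
  from integrable_restrict_space[OF this] show ?thesis
    using assms unfolding loc_integrable_on_def set_integrable_def by blast
qed

lemma loc_integrable_measurable:
  fixes u :: "'a::euclidean_space \<Rightarrow> 'b::euclidean_space"
  assumes u: "loc_integrable_on u \<Omega>" and K: "\<And>n::nat. compact (K n) \<and> K n \<subseteq> \<Omega>"
    and ev: "\<And>x. x \<in> \<Omega> \<Longrightarrow> \<forall>\<^sub>F n in sequentially. x \<in> K n"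
  shows "(\<lambda>x. indicator \<Omega> x *\<^sub>R u x) \<in> borel_measurable lebesgue"
proof (rule borel_measurable_LIMSEQ_metric)
  show "(\<lambda>x. indicator (K n) x *\<^sub>R u x) \<in> borel_measurable lebesgue" for n
    using borel_measurable_integrable[OF loc_integrable_onD[OF u]] K[of n] by blast
  show "(\<lambda>n. indicator (K n) x *\<^sub>R u x) \<longlonglongrightarrow> indicator \<Omega> x *\<^sub>R u x" for x
  proof (rule tendsto_eventually, cases "x \<in> \<Omega>")
    case True
    show "\<forall>\<^sub>F n in sequentially. indicator (K n) x *\<^sub>R u x = indicator \<Omega> x *\<^sub>R u x"
      using ev[OF True] by eventually_elim (use True in simp)
  next
    case False
    then have "x \<notin> K n" for n using K by blast
    then show "\<forall>\<^sub>F n in sequentially. indicator (K n) x *\<^sub>R u x = indicator \<Omega> x *\<^sub>R u x"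
      using False by simp
  qed
qed

lemma loc_integrable_UNIV_measurable:
  fixes u :: "'a::euclidean_space \<Rightarrow> 'b::euclidean_space"
  assumes "loc_integrable_on u UNIV"
  shows "u \<in> borel_measurable lebesgue"
proof -
  have "(\<lambda>x. indicator UNIV x *\<^sub>R u x) \<in> borel_measurable lebesgue"
  proof (rule loc_integrable_measurable[OF assms])
    show "compact (cball (0::'a) (real n)) \<and> cball (0::'a) (real n) \<subseteq> UNIV" for n by simp
    show "\<forall>\<^sub>F n in sequentially. x \<in> cball (0::'a) (real n)" for x
    proof -
      obtain N :: nat where N: "norm x \<le> real N" using real_arch_simple by blast
      show ?thesis using eventually_ge_at_top[of N] by eventually_elim (use N in auto)
    qed
  qed
  then show ?thesis by simp
qed

lemma continuous_loc_integrable: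
  fixes u :: "'a::euclidean_space \<Rightarrow> 'b::euclidean_space"
  assumes "continuous_on \<Omega> u"
  shows "loc_integrable_on u \<Omega>"
  unfolding loc_integrable_on_def
proof (intro allI impI)
  fix K assume K: "compact K \<and> K \<subseteq> \<Omega>"
  then have "set_integrable lborel K u"
    using assms continuous_on_subset unfolding set_integrable_def by (intro borel_integrable_compact) blast+
  then have "integrable lebesgue (\<lambda>x. indicator K x *\<^sub>R u x)"
    unfolding set_integrable_def by (simp add: integrable_completion)
  moreover have "K \<inter> space lebesgue \<in> sets lebesgue"
    using K by (auto intro: fmeasurableD[OF lmeasurable_compact])
  ultimately show "integrable (lebesgue_on K) u"
    using integrable_restrict_space unfolding set_integrable_def by blast
qed

lemma test_function_times_integrable:
  assumes "test_function \<Omega> \<phi>" "loc_integrable_on u \<Omega>"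
  shows "integrable lebesgue (\<lambda>x. \<phi> x *\<^sub>R u x)"
proof -
  obtain K where K: "compact K" "K \<subseteq> \<Omega>" "\<And>x. x \<notin> K \<Longrightarrow> \<phi> x = 0"
    by (rule test_function_compact_support[OF assms(1)]) (rule that)
  obtain M where M: "M > 0" "\<And>x. \<bar>\<phi> x\<bar> \<le> M"
    by (rule test_function_bounded[OF assms(1)]) (rule that)
  have "integrable lebesgue (\<lambda>x. \<phi> x *\<^sub>R (indicator K x *\<^sub>R u x))"
    using M(2) smooth_borel[OF test_function_smooth[OF assms(1)]]
    by (intro integrable_bounded_mult[where c = M] loc_integrable_onD[OF assms(2) K(1,2)] borel_imp_lebesgue)
  moreover have "(\<lambda>x. \<phi> x *\<^sub>R (indicator K x *\<^sub>R u x)) = (\<lambda>x. \<phi> x *\<^sub>R u x)"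
    using K(3) by (intro ext) (metis indicator_simps scaleR_one scaleR_zero_left)
  ultimately show ?thesis by (simp only:)
qed

lemma test_function_integral_lebesgue_on:
  fixes u :: "'a::euclidean_space \<Rightarrow> 'b::euclidean_space"
  assumes "test_function \<Omega> \<phi>" "\<Omega> \<in> sets lebesgue"
  shows "(\<integral>x. \<phi> x *\<^sub>R u x \<partial>lebesgue_on \<Omega>) = (\<integral>x. \<phi> x *\<^sub>R u x \<partial>lebesgue)"
proof -
  have "(\<lambda>x. indicator \<Omega> x *\<^sub>R (\<phi> x *\<^sub>R u x)) = (\<lambda>x. \<phi> x *\<^sub>R u x)"
    using test_function_outside[OF assms(1)]
    by (intro ext) (metis indicator_simps scaleR_one scaleR_zero_left)
  moreover have "\<Omega> \<inter> space lebesgue \<in> sets lebesgue" using assms(2) by simp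
  ultimately show ?thesis
    using integral_restrict_space[of \<Omega> lebesgue "\<lambda>x. \<phi> x *\<^sub>R u x"] by (simp only:)
qed

lemma has_weak_derivD:
  assumes "has_weak_deriv \<Omega> \<alpha> u w" "test_function \<Omega> \<phi>" "open \<Omega>" "set \<alpha> \<subseteq> Basis"
  shows "(\<integral>x. partial_deriv \<alpha> \<phi> x *\<^sub>R u x \<partial>lebesgue) = (-1) ^ length \<alpha> *\<^sub>R (\<integral>x. \<phi> x *\<^sub>R w x \<partial>lebesgue)"
proof -
  have "\<Omega> \<in> sets lebesgue" using assms(3) by simp
  then show ?thesis
    using assms test_function_integral_lebesgue_on[OF test_function_partial_deriv[OF assms(2,4)], of u]
      test_function_integral_lebesgue_on[OF assms(2), of w]
    unfolding has_weak_deriv_def by simp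
qed

text \<open>The mollifications of the indicator of a box are test functions, are bounded by \<open>1\<close>, and
  converge to the indicator off the boundary, which is a null set. So the integral of \<open>w\<close> over
  every box vanishes, and \<open>w\<close> vanishes at its Lebesgue points.\<close>

lemma fundamental_lemma:
  fixes w :: "'a::euclidean_space \<Rightarrow> 'b::euclidean_space" and \<rho> :: "'a \<Rightarrow> real"
  assumes \<rho>: "mollifier \<rho>" and w: "loc_integrable_on w UNIV"
    and zero: "\<And>\<phi>. test_function UNIV \<phi> \<Longrightarrow> (\<integral>x. \<phi> x *\<^sub>R w x \<partial>lebesgue) = 0"
  shows "AE x in lebesgue. w x = 0"
proof -
  have box: "(\<integral>x. indicator (cbox a b) x *\<^sub>R w x \<partial>lebesgue) = 0" for a b
  proof -
    let ?Q = "cbox a b"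
    let ?f = "indicator ?Q :: 'a \<Rightarrow> real"
    let ?t = "\<lambda>n. 1 / real (Suc n)"
    let ?c = "\<lambda>n. conv (dilated (?t n) \<rho>) ?f"
    have f: "integrable lebesgue ?f"
      using lmeasurable_cbox[of a b] by (simp add: fmeasurable_def)
    obtain R where R: "\<And>x. x \<in> ?Q \<Longrightarrow> norm x \<le> R"
      using bounded_cbox[of a b] unfolding bounded_iff by blast
    let ?K = "cball (0::'a) (R + 2)"
    have out: "?c n x = 0" if "x \<notin> ?K" for n x
    proof -
      have "dilated (?t n) \<rho> (x - y) * ?f y = 0" for y
      proof (cases "y \<in> ?Q")
        case True
        have "norm x - norm y \<le> norm (x - y)" by (rule norm_triangle_ineq2)
        moreover have "2 * ?t n \<le> 2" by (simp add: divide_le_eq)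
        ultimately have "2 * ?t n \<le> norm (x - y)" using R[OF True] that by simp
        then have "dilated (?t n) \<rho> (x - y) = 0" by (intro dilated_outside[OF \<rho>]) auto
        then show ?thesis by simp
      qed simp
      then show ?thesis unfolding conv_def by (simp only: integral_zero)
    qed
    have test: "test_function UNIV (?c n)" for n
    proof (rule test_functionI[of _ ?K])
      show "smooth (?c n)"
        using test_function_mono[OF dilated_test_function[OF \<rho>]] by (intro conv_smooth f) auto
    qed (use out in auto)
    have bd: "\<bar>?c n x\<bar> \<le> 1" for n x
    proof -
      \<comment> \<open>The indicator takes values within 1/2 of 1/2, and averaging preserves this.\<close>
      have "\<bar>?c n x - 1/2\<bar> \<le> 1/2"
        by (rule conv_average_bound[OF \<rho> _ f]) (auto simp: indicator_def)
      then show ?thesis unfolding abs_le_iff by linarith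
    qed
    have lim: "(\<lambda>n. ?c n x) \<longlonglongrightarrow> ?f x" if x: "x \<notin> frontier ?Q" for x
    proof -
      have "open (interior ?Q)" "open (- ?Q)" by (auto simp: open_Compl)
      moreover have "x \<in> interior ?Q \<or> x \<in> - ?Q" using x unfolding frontier_def by auto
      moreover have "interior ?Q \<subseteq> ?Q" by (rule interior_subset)
      ultimately obtain e where e0: "e > 0" "ball x e \<subseteq> ?Q \<or> ball x e \<subseteq> - ?Q"
        unfolding open_contains_ball by (metis subset_trans)
      have e: "?f y = ?f x" if "dist x y < e" for y
      proof -
        have "x \<in> ball x e" "y \<in> ball x e" using e0(1) that by auto
        then have "y \<in> ?Q \<longleftrightarrow> x \<in> ?Q" using e0(2) by blast
        then show ?thesis by (simp only: indicator_def)
      qed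
      have "(\<lambda>n. 2 * inverse (real (Suc n))) \<longlonglongrightarrow> 2 * 0"
        by (intro tendsto_mult tendsto_const LIMSEQ_inverse_real_of_nat)
      then have "\<forall>\<^sub>F n in sequentially. 2 * inverse (real (Suc n)) < e"
        using e0(1) unfolding order_tendsto_iff by simp
      then have "\<forall>\<^sub>F n in sequentially. ?c n x = ?f x"
      proof eventually_elim
        case (elim n)
        have "\<bar>?c n x - ?f x\<bar> \<le> 0"
        proof (rule conv_average_bound[OF \<rho> _ f])
          show "\<bar>?f y - ?f x\<bar> \<le> 0" if "dist x y < 2 * ?t n" for y
          proof -
            have "dist x y < e" using that elim by (simp only: inverse_eq_divide)
            then have "?f y = ?f x" by (rule e)
            then show ?thesis by (simp only: diff_self abs_zero order_refl)
          qed
        qed simp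
        then show ?case by linarith
      qed
      then show ?thesis by (rule tendsto_eventually)
    qed
    have "negligible (frontier ?Q)" by (intro negligible_convex_frontier convex_box)
    then have AE: "AE x in lebesgue. x \<notin> frontier ?Q"
      by (simp add: negligible_iff_null_sets AE_not_in)
    have K: "compact ?K" by simp
    have meas: "w \<in> borel_measurable lebesgue" by (rule loc_integrable_UNIV_measurable[OF w])
    have "(\<lambda>n. \<integral>x. ?c n x *\<^sub>R w x \<partial>lebesgue) \<longlonglongrightarrow> (\<integral>x. ?f x *\<^sub>R w x \<partial>lebesgue)"
    proof (rule integral_dominated_convergence[where w = "\<lambda>x. norm (indicator ?K x *\<^sub>R w x)"])
      show "(\<lambda>x. ?f x *\<^sub>R w x) \<in> borel_measurable lebesgue"
        using f meas by (intro borel_measurable_scaleR) auto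
      show "(\<lambda>x. ?c n x *\<^sub>R w x) \<in> borel_measurable lebesgue" for n
        by (rule borel_measurable_scaleR[OF borel_imp_lebesgue[OF smooth_borel[OF test_function_smooth[OF test]]] meas])
      show "integrable lebesgue (\<lambda>x. norm (indicator ?K x *\<^sub>R w x))"
        by (intro integrable_norm loc_integrable_onD[OF w K]) auto
      show "AE x in lebesgue. (\<lambda>n. ?c n x *\<^sub>R w x) \<longlonglongrightarrow> ?f x *\<^sub>R w x"
        using AE by eventually_elim (intro tendsto_scaleR lim tendsto_const)
      have "norm (?c n x *\<^sub>R w x) \<le> norm (indicator ?K x *\<^sub>R w x)" for n x
        using bd[of n x] out[of x n] by (cases "x \<in> ?K") (auto intro: mult_left_le_one_le)
      then show "AE x in lebesgue. norm (?c n x *\<^sub>R w x) \<le> norm (indicator ?K x *\<^sub>R w x)" for n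
        by simp
    qed
    then show ?thesis using zero[OF test] LIMSEQ_unique[OF _ tendsto_const] by simp
  qed
  have int: "integrable (lebesgue_on (cbox a b)) w" for a b
    using w by (auto simp: loc_integrable_on_def)
  have "integral (cbox a b) w = 0" for a b
    using box[of a b] lebesgue_integral_eq_integral[OF int, of a b] by (simp add: integral_restrict_space)
  moreover have "w integrable_on cbox a b" for a b
    using integrable_on_lebesgue_on[OF int] by simp
  then obtain N where N: "negligible N"
    "\<And>x e. \<lbrakk>x \<notin> N; 0 < e\<rbrakk> \<Longrightarrow>
       \<exists>d>0. \<forall>h. 0 < h \<and> h < d \<longrightarrow> norm (integral (cbox x (x + h *\<^sub>R One)) w /\<^sub>R h ^ DIM('a) - w x) < e"
    using integrable_ccontinuous_explicit by blast
  ultimately have "w x = 0" if "x \<notin> N" for x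
  proof -
    have "norm (w x) < e" if "e > 0" for e
    proof -
      obtain d where "d > 0" "\<And>h. 0 < h \<and> h < d \<Longrightarrow>
          norm (integral (cbox x (x + h *\<^sub>R One)) w /\<^sub>R h ^ DIM('a) - w x) < e"
        using N(2)[OF \<open>x \<notin> N\<close> \<open>e > 0\<close>] by blast
      from this(2)[of "d / 2"] this(1) \<open>\<And>b a. integral (cbox a b) w = 0\<close> show ?thesis by simp
    qed
    then show ?thesis by (metis less_irrefl zero_less_norm_iff)
  qed
  then have "{x \<in> space lebesgue. w x \<noteq> 0} \<subseteq> N" by blast
  moreover have "N \<in> null_sets lebesgue" using N(1) by (simp add: negligible_iff_null_sets)
  ultimately show ?thesis by (rule AE_I'[rotated])
qed

lemma has_weak_deriv_unique:
  fixes u :: "'a::euclidean_space \<Rightarrow> 'b::euclidean_space" and \<rho> :: "'a \<Rightarrow> real"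
  assumes \<rho>: "mollifier \<rho>" and w: "has_weak_deriv UNIV \<alpha> u w" "has_weak_deriv UNIV \<alpha> u w'"
    and \<alpha>: "set \<alpha> \<subseteq> Basis"
  shows "AE x in lebesgue. w x = w' x"
proof -
  have l: "loc_integrable_on w UNIV" "loc_integrable_on w' UNIV"
    using w by (auto simp: has_weak_deriv_def)
  have "AE x in lebesgue. w x - w' x = 0"
  proof (rule fundamental_lemma[OF \<rho>])
    show "loc_integrable_on (\<lambda>x. w x - w' x) UNIV"
      using l by (auto simp: loc_integrable_on_def)
    fix \<phi> :: "'a \<Rightarrow> real" assume \<phi>: "test_function UNIV \<phi>"
    have "(\<integral>x. \<phi> x *\<^sub>R w x \<partial>lebesgue) = (\<integral>x. \<phi> x *\<^sub>R w' x \<partial>lebesgue)"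
      using has_weak_derivD[OF w(1) \<phi> open_UNIV \<alpha>] has_weak_derivD[OF w(2) \<phi> open_UNIV \<alpha>] by simp
    then show "(\<integral>x. \<phi> x *\<^sub>R (w x - w' x) \<partial>lebesgue) = 0"
      using test_function_times_integrable[OF \<phi> l(1)] test_function_times_integrable[OF \<phi> l(2)]
      by (simp add: scaleR_diff_right)
  qed
  then show ?thesis by simp
qed

section \<open>Classical derivatives are weak derivatives\<close>

lemma continuous_compact_support_integrable:
  fixes f :: "'a::euclidean_space \<Rightarrow> real"
  assumes fc: "continuous_on UNIV f" and K: "compact K" "\<And>x. x \<notin> K \<Longrightarrow> f x = 0"
  shows "integrable lebesgue f"
proof -
  have "integrable lborel (\<lambda>x. indicator K x *\<^sub>R f x)"
    using K(1) fc by (intro borel_integrable_compact) (auto intro: continuous_on_subset)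
  moreover have "(\<lambda>x. indicator K x *\<^sub>R f x) = f"
    using K(2) by (intro ext) (metis indicator_simps mult_zero_left mult_1 real_scaleR_def)
  ultimately show ?thesis
    using borel_measurable_continuous_onI[OF fc] by (simp add: integrable_completion)
qed

text \<open>Difference quotients have integral zero by translation invariance, and they converge
  boundedly to the partial derivative.\<close>

lemma integral_derivative_eq_0:
  fixes f :: "'a::euclidean_space \<Rightarrow> real"
  assumes f': "\<And>x. (f has_derivative f' x) (at x)" and cont: "continuous_on UNIV (\<lambda>x. f' x i)"
    and K: "compact K" "\<And>x. x \<notin> K \<Longrightarrow> f x = 0" and i: "norm i \<le> 1"
  shows "(\<integral>x. f' x i \<partial>lebesgue) = 0"
proof -
  have fc: "continuous_on UNIV f"
    by (intro continuous_at_imp_continuous_on ballI has_derivative_continuous[OF f'])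
  have f'0: "f' x i = 0" if x: "x \<notin> K" for x
  proof -
    have "(f has_derivative (\<lambda>h. 0)) (at x)"
      by (rule has_derivative_transform_within_open[where f = "\<lambda>x. 0" and s = "- K"])
         (use K x in \<open>auto simp: compact_imp_closed\<close>)
    from has_derivative_unique[OF f' this] show ?thesis by (rule fun_cong)
  qed
  have "compact ((\<lambda>x. f' x i) ` K)"
    using K(1) cont by (intro compact_continuous_image) (auto intro: continuous_on_subset)
  then obtain M where "M > 0" and M1: "\<forall>y\<in>(\<lambda>x. f' x i) ` K. norm y \<le> M"
    using compact_imp_bounded bounded_pos by blast
  have M: "\<bar>f' x i\<bar> \<le> M" for x
  proof (cases "x \<in> K")
    case True
    then show ?thesis using M1 by simp
  qed (use f'0 \<open>M > 0\<close> in simp)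
  obtain R where R: "\<And>x. x \<in> K \<Longrightarrow> norm x \<le> R"
    using compact_imp_bounded[OF K(1)] unfolding bounded_iff by blast
  let ?t = "\<lambda>n. 1 / real (Suc n)"
  let ?d = "\<lambda>n x. (f (1 *\<^sub>R x + ?t n *\<^sub>R i) - f x) / ?t n"
  have fb: "f \<in> borel_measurable borel" using fc by (rule borel_measurable_continuous_onI)
  have fi: "integrable lebesgue f"
    by (rule continuous_compact_support_integrable[OF fc K])
  have dbound: "\<bar>?d n x\<bar> \<le> M" for n x
  proof -
    have "\<exists>s\<in>{0<..<?t n}. f (x + ?t n *\<^sub>R i) - f (x + 0 *\<^sub>R i) = f' (x + s *\<^sub>R i) ((?t n - 0) *\<^sub>R i)"
    proof (rule mvt_simple)
      fix s
      have "((\<lambda>s. x + s *\<^sub>R i) has_derivative (\<lambda>h. h *\<^sub>R i)) (at s)"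
        by (auto intro!: derivative_eq_intros)
      from diff_chain_at[OF this f']
      show "((\<lambda>s. f (x + s *\<^sub>R i)) has_derivative (\<lambda>h. f' (x + s *\<^sub>R i) (h *\<^sub>R i))) (at s within {0..?t n})"
        by (simp add: o_def has_derivative_at_withinI)
    qed simp
    then obtain s where "f (x + ?t n *\<^sub>R i) - f x = f' (x + s *\<^sub>R i) (?t n *\<^sub>R i)" by auto
    also have "\<dots> = ?t n * f' (x + s *\<^sub>R i) i"
      using has_derivative_bounded_linear[OF f'] by (simp add: linear_simps)
    finally have "?d n x = f' (x + s *\<^sub>R i) i" by simp
    then show ?thesis using M by simp
  qed
  have "(\<lambda>n. \<integral>x. ?d n x \<partial>lebesgue) \<longlonglongrightarrow> (\<integral>x. f' x i \<partial>lebesgue)"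
  proof (rule integral_dominated_convergence[where w = "\<lambda>x. M * indicator (cball (0::'a) (R + 1)) x"])
    show "(\<lambda>x. f' x i) \<in> borel_measurable lebesgue"
      using cont by (intro borel_imp_lebesgue borel_measurable_continuous_onI)
    have "(\<lambda>x. f (1 *\<^sub>R x + ?t n *\<^sub>R i)) \<in> borel_measurable borel" for n
      by (rule measurable_compose[OF _ fb]) simp
    then show "?d n \<in> borel_measurable lebesgue" for n
      using fb by (intro borel_imp_lebesgue borel_measurable_divide borel_measurable_diff) auto
    show "integrable lebesgue (\<lambda>x. M * indicator (cball (0::'a) (R + 1)) x)"
      using lmeasurable_cball[of "0::'a" "R + 1"] by (simp add: fmeasurable_def)
    have "(\<lambda>n. ?d n x) \<longlonglongrightarrow> f' x i" for x
    proof -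
      have "((\<lambda>s. x + s *\<^sub>R i) has_derivative (\<lambda>h. h *\<^sub>R i)) (at 0)"
        by (auto intro!: derivative_eq_intros)
      from diff_chain_at[OF this f'[of "x + 0 *\<^sub>R i"]]
      have "((\<lambda>s. f (x + s *\<^sub>R i)) has_derivative (\<lambda>h. h * f' x i)) (at 0)"
        using has_derivative_bounded_linear[OF f'[of x]] by (simp add: o_def linear_simps)
      then have "((\<lambda>s. f (x + s *\<^sub>R i)) has_field_derivative f' x i) (at 0)"
        unfolding has_field_derivative_def
        by (rule has_derivative_eq_rhs) (simp add: fun_eq_iff mult.commute)
      then have "((\<lambda>h. (f (x + h *\<^sub>R i) - f x) / h) \<longlongrightarrow> f' x i) (at 0)"
        by (simp add: DERIV_def)
      moreover have "filterlim ?t (at 0) sequentially"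
        using LIMSEQ_inverse_real_of_nat by (simp add: filterlim_at inverse_eq_divide)
      ultimately show ?thesis by (simp only: scaleR_one) (rule filterlim_compose)
    qed
    then show "AE x in lebesgue. (\<lambda>n. ?d n x) \<longlonglongrightarrow> f' x i" by simp
    have "norm (?d n x) \<le> M * indicator (cball (0::'a) (R + 1)) x" for n x
    proof (cases "x \<in> cball 0 (R + 1)")
      case True
      then show ?thesis using dbound[of x n] by simp
    next
      case False
      have "norm (?t n *\<^sub>R i) \<le> 1" using i by (simp add: mult_le_one divide_le_eq)
      moreover have "norm x \<le> norm (x + ?t n *\<^sub>R i) + norm (?t n *\<^sub>R i)"
        by (metis add_diff_cancel_right' norm_triangle_ineq4)
      moreover have "norm x > R + 1" using False by simp
      ultimately have "norm (x + ?t n *\<^sub>R i) > R" "norm x > R" by linarith+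
      then have "x \<notin> K" "x + ?t n *\<^sub>R i \<notin> K" using R by (meson linorder_not_less)+
      then show ?thesis using K(2) False by simp
    qed
    then show "AE x in lebesgue. norm (?d n x) \<le> M * indicator (cball (0::'a) (R + 1)) x" for n by simp
  qed
  moreover have "(\<integral>x. ?d n x \<partial>lebesgue) = 0" for n
  proof -
    have shift: "(\<integral>x. f (1 *\<^sub>R x + b) \<partial>lebesgue) = (\<integral>x. f x \<partial>lebesgue)" for b
      by (subst lebesgue_integral_affine) (auto simp: fb)
    have "integrable lebesgue (\<lambda>x. f (1 *\<^sub>R x + b))" for b
    proof (rule continuous_compact_support_integrable)
      show "continuous_on UNIV (\<lambda>x. f (1 *\<^sub>R x + b))"
        by (intro continuous_on_compose2[OF fc] continuous_intros) auto
      show "compact ((\<lambda>x. x - b) ` K)"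
        using K(1) by (intro compact_continuous_image continuous_intros)
      show "f (1 *\<^sub>R x + b) = 0" if "x \<notin> (\<lambda>x. x - b) ` K" for x
        using that by (intro K(2)) (metis add_diff_cancel_right' image_eqI scaleR_one)
    qed
    from Bochner_Integration.integral_diff[OF this fi] show ?thesis
      by (simp only: integral_divide_zero shift) simp
  qed
  ultimately show ?thesis using LIMSEQ_unique[OF _ tendsto_const] by simp
qed

lemma C1_has_weak_deriv:
  fixes f :: "'a::euclidean_space \<Rightarrow> real"
  assumes f': "\<And>x. (f has_derivative f' x) (at x)" and cont: "continuous_on UNIV (\<lambda>x. f' x i)"
    and i: "i \<in> Basis"
  shows "has_weak_deriv UNIV [i] f (\<lambda>x. f' x i)"
proof -
  have fc: "continuous_on UNIV f"
    by (intro continuous_at_imp_continuous_on ballI has_derivative_continuous[OF f'])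
  note l = continuous_loc_integrable[OF fc] continuous_loc_integrable[OF cont]
  have "(\<integral>x. partial_deriv [i] \<phi> x *\<^sub>R f x \<partial>lebesgue) = - (\<integral>x. \<phi> x *\<^sub>R f' x i \<partial>lebesgue)"
    if \<phi>: "test_function UNIV \<phi>" for \<phi>
  proof -
    note s = test_function_smooth[OF \<phi>]
    have \<phi>': "test_function UNIV (partial_deriv [i] \<phi>)"
      using i by (intro test_function_partial_deriv \<phi>) simp
    obtain K where K: "compact K" "K \<subseteq> UNIV" "\<And>x. x \<notin> K \<Longrightarrow> \<phi> x = 0"
      by (rule test_function_compact_support[OF \<phi>]) (rule that)
    have d: "(\<phi> has_derivative frechet_derivative \<phi> (at x)) (at x)" for x
      using smooth_differentiable[OF s] frechet_derivative_works by blast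
    have "(\<integral>x. \<phi> x * f' x i + frechet_derivative \<phi> (at x) i * f x \<partial>lebesgue) = 0"
    proof (rule integral_derivative_eq_0[where K = K])
      show "((\<lambda>x. \<phi> x * f x) has_derivative (\<lambda>h. \<phi> x * f' x h + frechet_derivative \<phi> (at x) h * f x)) (at x)" for x
        by (rule has_derivative_mult[OF d f'])
      show "continuous_on UNIV (\<lambda>x. \<phi> x * f' x i + frechet_derivative \<phi> (at x) i * f x)"
        unfolding partial_deriv_single[symmetric]
        by (intro continuous_on_add continuous_on_mult cont fc smooth_continuous_on[OF s]
            smooth_continuous_on[OF test_function_smooth[OF \<phi>']])
      show "\<phi> x * f x = 0" if "x \<notin> K" for x using K(3)[OF that] by simp
    qed (use K(1) i in simp_all)
    moreover have "integrable lebesgue (\<lambda>x. \<phi> x * f' x i)" "integrable lebesgue (\<lambda>x. frechet_derivative \<phi> (at x) i * f x)"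
      using test_function_times_integrable[OF \<phi> l(2)] test_function_times_integrable[OF \<phi>' l(1)]
      unfolding partial_deriv_single real_scaleR_def .
    ultimately show ?thesis by (simp add: partial_deriv_single)
  qed
  then show ?thesis unfolding has_weak_deriv_def lebesgue_on_UNIV_eq using l by simp
qed

section \<open>Radial integrals over dyadic shells\<close>

lemma dyadic_index:
  assumes "(s::real) \<ge> 1"
  shows "\<exists>k::nat. 2 ^ k \<le> s \<and> s < 2 ^ Suc k"
proof -
  obtain n where n: "s < 2 ^ n" using real_arch_pow[of 2 s] by auto
  define m where "m = (LEAST n. s < 2 ^ n)"
  have m: "s < 2 ^ m" unfolding m_def by (rule LeastI[of "\<lambda>n. s < 2 ^ n", OF n])
  with assms have "m \<noteq> 0" by (intro notI) simp
  then obtain k where k: "m = Suc k" using not0_implies_Suc by blast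
  have "\<not> s < 2 ^ k" using not_less_Least[of k "\<lambda>n. s < 2 ^ n"] k m_def by simp
  with m k show ?thesis by (intro exI[of _ k]) simp
qed

text \<open>The shells are the sets where the bound \<open>c k\<close> applies; the sum of the constants over the enclosing
balls majorises the integrand.\<close>

lemma nn_integral_shells:
  fixes g :: "'a::euclidean_space \<Rightarrow> ennreal"
  assumes c: "\<And>k. c k \<ge> 0" and r: "\<And>k. r k \<ge> 0"
    and g: "\<And>x. g x \<noteq> 0 \<Longrightarrow> \<exists>k::nat. dist y x \<le> r k \<and> g x \<le> ennreal (c k)"
    and S: "(\<lambda>k. c k * (unit_ball_vol (real DIM('a)) * r k ^ DIM('a))) sums S"
  shows "(\<integral>\<^sup>+x. g x \<partial>lborel) \<le> ennreal S"
proof -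
  let ?h = "\<lambda>k x. ennreal (c k) * indicator (cball y (r k)) x"
  have "g x \<le> (\<Sum>k. ?h k x)" for x
  proof (cases "g x = 0")
    case False
    then obtain k where "dist y x \<le> r k" "g x \<le> ennreal (c k)" using g by blast
    then have "g x \<le> ?h k x" by (simp add: indicator_def)
    also have "\<dots> \<le> (\<Sum>k. ?h k x)"
    proof -
      have "h k \<le> suminf h" for h :: "nat \<Rightarrow> ennreal"
        using sum_le_suminf[of h "{k}"] by simp
      then show ?thesis .
    qed
    finally show ?thesis .
  qed simp
  then have "(\<integral>\<^sup>+x. g x \<partial>lborel) \<le> (\<integral>\<^sup>+x. (\<Sum>k. ?h k x) \<partial>lborel)" by (intro nn_integral_mono)
  also have "\<dots> = (\<Sum>k. \<integral>\<^sup>+x. ?h k x \<partial>lborel)" by (intro nn_integral_suminf borel_measurable_times_ennreal borel_measurable_indicator) auto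
  also have "\<dots> = (\<Sum>k. ennreal (c k * (unit_ball_vol (real DIM('a)) * r k ^ DIM('a))))"
    using c r by (simp add: nn_integral_cmult_indicator emeasure_cball ennreal_mult)
  also have "\<dots> = ennreal S"
    using c r S by (intro suminf_ennreal_eq) (auto intro!: mult_nonneg_nonneg)
  finally show ?thesis .
qed

lemma half_powr_less_one: "a > 0 \<Longrightarrow> (1/2::real) powr a < 1"
  using powr_less_mono2[of a "1/2" 1] by simp

lemma radial_shell_sum:
  assumes "a > 0" "\<rho> > 0"
  shows "(\<lambda>k. C * (\<rho> * (1/2) powr (a * real k))) sums (C * (\<rho> / (1 - (1/2) powr a)))"
proof -
  have "(\<lambda>k. ((1/2::real) powr a) ^ k) sums (1 / (1 - (1/2) powr a))"
    using assms by (intro geometric_sums) (simp add: half_powr_less_one)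
  from sums_mult[OF this, of "C * \<rho>"] show ?thesis
    by (simp add: powr_powr[symmetric] powr_realpow mult.assoc)
qed

text \<open>The sum of the geometric series over dyadic shells that bounds both the integral of \<open>|x| powr (a - d)\<close>
over the unit ball and that of \<open>|x| powr (- a - d)\<close> over its complement. The first argument only
carries the dimension \<open>d\<close>.\<close>

definition radial_const :: "'a::euclidean_space itself \<Rightarrow> real \<Rightarrow> real" where
  "radial_const _ a = 2 ^ DIM('a) * unit_ball_vol (real DIM('a)) / (1 - (1/2) powr a)"

lemma radial_const_nonneg: "a > 0 \<Longrightarrow> radial_const TYPE('a::euclidean_space) a \<ge> 0"
  unfolding radial_const_def by (intro divide_nonneg_pos) (simp_all add: half_powr_less_one)

text \<open>The shell of radius \<open>\<rho> / 2 ^ k\<close> contributes a multiple of \<open>(\<rho> / 2 ^ k) powr a\<close>, which is summable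
because \<open>a > 0\<close>. The factor \<open>2 powr d\<close> covers both signs of the exponent \<open>a - d\<close>.\<close>

lemma nn_integral_radial_near:
  fixes y :: "'a::euclidean_space"
  assumes a: "a > 0" and \<rho>: "\<rho> > 0"
  shows "(\<integral>\<^sup>+x. (if norm (x - y) < \<rho> then ennreal (norm (x - y) powr (a - real DIM('a))) else 0) \<partial>lborel)
    \<le> ennreal (radial_const TYPE('a) a * \<rho> powr a)"
proof -
  let ?d = "real DIM('a)"
  let ?r = "\<lambda>k::nat. \<rho> / 2 ^ k"
  let ?c = "\<lambda>k. 2 powr ?d * ?r k powr (a - ?d)"
  have r: "?r k = \<rho> * (1/2) powr real k" for k
    by (simp add: powr_realpow power_divide)
  have E: "?c k * (unit_ball_vol ?d * ?r k ^ DIM('a))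
      = 2 powr ?d * unit_ball_vol ?d * (\<rho> powr a * (1/2) powr (a * real k))" for k
  proof -
    have "?r k powr (a - ?d) * ?r k ^ DIM('a) = ?r k powr (a - ?d) * ?r k powr ?d"
      using \<rho> by (simp add: powr_realpow)
    also have "\<dots> = ?r k powr a" by (simp flip: powr_add)
    also have "\<dots> = \<rho> powr a * (1/2) powr (a * real k)"
      unfolding r using \<rho> by (simp add: powr_mult powr_powr mult.commute)
    finally show ?thesis by (simp add: mult.commute mult.left_commute)
  qed
  have S: "(\<lambda>k. ?c k * (unit_ball_vol ?d * ?r k ^ DIM('a))) sums
      (radial_const TYPE('a) a * \<rho> powr a)"
    unfolding E using radial_shell_sum[OF a, of "\<rho> powr a" "2 powr ?d * unit_ball_vol ?d"] \<rho>
    by (simp add: radial_const_def powr_realpow)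
  show ?thesis
  proof (rule nn_integral_shells[OF _ _ _ S, where y = y])
    fix x assume "(if norm (x - y) < \<rho> then ennreal (norm (x - y) powr (a - ?d)) else 0) \<noteq> 0"
    then have x: "norm (x - y) < \<rho>" "norm (x - y) > 0" by (auto split: if_splits)
    let ?t = "norm (x - y)"
    obtain k where k: "2 ^ k \<le> \<rho> / ?t" "\<rho> / ?t < 2 ^ Suc k"
      using dyadic_index[of "\<rho> / ?t"] x by auto
    have t: "?t \<le> ?r k" "?r k / 2 \<le> ?t" using k x by (simp_all add: field_simps)
    have "?t powr (a - ?d) \<le> ?c k"
    proof (cases "a - ?d \<ge> 0")
      case True
      then have "?t powr (a - ?d) \<le> ?r k powr (a - ?d)" using t x by (intro powr_mono2) auto
      also have "\<dots> \<le> ?c k"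
        using mult_right_mono[of 1 "2 powr ?d" "?r k powr (a - ?d)"] by (simp add: ge_one_powr_ge_zero)
      finally show ?thesis .
    next
      case False
      then have "?t powr (a - ?d) \<le> (?r k / 2) powr (a - ?d)"
        using t x \<rho> by (intro powr_mono2') auto
      also have "\<dots> = 2 powr (?d - a) * ?r k powr (a - ?d)"
        using \<rho> powr_minus_divide[of 2 "a - ?d"] powr_divide[of "?r k" 2 "a - ?d"] by (simp only:) simp
      also have "\<dots> \<le> ?c k" using a by (intro mult_right_mono) auto
      finally show ?thesis .
    qed
    then show "\<exists>k. dist y x \<le> ?r k \<and>
        (if norm (x - y) < \<rho> then ennreal (norm (x - y) powr (a - ?d)) else 0) \<le> ennreal (?c k)"
      using t x by (intro exI[of _ k]) (simp add: dist_norm norm_minus_commute ennreal_leI)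
  qed (use \<rho> in auto)
qed

lemma nn_integral_radial_far:
  fixes y :: "'a::euclidean_space"
  assumes a: "a > 0" and \<rho>: "\<rho> > 0"
  shows "(\<integral>\<^sup>+x. (if norm (x - y) \<ge> \<rho> then ennreal (norm (x - y) powr (- a - real DIM('a))) else 0) \<partial>lborel)
    \<le> ennreal (radial_const TYPE('a) a * \<rho> powr (- a))"
proof -
  let ?d = "real DIM('a)"
  let ?r = "\<lambda>k::nat. \<rho> * 2 ^ Suc k"
  let ?c = "\<lambda>k. (\<rho> * 2 ^ k) powr (- a - ?d)"
  have E: "?c k * (unit_ball_vol ?d * ?r k ^ DIM('a))
      = 2 powr ?d * unit_ball_vol ?d * (\<rho> powr (- a) * (1/2) powr (a * real k))" for k
  proof -
    have "?c k * ?r k ^ DIM('a) = 2 powr ?d * ((\<rho> * 2 ^ k) powr (- a - ?d) * (\<rho> * 2 ^ k) powr ?d)"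
      using \<rho> by (simp add: powr_realpow power_mult_distrib)
    also have "\<dots> = 2 powr ?d * (\<rho> * 2 ^ k) powr (- a)" by (simp flip: powr_add)
    also have "(\<rho> * 2 ^ k) powr (- a) = \<rho> powr (- a) * (1/2) powr (a * real k)"
    proof -
      have "(2 ^ k :: real) powr (- a) = (1/2) powr (a * real k)"
        by (simp add: powr_realpow[symmetric] powr_powr powr_divide powr_minus_divide mult.commute)
      then show ?thesis using \<rho> by (simp add: powr_mult)
    qed
    finally show ?thesis by (simp add: mult.commute mult.left_commute)
  qed
  have S: "(\<lambda>k. ?c k * (unit_ball_vol ?d * ?r k ^ DIM('a))) sums
      (radial_const TYPE('a) a * \<rho> powr (- a))"
    unfolding E using radial_shell_sum[OF a, of "\<rho> powr (- a)" "2 powr ?d * unit_ball_vol ?d"] \<rho>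
    by (simp add: radial_const_def powr_realpow)
  show ?thesis
  proof (rule nn_integral_shells[OF _ _ _ S, where y = y])
    fix x assume "(if norm (x - y) \<ge> \<rho> then ennreal (norm (x - y) powr (- a - ?d)) else 0) \<noteq> 0"
    then have x: "norm (x - y) \<ge> \<rho>" by (auto split: if_splits)
    let ?t = "norm (x - y)"
    obtain k where k: "2 ^ k \<le> ?t / \<rho>" "?t / \<rho> < 2 ^ Suc k"
      using dyadic_index[of "?t / \<rho>"] x \<rho> by auto
    have t: "?t \<le> ?r k" "\<rho> * 2 ^ k \<le> ?t" using k \<rho> by (simp_all add: field_simps)
    have "?t powr (- a - ?d) \<le> ?c k"
      using t \<rho> a by (intro powr_mono2') auto
    then show "\<exists>k. dist y x \<le> ?r k \<and>
        (if norm (x - y) \<ge> \<rho> then ennreal (norm (x - y) powr (- a - ?d)) else 0) \<le> ennreal (?c k)"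
      using t x by (intro exI[of _ k]) (simp add: dist_norm norm_minus_commute ennreal_leI)
  qed (use \<rho> in auto)
qed

section \<open>A trace inequality\<close>

text \<open>The factor of \<open>v\<close> tends to \<open>1\<close> with \<open>\<delta>\<close>. When the inequality is iterated with a geometric sequence of
values \<open>\<delta>\<close>, the product of these factors stays bounded.\<close>

lemma powr_weighted_triangle:
  fixes u v \<delta> q :: real
  assumes "u \<ge> 0" "v \<ge> 0" "\<delta> > 0" "q \<ge> 0"
  shows "u powr q \<le> (1 + \<delta>) powr q * v powr q + (1 + 1 / \<delta>) powr q * \<bar>u - v\<bar> powr q"
proof (cases "\<bar>u - v\<bar> \<le> \<delta> * v")
  case True
  then have "u \<le> (1 + \<delta>) * v" by (simp add: algebra_simps)
  then have "u powr q \<le> ((1 + \<delta>) * v) powr q" using assms by (intro powr_mono2) auto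
  also have "\<dots> = (1 + \<delta>) powr q * v powr q" using assms by (simp add: powr_mult)
  finally show ?thesis by (simp add: add_increasing2)
next
  case False
  then have "v \<le> (1 / \<delta>) * \<bar>u - v\<bar>" using assms by (simp add: field_simps)
  then have "u \<le> (1 + 1 / \<delta>) * \<bar>u - v\<bar>" by (simp add: algebra_simps)
  then have "u powr q \<le> ((1 + 1 / \<delta>) * \<bar>u - v\<bar>) powr q" using assms by (intro powr_mono2) auto
  also have "\<dots> = (1 + 1 / \<delta>) powr q * \<bar>u - v\<bar> powr q" using assms by (simp add: powr_mult)
  finally show ?thesis by (simp add: add_increasing)
qed

text \<open>The multiplicative errors have the convergent product \<open>exp (q / (1 - \<theta>))\<close>, and the additive ones
sum up to at most \<open>B / (1 - \<tau>)\<close>.\<close>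

lemma perturbed_recursion_bound:
  fixes J :: "nat \<Rightarrow> ennreal"
  assumes step: "\<And>k. J (Suc k) \<le> ennreal (exp (q * \<theta> ^ k)) * J k + ennreal (B * \<tau> ^ k)"
    and J0: "J 0 \<le> ennreal j" and pos: "j \<ge> 0" "B \<ge> 0" "q \<ge> 0" "0 \<le> \<theta>" "\<theta> < 1" "0 \<le> \<tau>" "\<tau> < 1"
  shows "J k \<le> ennreal (exp (q / (1 - \<theta>)) * (j + B / (1 - \<tau>)))"
proof -
  let ?a = "\<lambda>k. exp (q * (\<Sum>i<k. \<theta> ^ i))" and ?b = "\<lambda>k. j + B * (\<Sum>i<k. \<tau> ^ i)"
  have "J k \<le> ennreal (?a k * ?b k)"
  proof (induction k)
    case 0
    then show ?case using J0 by simp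
  next
    case (Suc k)
    have "J (Suc k) \<le> ennreal (exp (q * \<theta> ^ k)) * ennreal (?a k * ?b k) + ennreal (B * \<tau> ^ k)"
      by (rule order_trans[OF step]) (intro add_mono mult_left_mono Suc order_refl, simp)
    also have "\<dots> = ennreal (exp (q * \<theta> ^ k) * (?a k * ?b k) + B * \<tau> ^ k)"
      using pos by (simp add: ennreal_mult[symmetric] ennreal_plus[symmetric] sum_nonneg
          del: ennreal_plus)
    also have "\<dots> \<le> ennreal (?a (Suc k) * ?b (Suc k))"
    proof (rule ennreal_leI)
      have "exp (q * \<theta> ^ k) * (?a k * ?b k) = ?a (Suc k) * ?b k"
        by (simp add: exp_add[symmetric] algebra_simps mult_exp_exp)
      moreover have "1 \<le> ?a (Suc k)" using pos by (simp add: sum_nonneg)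
      then have "B * \<tau> ^ k \<le> ?a (Suc k) * (B * \<tau> ^ k)"
        using mult_right_mono[of 1 "?a (Suc k)" "B * \<tau> ^ k"] pos by simp
      ultimately show "exp (q * \<theta> ^ k) * (?a k * ?b k) + B * \<tau> ^ k \<le> ?a (Suc k) * ?b (Suc k)"
        by (simp add: algebra_simps)
    qed
    finally show ?case .
  qed
  also have "\<dots> \<le> ennreal (exp (q / (1 - \<theta>)) * (j + B / (1 - \<tau>)))"
  proof (rule ennreal_leI)
    have geo: "(\<Sum>i<k. x ^ i) \<le> 1 / (1 - x)" if "0 \<le> x" "x < 1" for x :: real
      using that by (simp add: sum_gp_strict divide_right_mono)
    show "?a k * ?b k \<le> exp (q / (1 - \<theta>)) * (j + B / (1 - \<tau>))"
      using geo[of \<theta>] geo[of \<tau>] pos mult_left_mono[OF geo[of \<theta>], of q] mult_left_mono[OF geo[of \<tau>], of B]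
      by (intro mult_mono) (auto simp: sum_nonneg)
  qed
  finally show ?thesis .
qed

text \<open>The density of the uniform distribution on the ball of radius \<open>\<rho>\<close> about \<open>x\<close>.\<close>

definition ball_kernel :: "real \<Rightarrow> 'a::euclidean_space \<Rightarrow> 'a \<Rightarrow> ennreal" where
  "ball_kernel \<rho> x y =
     (if dist x y < \<rho> then ennreal (1 / (unit_ball_vol (real DIM('a)) * \<rho> ^ DIM('a))) else 0)"

lemma ball_kernel_measurable [measurable (raw)]:
  fixes f g :: "'b \<Rightarrow> 'a::euclidean_space"
  assumes [measurable]: "f \<in> borel_measurable M" "g \<in> borel_measurable M"
  shows "(\<lambda>x. ball_kernel \<rho> (f x) (g x)) \<in> borel_measurable M"
  unfolding ball_kernel_def by measurable

lemma ball_kernel_integral: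
  assumes "\<rho> > 0"
  shows "(\<integral>\<^sup>+y. ball_kernel \<rho> (x::'a::euclidean_space) y \<partial>lborel) = 1"
proof -
  let ?v = "unit_ball_vol (real DIM('a)) * \<rho> ^ DIM('a)"
  have v: "?v > 0" using assms by simp
  have "(\<integral>\<^sup>+y. ball_kernel \<rho> x y \<partial>lborel) = (\<integral>\<^sup>+y. ennreal (1 / ?v) * indicator (ball x \<rho>) y \<partial>lborel)"
    by (intro nn_integral_cong) (simp add: ball_kernel_def)
  also have "\<dots> = ennreal (1 / ?v) * emeasure lborel (ball x \<rho>)"
    by (rule nn_integral_cmult_indicator) simp
  also have "\<dots> = ennreal (1 / ?v * ?v)"
    using v assms by (simp add: emeasure_ball ennreal_mult[symmetric])
  also have "1 / ?v * ?v = 1" using v by (metis less_irrefl nonzero_eq_divide_eq)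
  finally show ?thesis by (simp only: ennreal_1)
qed

text \<open>The hypothesis on \<open>W\<close> is averaged in both variables with respect to the product of the two probability
densities.\<close>

lemma weighted_average_step:
  fixes \<alpha> \<beta> W :: "'a::euclidean_space \<Rightarrow> ennreal"
  assumes [measurable]: "\<alpha> \<in> borel_measurable borel" "\<beta> \<in> borel_measurable borel"
    "W \<in> borel_measurable borel" "(\<lambda>(a, b). \<Delta> a b) \<in> borel_measurable (lborel \<Otimes>\<^sub>M lborel)"
    and \<alpha>: "(\<integral>\<^sup>+a. \<alpha> a \<partial>lborel) = 1" and \<beta>: "(\<integral>\<^sup>+b. \<beta> b \<partial>lborel) = 1"
    and le: "\<And>a b. W a \<le> p * W b + s * \<Delta> a b"
  shows "(\<integral>\<^sup>+a. \<alpha> a * W a \<partial>lborel)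
    \<le> p * (\<integral>\<^sup>+b. \<beta> b * W b \<partial>lborel) + s * (\<integral>\<^sup>+a. \<alpha> a * (\<integral>\<^sup>+b. \<beta> b * \<Delta> a b \<partial>lborel) \<partial>lborel)"
proof -
  have [measurable]: "\<Delta> a \<in> borel_measurable borel" for a
    using measurable_Pair2[OF assms(4), of a] by simp
  have W: "W a \<le> p * (\<integral>\<^sup>+b. \<beta> b * W b \<partial>lborel) + s * (\<integral>\<^sup>+b. \<beta> b * \<Delta> a b \<partial>lborel)" for a
  proof -
    have "W a = (\<integral>\<^sup>+b. \<beta> b * W a \<partial>lborel)" by (simp add: nn_integral_multc \<beta>)
    also have "\<dots> \<le> (\<integral>\<^sup>+b. p * (\<beta> b * W b) + s * (\<beta> b * \<Delta> a b) \<partial>lborel)"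
    proof (rule nn_integral_mono)
      fix b
      have "\<beta> b * W a \<le> \<beta> b * (p * W b + s * \<Delta> a b)" by (intro mult_left_mono le) simp
      then show "\<beta> b * W a \<le> p * (\<beta> b * W b) + s * (\<beta> b * \<Delta> a b)"
        by (simp add: distrib_left mult.left_commute)
    qed
    also have "\<dots> = p * (\<integral>\<^sup>+b. \<beta> b * W b \<partial>lborel) + s * (\<integral>\<^sup>+b. \<beta> b * \<Delta> a b \<partial>lborel)"
      by (simp add: nn_integral_add nn_integral_cmult)
    finally show ?thesis .
  qed
  let ?M = "\<integral>\<^sup>+b. \<beta> b * W b \<partial>lborel" and ?N = "\<lambda>a. \<integral>\<^sup>+b. \<beta> b * \<Delta> a b \<partial>lborel"
  have [measurable]: "?N \<in> borel_measurable borel"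
    using assms(4) by measurable
  have "(\<integral>\<^sup>+a. \<alpha> a * W a \<partial>lborel) \<le> (\<integral>\<^sup>+a. \<alpha> a * (p * ?M) + s * (\<alpha> a * ?N a) \<partial>lborel)"
  proof (rule nn_integral_mono)
    fix a
    have "\<alpha> a * W a \<le> \<alpha> a * (p * ?M + s * ?N a)" by (intro mult_left_mono W) simp
    then show "\<alpha> a * W a \<le> \<alpha> a * (p * ?M) + s * (\<alpha> a * ?N a)"
      by (simp add: distrib_left mult.left_commute)
  qed
  also have "\<dots> = p * ?M + s * (\<integral>\<^sup>+a. \<alpha> a * ?N a \<partial>lborel)"
    by (simp add: nn_integral_add nn_integral_cmult nn_integral_multc \<alpha>)
  finally show ?thesis .
qed

text \<open>The bound of \<open>perturbed_recursion_bound\<close> for the averages in the proof of the trace inequality, and the factor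
\<open>2 powr q\<close> lost in comparing \<open>w\<close> with its averages.\<close>

definition trace_const :: "'a::euclidean_space itself \<Rightarrow> real \<Rightarrow> real \<Rightarrow> real \<Rightarrow> real" where
  "trace_const _ q \<sigma> \<epsilon> =
     (let v = unit_ball_vol (real DIM('a)) in
      2 powr q * (exp (q / (1 - 2 powr (- \<epsilon> / (2 * q)))) *
        (1 / v + 2 powr q * 2 powr (2 * real DIM('a) + \<sigma> * q) / v\<^sup>2 / (1 - 2 powr (- \<epsilon> / 2)))))"

text \<open>Let \<open>J k\<close> be the integral of the averages of \<open>w powr q\<close> over balls of radius \<open>2 powr (- k)\<close> against \<open>D\<close>. Passing from
\<open>k\<close> to \<open>k + 1\<close> costs the mean oscillation of \<open>w\<close> at this scale. By the growth of \<open>D\<close> its integral against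
\<open>D\<close> is at most a multiple of the energy of \<open>w\<close> times \<open>2 powr (- k * \<epsilon>)\<close>: the kernel of the energy and the normalisation
of the averages cancel the rest of the growth exponent. So \<open>J k\<close> is bounded in \<open>k\<close>. As \<open>k\<close> grows the
averages approximate \<open>w powr q\<close> in mean with respect to Lebesgue measure, and since \<open>D\<close> is bounded also in
mean with respect to \<open>D\<close>.\<close>

lemma trace_inequality_bounded:
  fixes w :: "'a::euclidean_space \<Rightarrow> real" and D :: "'a \<Rightarrow> ennreal"
  defines "d \<equiv> real DIM('a)"
  assumes w [measurable]: "w \<in> borel_measurable borel" and w0: "\<And>x. w x \<ge> 0"
    and D [measurable]: "D \<in> borel_measurable borel" and Dn: "\<And>x. D x \<le> ennreal n"
    and q: "q > 0" and \<sigma>: "\<sigma> > 0" and \<epsilon>: "\<epsilon> > 0" and K: "K \<ge> 0" and n: "n \<ge> 0"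
    and growth: "\<And>a \<rho>. 0 < \<rho> \<Longrightarrow> \<rho> \<le> 1 \<Longrightarrow>
       (\<integral>\<^sup>+x. (if dist x a < \<rho> then D x else 0) \<partial>lborel) \<le> ennreal (K * \<rho> powr (d - \<sigma> * q + \<epsilon>))"
    and L: "(\<integral>\<^sup>+x. ennreal (w x powr q) \<partial>lborel) \<le> 1"
    and E: "(\<integral>\<^sup>+x. (\<integral>\<^sup>+y. ennreal (\<bar>w x - w y\<bar> powr q / norm (x - y) powr (d + \<sigma> * q)) \<partial>lborel) \<partial>lborel) \<le> 1"
  shows "(\<integral>\<^sup>+x. ennreal (w x powr q) * D x \<partial>lborel) \<le> ennreal (trace_const TYPE('a) q \<sigma> \<epsilon> * K)"
proof -
  define v where "v = unit_ball_vol d"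
  have v: "v > 0" unfolding v_def d_def by simp
  define r :: "nat \<Rightarrow> real" where "r k = 1 / 2 ^ k" for k
  have r: "r k > 0" "r k \<le> 1" "r (Suc k) \<le> r k" "r k = 2 powr (- real k)" for k
    by (auto simp: r_def powr_minus_divide powr_realpow divide_simps)
  define W where "W x = ennreal (w x powr q)" for x
  define \<Delta> where "\<Delta> a b = ennreal (\<bar>w a - w b\<bar> powr q)" for a b
  define e where "e a b = ennreal (\<bar>w a - w b\<bar> powr q / norm (a - b) powr (d + \<sigma> * q))" for a b
  have [measurable]: "W \<in> borel_measurable borel" unfolding W_def by measurable
  have [measurable]: "(\<lambda>(a, b). \<Delta> a b) \<in> borel_measurable (lborel \<Otimes>\<^sub>M lborel)"
    unfolding \<Delta>_def by measurable
  have [measurable]: "(\<lambda>(a, b). e a b) \<in> borel_measurable (lborel \<Otimes>\<^sub>M lborel)"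
    unfolding e_def by measurable
  have [measurable]: "\<Delta> a \<in> borel_measurable borel" for a unfolding \<Delta>_def by measurable
  let ?\<kappa> = "\<lambda>k. ball_kernel (r k) :: 'a \<Rightarrow> 'a \<Rightarrow> ennreal"
  have [measurable]: "(\<lambda>x. \<integral>\<^sup>+a. ?\<kappa> k x a * W a \<partial>lborel) \<in> borel_measurable borel" for k
    by measurable
  have [measurable]: "(\<lambda>x. \<integral>\<^sup>+a. ?\<kappa> (Suc k) x a * (\<integral>\<^sup>+b. ?\<kappa> k x b * \<Delta> a b \<partial>lborel) \<partial>lborel)
      \<in> borel_measurable borel" for k
    unfolding \<Delta>_def by measurable
  have [measurable]: "(\<lambda>a. \<integral>\<^sup>+b. ?\<kappa> k x b * \<Delta> a b \<partial>lborel) \<in> borel_measurable borel" for k x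
    unfolding \<Delta>_def by measurable
  have [measurable]: "(\<lambda>x. \<integral>\<^sup>+b. ?\<kappa> k x b * \<Delta> x b \<partial>lborel) \<in> borel_measurable borel" for k
    unfolding \<Delta>_def by measurable
  have [measurable]: "(\<lambda>x. \<integral>\<^sup>+b. e x b \<partial>lborel) \<in> borel_measurable borel"
    unfolding e_def by measurable
  define J where "J k = (\<integral>\<^sup>+x. D x * (\<integral>\<^sup>+a. ?\<kappa> k x a * W a \<partial>lborel) \<partial>lborel)" for k
  define N where "N k = (\<integral>\<^sup>+x. D x * (\<integral>\<^sup>+a. ?\<kappa> (Suc k) x a * (\<integral>\<^sup>+b. ?\<kappa> k x b * \<Delta> a b \<partial>lborel) \<partial>lborel) \<partial>lborel)" for k
  \<comment> \<open>The parameter is left free: it tends to zero in the recursion, and equals 1 in the final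
    comparison.\<close>
  have tri: "W a \<le> ennreal ((1 + \<delta>) powr q) * W b + ennreal ((1 + 1 / \<delta>) powr q) * \<Delta> a b"
    if "\<delta> > 0" for a b \<delta>
    unfolding W_def \<Delta>_def using powr_weighted_triangle[of "w a" "w b" \<delta> q] w0 q that
    by (simp add: ennreal_mult[symmetric] ennreal_plus[symmetric] ennreal_leI del: ennreal_plus)
  have step: "J (Suc k) \<le> ennreal ((1 + \<delta>) powr q) * J k + ennreal ((1 + 1 / \<delta>) powr q) * N k"
    if \<delta>: "\<delta> > 0" for k \<delta>
  proof -
    let ?p = "ennreal ((1 + \<delta>) powr q)" and ?s = "ennreal ((1 + 1 / \<delta>) powr q)"
    have "J (Suc k) \<le> (\<integral>\<^sup>+x. ?p * (D x * (\<integral>\<^sup>+a. ?\<kappa> k x a * W a \<partial>lborel)) +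
        ?s * (D x * (\<integral>\<^sup>+a. ?\<kappa> (Suc k) x a * (\<integral>\<^sup>+b. ?\<kappa> k x b * \<Delta> a b \<partial>lborel) \<partial>lborel)) \<partial>lborel)"
      unfolding J_def
    proof (rule nn_integral_mono)
      fix x
      have "(\<integral>\<^sup>+a. ?\<kappa> (Suc k) x a * W a \<partial>lborel) \<le> ?p * (\<integral>\<^sup>+a. ?\<kappa> k x a * W a \<partial>lborel) +
          ?s * (\<integral>\<^sup>+a. ?\<kappa> (Suc k) x a * (\<integral>\<^sup>+b. ?\<kappa> k x b * \<Delta> a b \<partial>lborel) \<partial>lborel)"
        by (rule weighted_average_step) (auto intro: tri[OF \<delta>] simp: ball_kernel_integral r)
      from mult_left_mono[OF this, of "D x"]
      show "D x * (\<integral>\<^sup>+a. ?\<kappa> (Suc k) x a * W a \<partial>lborel) \<le> ?p * (D x * (\<integral>\<^sup>+a. ?\<kappa> k x a * W a \<partial>lborel)) +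
        ?s * (D x * (\<integral>\<^sup>+a. ?\<kappa> (Suc k) x a * (\<integral>\<^sup>+b. ?\<kappa> k x b * \<Delta> a b \<partial>lborel) \<partial>lborel))"
        by (simp add: distrib_left mult.left_commute)
    qed
    also have "\<dots> = ?p * J k + ?s * N k"
      unfolding J_def N_def by (simp add: nn_integral_add nn_integral_cmult)
    finally show ?thesis .
  qed
  have near: "\<Delta> a b \<le> ennreal (t powr (d + \<sigma> * q)) * e a b" if "norm (a - b) \<le> t" for a b t
  proof (cases "a = b")
    case True
    then show ?thesis using q by (simp add: \<Delta>_def)
  next
    case False
    have "\<bar>w a - w b\<bar> powr q = norm (a - b) powr (d + \<sigma> * q) * (\<bar>w a - w b\<bar> powr q / norm (a - b) powr (d + \<sigma> * q))"
      using False by simp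
    also have "\<dots> \<le> t powr (d + \<sigma> * q) * (\<bar>w a - w b\<bar> powr q / norm (a - b) powr (d + \<sigma> * q))"
      using that \<sigma> q by (intro mult_right_mono powr_mono2) (auto simp: d_def)
    finally show ?thesis unfolding \<Delta>_def e_def by (simp add: ennreal_mult[symmetric] ennreal_leI)
  qed
  have c: "?\<kappa> k x a \<le> ennreal (1 / (v * r k powr d))" for k x a
    using r(1)[of k] by (simp add: ball_kernel_def v_def d_def powr_realpow)
  have Nb: "N k \<le> ennreal (K * (2 powr (2 * d + \<sigma> * q) / v\<^sup>2) * r k powr \<epsilon>)" for k
  proof -
    let ?c = "ennreal (1 / (v * r (Suc k) powr d)) * (ennreal (1 / (v * r k powr d)) * ennreal ((2 * r k) powr (d + \<sigma> * q)))"
    have "N k \<le> (\<integral>\<^sup>+x. (\<integral>\<^sup>+a. ?c * ((if dist x a < r k then D x else 0) * (\<integral>\<^sup>+b. e a b \<partial>lborel)) \<partial>lborel) \<partial>lborel)"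
      unfolding N_def
    proof (rule nn_integral_mono)
      fix x
      have "D x * (\<integral>\<^sup>+a. ?\<kappa> (Suc k) x a * (\<integral>\<^sup>+b. ?\<kappa> k x b * \<Delta> a b \<partial>lborel) \<partial>lborel)
          = (\<integral>\<^sup>+a. D x * (?\<kappa> (Suc k) x a * (\<integral>\<^sup>+b. ?\<kappa> k x b * \<Delta> a b \<partial>lborel)) \<partial>lborel)"
        by (subst nn_integral_cmult) auto
      also have "\<dots> \<le> (\<integral>\<^sup>+a. ?c * ((if dist x a < r k then D x else 0) * (\<integral>\<^sup>+b. e a b \<partial>lborel)) \<partial>lborel)"
      proof (rule nn_integral_mono)
        fix a
        show "D x * (?\<kappa> (Suc k) x a * (\<integral>\<^sup>+b. ?\<kappa> k x b * \<Delta> a b \<partial>lborel))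
          \<le> ?c * ((if dist x a < r k then D x else 0) * (\<integral>\<^sup>+b. e a b \<partial>lborel))"
        proof (cases "dist x a < r (Suc k)")
          case True
          have "(\<integral>\<^sup>+b. ?\<kappa> k x b * \<Delta> a b \<partial>lborel)
              \<le> (\<integral>\<^sup>+b. (ennreal (1 / (v * r k powr d)) * ennreal ((2 * r k) powr (d + \<sigma> * q))) * e a b \<partial>lborel)"
          proof (rule nn_integral_mono)
            fix b
            show "?\<kappa> k x b * \<Delta> a b
                \<le> (ennreal (1 / (v * r k powr d)) * ennreal ((2 * r k) powr (d + \<sigma> * q))) * e a b"
            proof (cases "dist x b < r k")
              case b: True
              have "norm (a - b) \<le> 2 * r k"
                using True b r(3)[of k] dist_triangle3[of a b x] by (simp add: dist_norm)
              from mult_mono[OF c[of k x b] near[OF this]] show ?thesis by (simp add: mult.assoc)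
            qed (simp add: ball_kernel_def)
          qed
          also have "\<dots> = (ennreal (1 / (v * r k powr d)) * ennreal ((2 * r k) powr (d + \<sigma> * q))) * (\<integral>\<^sup>+b. e a b \<partial>lborel)"
            by (rule nn_integral_cmult) (simp add: e_def)
          finally have "?\<kappa> (Suc k) x a * (\<integral>\<^sup>+b. ?\<kappa> k x b * \<Delta> a b \<partial>lborel) \<le> ?c * (\<integral>\<^sup>+b. e a b \<partial>lborel)"
            using mult_mono[OF c[of "Suc k" x a]] by (simp add: mult.assoc)
          from mult_left_mono[OF this, of "D x"] show ?thesis
            using True r(3)[of k] by (simp add: mult.left_commute)
        qed (simp add: ball_kernel_def)
      qed
      finally show "D x * (\<integral>\<^sup>+a. ?\<kappa> (Suc k) x a * (\<integral>\<^sup>+b. ?\<kappa> k x b * \<Delta> a b \<partial>lborel) \<partial>lborel) \<le> \<dots>" .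
    qed
    also have "\<dots> = (\<integral>\<^sup>+a. (\<integral>\<^sup>+x. ?c * ((if dist x a < r k then D x else 0) * (\<integral>\<^sup>+b. e a b \<partial>lborel)) \<partial>lborel) \<partial>lborel)"
      by (rule lborel_pair.Fubini') measurable
    also have "\<dots> = (\<integral>\<^sup>+a. ?c * ((\<integral>\<^sup>+x. (if dist x a < r k then D x else 0) \<partial>lborel) * (\<integral>\<^sup>+b. e a b \<partial>lborel)) \<partial>lborel)"
      by (intro nn_integral_cong, subst nn_integral_cmult, measurable, subst nn_integral_multc, measurable)
    also have "\<dots> \<le> (\<integral>\<^sup>+a. ?c * (ennreal (K * r k powr (d - \<sigma> * q + \<epsilon>)) * (\<integral>\<^sup>+b. e a b \<partial>lborel)) \<partial>lborel)"
      by (intro nn_integral_mono mult_mono growth r) auto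
    also have "\<dots> = ?c * (ennreal (K * r k powr (d - \<sigma> * q + \<epsilon>)) * (\<integral>\<^sup>+a. (\<integral>\<^sup>+b. e a b \<partial>lborel) \<partial>lborel))"
      by (subst nn_integral_cmult, measurable, subst nn_integral_cmult, measurable)
    also have "\<dots> \<le> ?c * (ennreal (K * r k powr (d - \<sigma> * q + \<epsilon>)) * 1)"
      using E unfolding e_def by (intro mult_left_mono) auto
    also have "\<dots> = ennreal ((1 / (v * r (Suc k) powr d)) * ((1 / (v * r k powr d)) * (2 * r k) powr (d + \<sigma> * q))
        * (K * r k powr (d - \<sigma> * q + \<epsilon>)))"
      using v K by (simp add: ennreal_mult[symmetric])
    also have "(1 / (v * r (Suc k) powr d)) * ((1 / (v * r k powr d)) * (2 * r k) powr (d + \<sigma> * q))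
        * (K * r k powr (d - \<sigma> * q + \<epsilon>)) = K * (2 powr (2 * d + \<sigma> * q) / v\<^sup>2) * r k powr \<epsilon>"
    proof -
      have regroup: "1 / (v * (X / Y)) * (1 / (v * X) * (Z * U)) * (K * T) = K * (Y * Z / v\<^sup>2) * (U * T / (X * X))"
        if "X > 0" "Y > 0" for X Y Z U T :: real
        using that v by (simp add: power2_eq_square mult.commute mult.left_commute)
      have rS: "r (Suc k) powr d = r k powr d / 2 powr d"
        by (simp add: r_def powr_divide powr_mult)
      have r2: "(2 * r k) powr (d + \<sigma> * q) = 2 powr (d + \<sigma> * q) * r k powr (d + \<sigma> * q)"
        using r(1)[of k] by (simp add: powr_mult)
      have A: "2 powr d * 2 powr (d + \<sigma> * q) = 2 powr (2 * d + \<sigma> * q)"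
        by (simp flip: powr_add)
      have B: "r k powr (d + \<sigma> * q) * r k powr (d - \<sigma> * q + \<epsilon>) / (r k powr d * r k powr d) = r k powr \<epsilon>"
        by (simp flip: powr_add powr_diff)
      have "r k powr d > 0" "2 powr d > 0" using r(1)[of k] by auto
      then show ?thesis unfolding rS r2 by (subst regroup) (simp_all only: A B)
    qed
    finally show ?thesis .
  qed
  have J0: "J 0 \<le> ennreal (K / v)"
  proof -
    have "J 0 = (\<integral>\<^sup>+x. (\<integral>\<^sup>+a. (ennreal (1 / v) * (if dist x a < 1 then D x else 0)) * W a \<partial>lborel) \<partial>lborel)"
      unfolding J_def
      by (intro nn_integral_cong, subst nn_integral_cmult[symmetric])
         (auto intro!: nn_integral_cong simp: ball_kernel_def r_def v_def d_def mult_ac)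
    also have "\<dots> = (\<integral>\<^sup>+a. (\<integral>\<^sup>+x. (ennreal (1 / v) * (if dist x a < 1 then D x else 0)) * W a \<partial>lborel) \<partial>lborel)"
      by (rule lborel_pair.Fubini') measurable
    also have "\<dots> = (\<integral>\<^sup>+a. ennreal (1 / v) * (\<integral>\<^sup>+x. (if dist x a < 1 then D x else 0) \<partial>lborel) * W a \<partial>lborel)"
      by (intro nn_integral_cong, subst nn_integral_multc, measurable, subst nn_integral_cmult, measurable)
    also have "\<dots> \<le> (\<integral>\<^sup>+a. ennreal (1 / v) * ennreal (K * 1 powr (d - \<sigma> * q + \<epsilon>)) * W a \<partial>lborel)"
      by (intro nn_integral_mono mult_mono growth) auto
    also have "\<dots> = ennreal (1 / v) * ennreal K * (\<integral>\<^sup>+a. W a \<partial>lborel)"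
      by (simp add: nn_integral_cmult)
    also have "\<dots> \<le> ennreal (1 / v) * ennreal K * 1"
      using L unfolding W_def by (intro mult_left_mono) auto
    also have "\<dots> = ennreal (K / v)" using v K by (simp add: ennreal_mult[symmetric])
    finally show ?thesis .
  qed
  \<comment> \<open>With the parameter \<open>\<theta> ^ k\<close> the factor \<open>(1 + 1 / \<theta> ^ k) powr q\<close> grows like \<open>2 powr (k * \<epsilon> / 2)\<close> and
    uses up only half of the decay of \<open>N k\<close>.\<close>
  define \<theta> where "\<theta> = 2 powr (- \<epsilon> / (2 * q))"
  define \<tau> where "\<tau> = 2 powr (- \<epsilon> / 2)"
  have \<theta>: "0 < \<theta>" "\<theta> < 1" and \<tau>: "0 < \<tau>" "\<tau> < 1"
    using \<epsilon> q by (auto simp: \<theta>_def \<tau>_def powr_less_one)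
  define B where "B = 2 powr q * (K * (2 powr (2 * d + \<sigma> * q) / v\<^sup>2))"
  have B: "B \<ge> 0" using K v by (simp add: B_def)
  have rec: "J (Suc k) \<le> ennreal (exp (q * \<theta> ^ k)) * J k + ennreal (B * \<tau> ^ k)" for k
  proof -
    have \<theta>k: "0 < \<theta> ^ k" "\<theta> ^ k \<le> 1" using \<theta> by (auto simp: power_le_one)
    have "(1 + \<theta> ^ k) powr q \<le> exp (\<theta> ^ k) powr q"
      using \<theta>k q exp_ge_add_one_self[of "\<theta> ^ k"] by (intro powr_mono2) auto
    also have "\<dots> = exp (q * \<theta> ^ k)" by (simp add: powr_def)
    finally have p: "(1 + \<theta> ^ k) powr q \<le> exp (q * \<theta> ^ k)" .
    have "1 + 1 / x \<le> 2 / x" if "0 < x" "x \<le> 1" for x :: real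
      using that by (simp add: field_simps)
    from this[OF \<theta>k] have "1 + 1 / \<theta> ^ k \<le> 2 / \<theta> ^ k" .
    then have "(1 + 1 / \<theta> ^ k) powr q \<le> (2 / \<theta> ^ k) powr q" using \<theta>k q by (intro powr_mono2) auto
    also have "\<dots> = 2 powr q * 2 powr (\<epsilon> / 2 * real k)"
      using q by (simp add: \<theta>_def powr_realpow[symmetric] powr_powr powr_divide powr_mult powr_minus_divide field_simps)
    finally have s: "(1 + 1 / \<theta> ^ k) powr q \<le> 2 powr q * 2 powr (\<epsilon> / 2 * real k)" .
    have "ennreal ((1 + 1 / \<theta> ^ k) powr q) * N k
        \<le> ennreal (2 powr q * 2 powr (\<epsilon> / 2 * real k)) * ennreal (K * (2 powr (2 * d + \<sigma> * q) / v\<^sup>2) * r k powr \<epsilon>)"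
      by (intro mult_mono Nb ennreal_leI s) auto
    also have "\<dots> = ennreal (B * (2 powr (\<epsilon> / 2 * real k) * r k powr \<epsilon>))"
      using K v by (simp add: ennreal_mult[symmetric] B_def mult_ac)
    also have "2 powr (\<epsilon> / 2 * real k) * r k powr \<epsilon> = \<tau> ^ k"
      unfolding r(4) \<tau>_def by (simp add: powr_realpow[symmetric] powr_powr flip: powr_add)
    finally have "ennreal ((1 + 1 / \<theta> ^ k) powr q) * N k \<le> ennreal (B * \<tau> ^ k)" .
    moreover have "ennreal ((1 + \<theta> ^ k) powr q) * J k \<le> ennreal (exp (q * \<theta> ^ k)) * J k"
      by (intro mult_right_mono ennreal_leI p) auto
    ultimately show ?thesis
      using step[OF \<theta>k(1), of k] by (meson add_mono order_trans)
  qed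
  define Jb where "Jb = exp (q / (1 - \<theta>)) * (K / v + B / (1 - \<tau>))"
  have Jb0: "Jb \<ge> 0" using K v B \<tau> by (simp add: Jb_def)
  have Jb: "J k \<le> ennreal Jb" for k
    unfolding Jb_def using rec J0 K v B q \<theta> \<tau> by (intro perturbed_recursion_bound) auto
  have final: "(\<integral>\<^sup>+x. W x * D x \<partial>lborel) \<le> ennreal (2 powr q * Jb) + ennreal (2 powr q * (n * (1 / v * r k powr (\<sigma> * q))))" for k
  proof -
    let ?R = "\<lambda>x. \<integral>\<^sup>+b. ?\<kappa> k x b * \<Delta> x b \<partial>lborel"
    have WR: "W x \<le> ennreal (2 powr q) * (\<integral>\<^sup>+a. ?\<kappa> k x a * W a \<partial>lborel) + ennreal (2 powr q) * ?R x" for x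
    proof -
      have "W x = (\<integral>\<^sup>+b. ?\<kappa> k x b * W x \<partial>lborel)" by (simp add: nn_integral_multc ball_kernel_integral r)
      also have "\<dots> \<le> (\<integral>\<^sup>+b. ennreal (2 powr q) * (?\<kappa> k x b * W b) + ennreal (2 powr q) * (?\<kappa> k x b * \<Delta> x b) \<partial>lborel)"
      proof (rule nn_integral_mono)
        fix b
        have "?\<kappa> k x b * W x \<le> ?\<kappa> k x b * (ennreal (2 powr q) * W b + ennreal (2 powr q) * \<Delta> x b)"
          using tri[of 1 x b] by (intro mult_left_mono) auto
        then show "?\<kappa> k x b * W x \<le> ennreal (2 powr q) * (?\<kappa> k x b * W b) + ennreal (2 powr q) * (?\<kappa> k x b * \<Delta> x b)"
          by (simp add: distrib_left mult.left_commute)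
      qed
      also have "\<dots> = ennreal (2 powr q) * (\<integral>\<^sup>+a. ?\<kappa> k x a * W a \<partial>lborel) + ennreal (2 powr q) * ?R x"
        by (simp add: nn_integral_add nn_integral_cmult)
      finally show ?thesis .
    qed
    have R: "(\<integral>\<^sup>+x. ?R x \<partial>lborel) \<le> ennreal (1 / v * r k powr (\<sigma> * q))"
    proof -
      have "(\<integral>\<^sup>+x. ?R x \<partial>lborel)
          \<le> (\<integral>\<^sup>+x. (\<integral>\<^sup>+b. (ennreal (1 / (v * r k powr d)) * ennreal (r k powr (d + \<sigma> * q))) * e x b \<partial>lborel) \<partial>lborel)"
      proof (intro nn_integral_mono)
        fix x b
        show "?\<kappa> k x b * \<Delta> x b \<le> (ennreal (1 / (v * r k powr d)) * ennreal (r k powr (d + \<sigma> * q))) * e x b"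
        proof (cases "dist x b < r k")
          case True
          then have "norm (x - b) \<le> r k" by (simp add: dist_norm)
          from mult_mono[OF c[of k x b] near[OF this]] show ?thesis by (simp add: mult.assoc)
        qed (simp add: ball_kernel_def)
      qed
      also have "\<dots> = ennreal (1 / (v * r k powr d)) * ennreal (r k powr (d + \<sigma> * q)) * (\<integral>\<^sup>+x. (\<integral>\<^sup>+b. e x b \<partial>lborel) \<partial>lborel)"
        by (simp add: nn_integral_cmult e_def)
      also have "\<dots> \<le> ennreal (1 / (v * r k powr d)) * ennreal (r k powr (d + \<sigma> * q)) * 1"
        using E unfolding e_def by (intro mult_left_mono) auto
      also have "\<dots> = ennreal (1 / v * r k powr (\<sigma> * q))"
        using v r(1)[of k] by (simp add: ennreal_mult[symmetric] powr_add)
      finally show ?thesis .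
    qed
    have "(\<integral>\<^sup>+x. W x * D x \<partial>lborel)
        \<le> (\<integral>\<^sup>+x. ennreal (2 powr q) * (D x * (\<integral>\<^sup>+a. ?\<kappa> k x a * W a \<partial>lborel)) + ennreal (2 powr q) * (ennreal n * ?R x) \<partial>lborel)"
    proof (rule nn_integral_mono)
      fix x
      have "W x * D x \<le> ennreal (2 powr q) * (D x * (\<integral>\<^sup>+a. ?\<kappa> k x a * W a \<partial>lborel)) + ennreal (2 powr q) * (D x * ?R x)"
      proof -
        have regroup: "(a * M + b * R) * E = a * (E * M) + b * (E * R)" for a b M R E :: ennreal
          by (simp add: distrib_left distrib_right mult.commute mult.left_commute)
        show ?thesis using mult_right_mono[OF WR, of "D x" x] unfolding regroup by simp
      qed
      also have "\<dots> \<le> ennreal (2 powr q) * (D x * (\<integral>\<^sup>+a. ?\<kappa> k x a * W a \<partial>lborel)) + ennreal (2 powr q) * (ennreal n * ?R x)"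
        by (intro add_left_mono mult_left_mono mult_right_mono Dn) auto
      finally show "W x * D x \<le> \<dots>" .
    qed
    also have "\<dots> = ennreal (2 powr q) * J k + ennreal (2 powr q) * (ennreal n * (\<integral>\<^sup>+x. ?R x \<partial>lborel))"
      unfolding J_def by (simp add: nn_integral_add nn_integral_cmult)
    also have "\<dots> \<le> ennreal (2 powr q) * ennreal Jb + ennreal (2 powr q) * (ennreal n * ennreal (1 / v * r k powr (\<sigma> * q)))"
      by (intro add_mono mult_left_mono Jb R) auto
    also have "\<dots> = ennreal (2 powr q * Jb) + ennreal (2 powr q * (n * (1 / v * r k powr (\<sigma> * q))))"
      using Jb0 n v by (simp add: ennreal_mult[symmetric])
    finally show ?thesis .
  qed
  have "(\<lambda>k. ennreal (2 powr q * Jb) + ennreal (2 powr q * (n * (1 / v * r k powr (\<sigma> * q)))))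
      \<longlonglongrightarrow> ennreal (2 powr q * Jb) + ennreal (2 powr q * (n * (1 / v * 0)))"
  proof (intro tendsto_add tendsto_const tendsto_ennrealI tendsto_mult)
    have "(\<lambda>k. (2 powr (- \<sigma> * q)) ^ k) \<longlonglongrightarrow> (0::real)"
      using \<sigma> q by (intro LIMSEQ_realpow_zero) (auto simp: powr_less_one)
    then show "(\<lambda>k. r k powr (\<sigma> * q)) \<longlonglongrightarrow> 0"
      unfolding r(4) by (simp add: powr_realpow[symmetric] powr_powr mult.commute mult.left_commute)
  qed
  from LIMSEQ_le_const[OF this] final
  have "(\<integral>\<^sup>+x. W x * D x \<partial>lborel) \<le> ennreal (2 powr q * Jb)" by simp
  also have "2 powr q * Jb = trace_const TYPE('a) q \<sigma> \<epsilon> * K"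
    unfolding trace_const_def Let_def Jb_def B_def \<theta>_def \<tau>_def v_def d_def
    by (simp add: algebra_simps add_divide_distrib)
  finally show ?thesis unfolding W_def .
qed

text \<open>The density is truncated so that its product with the approximation error, which is small
  only in mean, is controlled.\<close>

lemma trace_inequality:
  fixes w :: "'a::euclidean_space \<Rightarrow> real" and D :: "'a \<Rightarrow> ennreal"
  defines "d \<equiv> real DIM('a)"
  assumes w [measurable]: "w \<in> borel_measurable borel" and w0: "\<And>x. w x \<ge> 0"
    and D [measurable]: "D \<in> borel_measurable borel"
    and q: "q > 0" and \<sigma>: "\<sigma> > 0" and \<epsilon>: "\<epsilon> > 0" and K: "K \<ge> 0"
    and growth: "\<And>a \<rho>. 0 < \<rho> \<Longrightarrow> \<rho> \<le> 1 \<Longrightarrow>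
       (\<integral>\<^sup>+x. (if dist x a < \<rho> then D x else 0) \<partial>lborel) \<le> ennreal (K * \<rho> powr (d - \<sigma> * q + \<epsilon>))"
    and L: "(\<integral>\<^sup>+x. ennreal (w x powr q) \<partial>lborel) \<le> 1"
    and E: "(\<integral>\<^sup>+x. (\<integral>\<^sup>+y. ennreal (\<bar>w x - w y\<bar> powr q / norm (x - y) powr (d + \<sigma> * q)) \<partial>lborel) \<partial>lborel) \<le> 1"
  shows "(\<integral>\<^sup>+x. ennreal (w x powr q) * D x \<partial>lborel) \<le> ennreal (trace_const TYPE('a) q \<sigma> \<epsilon> * K)"
proof -
  let ?D = "\<lambda>n::nat. \<lambda>x. min (D x) (ennreal (real n))"
  have "ennreal (w x powr q) * D x = (SUP n. ennreal (w x powr q) * ?D n x)" for x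
  proof -
    have "D x = (SUP n. ?D n x)"
    proof (rule antisym)
      show "D x \<le> (SUP n. ?D n x)"
      proof (rule le_SUP_iff[THEN iffD2], intro allI impI)
        fix y assume y: "y < D x"
        then obtain n :: nat where "y < of_nat n"
          using ennreal_Ex_less_of_nat[of y] by (metis infinity_ennreal_def less_top_ennreal order_less_le_trans top_greatest)
        then show "\<exists>n\<in>UNIV. y < ?D n x" using y by (auto simp: ennreal_of_nat_eq_real_of_nat)
      qed
    qed (auto intro: SUP_least)
    from arg_cong[OF this, of "\<lambda>t. ennreal (w x powr q) * t"] show ?thesis
      by (rule trans[OF _ SUP_mult_left_ennreal])
  qed
  then have "(\<integral>\<^sup>+x. ennreal (w x powr q) * D x \<partial>lborel) = (\<integral>\<^sup>+x. (SUP n. ennreal (w x powr q) * ?D n x) \<partial>lborel)"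
    by simp
  also have "\<dots> = (SUP n. \<integral>\<^sup>+x. ennreal (w x powr q) * ?D n x \<partial>lborel)"
    by (intro nn_integral_monotone_convergence_SUP)
       (auto simp: incseq_def le_fun_def intro!: mult_left_mono min.mono ennreal_leI)
  also have "\<dots> \<le> ennreal (trace_const TYPE('a) q \<sigma> \<epsilon> * K)"
  proof (rule SUP_least)
    fix n :: nat
    show "(\<integral>\<^sup>+x. ennreal (w x powr q) * ?D n x \<partial>lborel) \<le> ennreal (trace_const TYPE('a) q \<sigma> \<epsilon> * K)"
    proof (rule trace_inequality_bounded[where n = "real n"])
      fix a :: 'a and \<rho> :: real assume \<rho>: "0 < \<rho>" "\<rho> \<le> 1"
      have "(\<integral>\<^sup>+x. (if dist x a < \<rho> then ?D n x else 0) \<partial>lborel) \<le> (\<integral>\<^sup>+x. (if dist x a < \<rho> then D x else 0) \<partial>lborel)"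
        by (intro nn_integral_mono) auto
      also note growth[OF \<rho>]
      finally show "(\<integral>\<^sup>+x. (if dist x a < \<rho> then ?D n x else 0) \<partial>lborel)
          \<le> ennreal (K * \<rho> powr (real DIM('a) - \<sigma> * q + \<epsilon>))" unfolding d_def .
    qed (use w0 q \<sigma> \<epsilon> K L E in \<open>auto simp: d_def\<close>)
  qed
  finally show ?thesis .
qed

section \<open>Multipliers of low-order Sobolev spaces\<close>

text \<open>The two radial constants stem from the parts near to and away from the diagonal; the summand \<open>1\<close> is
the bound on the energy.\<close>

definition growth_const :: "'a::euclidean_space itself \<Rightarrow> real \<Rightarrow> real \<Rightarrow> real \<Rightarrow> real \<Rightarrow> real \<Rightarrow> real" where
  "growth_const t q \<sigma> s g c =
     unit_ball_vol (real DIM('a)) *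
       (radial_const t ((s - \<sigma>) * q) + c powr q * radial_const t ((\<sigma> - g) * q)) + 1"

text \<open>For \<open>z < \<rho>\<close> the size of \<open>h\<close> is compared with \<open>\<tau> = z powr s * \<rho> powr (g - s)\<close>. If \<open>h \<le> \<tau>\<close>, then \<open>h powr q\<close> is at
most \<open>\<tau> powr q\<close>, whose quotient by the kernel is integrable because \<open>\<sigma> < s\<close>. Otherwise \<open>h powr q\<close> is at
most \<open>h powr P * \<tau> powr (q - P)\<close>, a multiple of the integrand of the energy. The power of \<open>\<rho>\<close> in \<open>\<tau>\<close> makes both
parts scale in the same way.\<close>

lemma near_far_split:
  fixes h z :: real
  assumes h: "h \<ge> 0" and z: "z > 0" and \<rho>: "\<rho> > 0" and q: "0 < q" "q < P" and \<sigma>: "\<sigma> < s"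
    and g': "g = s - d / P" and hol: "h \<le> c * z powr g'" and c: "c \<ge> 0"
  shows "h powr q / z powr (d + \<sigma> * q) \<le>
      \<rho> powr ((g - s) * q) * (if z < \<rho> then z powr ((s - \<sigma>) * q - d) else 0)
    + \<rho> powr (d - \<sigma> * q + g * q) * (h powr P / z powr (d + s * P))
    + c powr q * (if z \<ge> \<rho> then z powr (- ((\<sigma> - g') * q) - d) else 0)"
proof (cases "z < \<rho>")
  case False
  have "h powr q \<le> (c * z powr g') powr q" using h hol q by (intro powr_mono2) auto
  also have "\<dots> = c powr q * z powr (g' * q)" using c z by (simp add: powr_mult powr_powr)
  finally have "h powr q / z powr (d + \<sigma> * q) \<le> c powr q * z powr (g' * q) / z powr (d + \<sigma> * q)"
    by (intro divide_right_mono) auto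
  also have "\<dots> = c powr q * z powr (- ((\<sigma> - g') * q) - d)"
    by (simp only: times_divide_eq_right[symmetric] powr_diff[symmetric]) (simp add: algebra_simps)
  finally show ?thesis using False by (simp add: add_increasing)
next
  case z\<rho>: True
  let ?\<tau> = "z powr s * \<rho> powr (g - s)"
  have \<tau>: "?\<tau> > 0" using z \<rho> by simp
  show ?thesis
  proof (cases "h \<le> ?\<tau>")
    case True
    then have "h powr q \<le> ?\<tau> powr q" using h q by (intro powr_mono2) auto
    also have "\<dots> = \<rho> powr ((g - s) * q) * z powr (s * q)" using z \<rho> by (simp add: powr_mult powr_powr)
    finally have "h powr q / z powr (d + \<sigma> * q) \<le> \<rho> powr ((g - s) * q) * z powr (s * q) / z powr (d + \<sigma> * q)"
      by (intro divide_right_mono) auto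
    also have "\<dots> = \<rho> powr ((g - s) * q) * z powr ((s - \<sigma>) * q - d)"
      by (simp only: times_divide_eq_right[symmetric] powr_diff[symmetric]) (simp add: algebra_simps)
    finally show ?thesis using z\<rho> by (simp add: add_increasing2)
  next
    case False
    then have h\<tau>: "?\<tau> < h" by simp
    have "h powr q = h powr P * h powr (q - P)" by (simp flip: powr_add)
    also have "\<dots> \<le> h powr P * ?\<tau> powr (q - P)"
      using h\<tau> \<tau> q by (intro mult_left_mono powr_mono2') auto
    also have "?\<tau> powr (q - P) = z powr (s * (q - P)) * \<rho> powr ((g - s) * (q - P))"
      using z \<rho> by (simp add: powr_mult powr_powr)
    finally have "h powr q / z powr (d + \<sigma> * q)
        \<le> h powr P * (z powr (s * (q - P)) * \<rho> powr ((g - s) * (q - P))) / z powr (d + \<sigma> * q)"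
      by (intro divide_right_mono) auto
    also have "\<dots> = h powr P / z powr (d + s * P) * (z powr ((s - \<sigma>) * q) * \<rho> powr ((g - s) * (q - P)))"
    proof -
      have "z powr (s * (q - P)) / z powr (d + \<sigma> * q) = z powr ((s - \<sigma>) * q) / z powr (d + s * P)"
        by (simp flip: powr_diff add: algebra_simps)
      moreover have "A * (B * R) / Z = A * R * (B / Z)" "A / W * (C * R) = A * R * (C / W)" for A B C R Z W :: real
        by (simp_all add: mult.commute mult.left_commute)
      ultimately show ?thesis by (simp only:)
    qed
    also have "\<dots> \<le> h powr P / z powr (d + s * P) * (\<rho> powr ((s - \<sigma>) * q) * \<rho> powr ((g - s) * (q - P)))"
      using z z\<rho> \<sigma> q by (intro mult_left_mono mult_right_mono powr_mono2) auto
    also have "\<rho> powr ((s - \<sigma>) * q) * \<rho> powr ((g - s) * (q - P)) = \<rho> powr (d - \<sigma> * q + g * q)"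
    proof -
      have "(g - s) * P = - d" using q by (simp add: g')
      then have "(s - \<sigma>) * q + (g - s) * (q - P) = d - \<sigma> * q + g * q" by (simp add: algebra_simps)
      then show ?thesis by (simp only: powr_add[symmetric])
    qed
    finally show ?thesis using z\<rho> by (simp add: add_increasing mult.commute)
  qed
qed

lemma ennreal_linear3:
  assumes "a \<ge> 0" "b \<ge> 0" "c \<ge> 0" "x \<ge> 0" "y \<ge> 0" "z \<ge> 0"
  shows "ennreal (a * x + b * y + c * z) = ennreal a * ennreal x + ennreal b * ennreal y + ennreal c * ennreal z"
  using assms by (simp add: ennreal_mult)

text \<open>Near the diagonal the difference is split at the size \<open>|x - y|\<^sup>s\<close>, suitably scaled: small
  differences are integrated directly, large ones are absorbed in the energy. Away from the
  diagonal the Hoelder bound decides.\<close>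

lemma difference_density_growth:
  fixes H :: "'a::euclidean_space \<Rightarrow> 'a \<Rightarrow> real"
  defines "d \<equiv> real DIM('a)"
  assumes H [measurable]: "(\<lambda>(x, y). H x y) \<in> borel_measurable (lborel \<Otimes>\<^sub>M lborel)"
    and H0: "\<And>x y. H x y \<ge> 0" and q: "0 < q" "q < P" and \<sigma>: "\<sigma> < s"
    and g: "g' < \<sigma>" "g' \<le> s - d / P" and hol: "\<And>x y. H x y \<le> c * norm (x - y) powr g'" and c: "c \<ge> 0"
    and E: "(\<integral>\<^sup>+y. (\<integral>\<^sup>+x. ennreal (H x y powr P / norm (x - y) powr (d + s * P)) \<partial>lborel) \<partial>lborel) \<le> 1"
    and \<rho>: "0 < \<rho>" "\<rho> \<le> 1"
  shows "(\<integral>\<^sup>+y. (if dist y a < \<rho> then \<integral>\<^sup>+x. ennreal (H x y powr q / norm (x - y) powr (d + \<sigma> * q)) \<partial>lborel else 0) \<partial>lborel)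
    \<le> ennreal (growth_const TYPE('a) q \<sigma> s g' c * \<rho> powr (d - \<sigma> * q + g' * q))"
proof -
  let ?g = "s - d / P" and ?v = "unit_ball_vol d"
  define a1 where "a1 = (s - \<sigma>) * q"
  define a2 where "a2 = (\<sigma> - g') * q"
  have a: "a1 > 0" "a2 > 0" using q \<sigma> g by (auto simp: a1_def a2_def)
  define R1 where "R1 = radial_const TYPE('a) a1"
  define R2 where "R2 = radial_const TYPE('a) a2"
  have R: "R1 \<ge> 0" "R2 \<ge> 0" unfolding R1_def R2_def using a by (auto intro: radial_const_nonneg)
  define e where "e x y = ennreal (H x y powr P / norm (x - y) powr (d + s * P))" for x y
  have [measurable]: "(\<lambda>x. e x y) \<in> borel_measurable borel" for y unfolding e_def by measurable
  have [measurable]: "(\<lambda>y. \<integral>\<^sup>+x. e x y \<partial>lborel) \<in> borel_measurable borel" unfolding e_def by measurable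
  have inner: "(\<integral>\<^sup>+x. ennreal (H x y powr q / norm (x - y) powr (d + \<sigma> * q)) \<partial>lborel)
      \<le> ennreal (\<rho> powr (?g * q - \<sigma> * q) * R1 + c powr q * (R2 * \<rho> powr (- a2)))
        + ennreal (\<rho> powr (d - \<sigma> * q + ?g * q)) * (\<integral>\<^sup>+x. e x y \<partial>lborel)" for y
  proof -
    let ?n = "\<lambda>x. if norm (x - y) < \<rho> then ennreal (norm (x - y) powr (a1 - real DIM('a))) else 0"
    let ?f = "\<lambda>x. if norm (x - y) \<ge> \<rho> then ennreal (norm (x - y) powr (- a2 - real DIM('a))) else 0"
    have "(\<integral>\<^sup>+x. ennreal (H x y powr q / norm (x - y) powr (d + \<sigma> * q)) \<partial>lborel)
        \<le> (\<integral>\<^sup>+x. ennreal (\<rho> powr ((?g - s) * q)) * ?n x + ennreal (\<rho> powr (d - \<sigma> * q + ?g * q)) * e x y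
             + ennreal (c powr q) * ?f x \<partial>lborel)"
    proof (rule nn_integral_mono)
      fix x
      show "ennreal (H x y powr q / norm (x - y) powr (d + \<sigma> * q))
        \<le> ennreal (\<rho> powr ((?g - s) * q)) * ?n x + ennreal (\<rho> powr (d - \<sigma> * q + ?g * q)) * e x y
             + ennreal (c powr q) * ?f x"
      proof (cases "x = y")
        case False
        let ?z = "norm (x - y)"
        have "H x y powr q / ?z powr (d + \<sigma> * q) \<le>
          \<rho> powr ((?g - s) * q) * (if ?z < \<rho> then ?z powr ((s - \<sigma>) * q - d) else 0)
          + \<rho> powr (d - \<sigma> * q + ?g * q) * (H x y powr P / ?z powr (d + s * P))
          + c powr q * (if ?z \<ge> \<rho> then ?z powr (- ((\<sigma> - g') * q) - d) else 0)"
          using False \<rho> q \<sigma> hol c by (intro near_far_split H0) auto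
        from ennreal_leI[OF this] show ?thesis
          unfolding e_def a1_def a2_def d_def
          by (subst (asm) ennreal_linear3) (auto simp: H0 if_distrib[of ennreal] cong: if_cong)
      qed simp
    qed
    also have "\<dots> = ennreal (\<rho> powr ((?g - s) * q)) * (\<integral>\<^sup>+x. ?n x \<partial>lborel)
        + ennreal (\<rho> powr (d - \<sigma> * q + ?g * q)) * (\<integral>\<^sup>+x. e x y \<partial>lborel)
        + ennreal (c powr q) * (\<integral>\<^sup>+x. ?f x \<partial>lborel)"
      by (simp add: nn_integral_add nn_integral_cmult)
    also have "\<dots> \<le> ennreal (\<rho> powr ((?g - s) * q)) * ennreal (R1 * \<rho> powr a1)
        + ennreal (\<rho> powr (d - \<sigma> * q + ?g * q)) * (\<integral>\<^sup>+x. e x y \<partial>lborel)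
        + ennreal (c powr q) * ennreal (R2 * \<rho> powr (- a2))"
      unfolding R1_def R2_def using nn_integral_radial_near[OF a(1) \<rho>(1), of y]
        nn_integral_radial_far[OF a(2) \<rho>(1), of y]
      by (intro add_mono mult_left_mono order_refl) auto
    also have "\<dots> = ennreal (\<rho> powr ((?g - s) * q) * (R1 * \<rho> powr a1) + c powr q * (R2 * \<rho> powr (- a2)))
        + ennreal (\<rho> powr (d - \<sigma> * q + ?g * q)) * (\<integral>\<^sup>+x. e x y \<partial>lborel)"
      using R by (simp add: ennreal_mult[symmetric] add_ac)
    also have "\<rho> powr ((?g - s) * q) * (R1 * \<rho> powr a1) = \<rho> powr (?g * q - \<sigma> * q) * R1"
      by (simp add: a1_def algebra_simps flip: powr_add)
    finally show ?thesis .
  qed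
  let ?A = "\<rho> powr (?g * q - \<sigma> * q) * R1 + c powr q * (R2 * \<rho> powr (- a2))"
  have A0: "?A \<ge> 0" using R by simp
  have "(\<integral>\<^sup>+y. (if dist y a < \<rho> then \<integral>\<^sup>+x. ennreal (H x y powr q / norm (x - y) powr (d + \<sigma> * q)) \<partial>lborel else 0) \<partial>lborel)
      \<le> (\<integral>\<^sup>+y. ennreal ?A * indicator (ball a \<rho>) y + ennreal (\<rho> powr (d - \<sigma> * q + ?g * q)) * (\<integral>\<^sup>+x. e x y \<partial>lborel) \<partial>lborel)"
  proof (rule nn_integral_mono)
    fix y
    show "(if dist y a < \<rho> then \<integral>\<^sup>+x. ennreal (H x y powr q / norm (x - y) powr (d + \<sigma> * q)) \<partial>lborel else 0)
      \<le> ennreal ?A * indicator (ball a \<rho>) y + ennreal (\<rho> powr (d - \<sigma> * q + ?g * q)) * (\<integral>\<^sup>+x. e x y \<partial>lborel)"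
    proof (cases "dist y a < \<rho>")
      case True
      then have "indicator (ball a \<rho>) y = (1::ennreal)" by (simp add: dist_commute)
      then show ?thesis using True inner[of y] by (simp only: if_True mult_1_right)
    qed (simp only: if_False zero_le)
  qed
  also have "\<dots> = ennreal ?A * emeasure lborel (ball a \<rho>)
      + ennreal (\<rho> powr (d - \<sigma> * q + ?g * q)) * (\<integral>\<^sup>+y. (\<integral>\<^sup>+x. e x y \<partial>lborel) \<partial>lborel)"
  proof -
    have m1: "(\<lambda>y. ennreal ?A * indicator (ball a \<rho>) y) \<in> borel_measurable lborel"
      by (intro borel_measurable_times_ennreal borel_measurable_const borel_measurable_indicator) simp
    have m2: "(\<lambda>y. \<integral>\<^sup>+x. e x y \<partial>lborel) \<in> borel_measurable lborel"
      unfolding e_def by measurable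
    show ?thesis
      unfolding nn_integral_add[OF m1 borel_measurable_times_ennreal[OF borel_measurable_const m2]]
        nn_integral_cmult[OF m2]
      by (subst nn_integral_cmult_indicator) simp_all
  qed
  also have "\<dots> \<le> ennreal ?A * ennreal (?v * \<rho> powr d) + ennreal (\<rho> powr (d - \<sigma> * q + ?g * q)) * 1"
    using E \<rho> unfolding e_def
    by (intro add_mono mult_left_mono) (auto simp: emeasure_ball d_def powr_realpow)
  also have "\<dots> = ennreal (?A * (?v * \<rho> powr d) + \<rho> powr (d - \<sigma> * q + ?g * q))"
    using A0 by (simp add: ennreal_mult[symmetric] ennreal_plus[symmetric] d_def del: ennreal_plus)
  also have "\<dots> \<le> ennreal (growth_const TYPE('a) q \<sigma> s g' c * \<rho> powr (d - \<sigma> * q + g' * q))"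
  proof (rule ennreal_leI)
    have v: "?v \<ge> 0" by (simp add: d_def)
    have e: "\<rho> powr (d - \<sigma> * q + ?g * q) \<le> \<rho> powr (d - \<sigma> * q + g' * q)"
      using \<rho> q g by (intro powr_mono') auto
    have "?A * (?v * \<rho> powr d) = ?v * R1 * (\<rho> powr (?g * q - \<sigma> * q) * \<rho> powr d)
        + ?v * (c powr q * R2) * (\<rho> powr (- a2) * \<rho> powr d)"
      by (simp add: algebra_simps)
    also have "\<rho> powr (?g * q - \<sigma> * q) * \<rho> powr d = \<rho> powr (d - \<sigma> * q + ?g * q)"
      by (simp add: algebra_simps flip: powr_add)
    also have "\<rho> powr (- a2) * \<rho> powr d = \<rho> powr (d - \<sigma> * q + g' * q)"
      by (simp add: a2_def algebra_simps flip: powr_add)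
    also have "?v * R1 * \<rho> powr (d - \<sigma> * q + ?g * q) \<le> ?v * R1 * \<rho> powr (d - \<sigma> * q + g' * q)"
      using v R by (intro mult_left_mono e) auto
    finally have "?A * (?v * \<rho> powr d) + \<rho> powr (d - \<sigma> * q + ?g * q)
        \<le> ?v * R1 * \<rho> powr (d - \<sigma> * q + g' * q) + ?v * (c powr q * R2) * \<rho> powr (d - \<sigma> * q + g' * q)
          + \<rho> powr (d - \<sigma> * q + g' * q)"
      using e by linarith
    also have "\<dots> = growth_const TYPE('a) q \<sigma> s g' c * \<rho> powr (d - \<sigma> * q + g' * q)"
      unfolding growth_const_def R1_def R2_def a1_def a2_def d_def by (simp add: algebra_simps)
    finally show "?A * (?v * \<rho> powr d) + \<rho> powr (d - \<sigma> * q + ?g * q)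
        \<le> growth_const TYPE('a) q \<sigma> s g' c * \<rho> powr (d - \<sigma> * q + g' * q)" .
  qed
  finally show ?thesis .
qed

text \<open>For a bounded Lipschitz function the order \<open>\<sigma> < 1\<close> of the kernel is harmless near the diagonal, and
\<open>\<sigma> > 0\<close> makes it integrable at infinity.\<close>

lemma nn_integral_min_kernel:
  fixes y :: "'a::euclidean_space"
  assumes "q > 0" "0 < \<sigma>" "\<sigma> < 1"
  shows "(\<integral>\<^sup>+x. ennreal ((min 1 (norm (x - y))) powr q / norm (x - y) powr (real DIM('a) + \<sigma> * q)) \<partial>lborel)
    \<le> ennreal (radial_const TYPE('a) ((1 - \<sigma>) * q) + radial_const TYPE('a) (\<sigma> * q))"
proof -
  let ?d = "real DIM('a)"
  let ?n = "\<lambda>x. if norm (x - y) < 1 then ennreal (norm (x - y) powr ((1 - \<sigma>) * q - ?d)) else 0"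
  let ?f = "\<lambda>x. if norm (x - y) \<ge> 1 then ennreal (norm (x - y) powr (- (\<sigma> * q) - ?d)) else 0"
  have a: "(1 - \<sigma>) * q > 0" "\<sigma> * q > 0" using assms by auto
  have "(\<integral>\<^sup>+x. ennreal ((min 1 (norm (x - y))) powr q / norm (x - y) powr (?d + \<sigma> * q)) \<partial>lborel)
      \<le> (\<integral>\<^sup>+x. ?n x + ?f x \<partial>lborel)"
  proof (rule nn_integral_mono)
    fix x
    show "ennreal ((min 1 (norm (x - y))) powr q / norm (x - y) powr (?d + \<sigma> * q)) \<le> ?n x + ?f x"
    proof (cases "norm (x - y) < 1")
      case True
      have "norm (x - y) powr q / norm (x - y) powr (?d + \<sigma> * q) = norm (x - y) powr ((1 - \<sigma>) * q - ?d)"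
        by (simp add: algebra_simps flip: powr_diff)
      then show ?thesis using True by simp
    next
      case False
      have "1 / norm (x - y) powr (?d + \<sigma> * q) = norm (x - y) powr (- (\<sigma> * q) - ?d)"
        by (simp add: powr_minus_divide[symmetric] algebra_simps)
      then show ?thesis using False by simp
    qed
  qed
  also have "\<dots> = (\<integral>\<^sup>+x. ?n x \<partial>lborel) + (\<integral>\<^sup>+x. ?f x \<partial>lborel)" by (intro nn_integral_add) measurable
  also have "\<dots> \<le> ennreal (radial_const TYPE('a) ((1 - \<sigma>) * q) * 1 powr ((1 - \<sigma>) * q))
      + ennreal (radial_const TYPE('a) (\<sigma> * q) * 1 powr (- (\<sigma> * q)))"
    by (intro add_mono nn_integral_radial_near nn_integral_radial_far a) auto
  also have "\<dots> = ennreal (radial_const TYPE('a) ((1 - \<sigma>) * q) + radial_const TYPE('a) (\<sigma> * q))"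
    using a by (simp add: radial_const_nonneg ennreal_plus[symmetric] del: ennreal_plus)
  finally show ?thesis .
qed

lemma powr_sum3_le:
  fixes a b c q :: real
  assumes "a \<ge> 0" "b \<ge> 0" "c \<ge> 0" "q \<ge> 0"
  shows "(a + b + c) powr q \<le> 3 powr q * (a powr q + b powr q + c powr q)"
proof -
  let ?m = "max a (max b c)"
  have "(a + b + c) powr q \<le> (3 * ?m) powr q" using assms by (intro powr_mono2) auto
  also have "\<dots> = 3 powr q * ?m powr q" using assms by (simp add: powr_mult)
  also have "?m powr q \<le> a powr q + b powr q + c powr q" by (simp add: max_def)
  finally show ?thesis by simp
qed

text \<open>The three summands bound the contributions of \<open>F x \<bullet> (v x - v y)\<close>, of the majorant \<open>H\<close> and of the Lipschitz
part of \<open>F\<close>; the factor \<open>3 powr q\<close> separates them.\<close>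

definition multiplier_const ::
  "'a::euclidean_space itself \<Rightarrow> real \<Rightarrow> real \<Rightarrow> real \<Rightarrow> real \<Rightarrow> real \<Rightarrow> real \<Rightarrow> real \<Rightarrow> real" where
  "multiplier_const t q \<sigma> s g c c0 c1 =
     3 powr q * (c0 powr q + trace_const t q \<sigma> (g * q) * growth_const t q \<sigma> s g c
       + c1 powr q * (radial_const t ((1 - \<sigma>) * q) + radial_const t (\<sigma> * q)))"

text \<open>The differences of \<open>F\<close> have a Lipschitz part and a rough part \<open>H\<close>. The latter is integrated first in \<open>x\<close>;
the resulting density grows slowly enough for the trace inequality with \<open>\<epsilon> = g q\<close>.\<close>

lemma multiplier_slobodeckij_bound:
  fixes F v :: "'a::euclidean_space \<Rightarrow> 'a" and H :: "'a \<Rightarrow> 'a \<Rightarrow> real"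
  defines "d \<equiv> real DIM('a)"
  assumes H [measurable]: "(\<lambda>(x, y). H x y) \<in> borel_measurable (lborel \<Otimes>\<^sub>M lborel)"
    and H0: "\<And>x y. H x y \<ge> 0" and q: "0 < q" "q < P" and \<sigma>: "0 < \<sigma>" "\<sigma> < s" "\<sigma> < 1"
    and g: "0 < g" "g < \<sigma>" "g \<le> s - d / P" and hol: "\<And>x y. H x y \<le> c * norm (x - y) powr g" and c: "c \<ge> 0"
    and E: "(\<integral>\<^sup>+y. (\<integral>\<^sup>+x. ennreal (H x y powr P / norm (x - y) powr (d + s * P)) \<partial>lborel) \<partial>lborel) \<le> 1"
    and F [measurable]: "F \<in> borel_measurable borel" and F0: "\<And>x. norm (F x) \<le> c0"
    and F1: "\<And>x y. norm (F x - F y) \<le> H x y + c1 * min 1 (norm (x - y))" and c01: "c0 \<ge> 0" "c1 \<ge> 0"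
    and v [measurable]: "v \<in> borel_measurable borel"
    and vL: "(\<integral>\<^sup>+x. ennreal (norm (v x) powr q) \<partial>lborel) \<le> 1"
    and vE: "(\<integral>\<^sup>+x. (\<integral>\<^sup>+y. ennreal (norm (v x - v y) powr q / norm (x - y) powr (d + \<sigma> * q)) \<partial>lborel) \<partial>lborel) \<le> 1"
  shows "(\<integral>\<^sup>+x. (\<integral>\<^sup>+y. ennreal (norm (F x \<bullet> v x - F y \<bullet> v y) powr q / norm (x - y) powr (d + \<sigma> * q)) \<partial>lborel) \<partial>lborel)
    \<le> ennreal (multiplier_const TYPE('a) q \<sigma> s g c c0 c1)"
proof -
  define k where "k x y = norm (x - y) powr (d + \<sigma> * q)" for x y :: 'a
  have k0: "k x y \<ge> 0" for x y by (simp add: k_def)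
  define w where "w x = norm (v x)" for x
  have [measurable]: "w \<in> borel_measurable borel" unfolding w_def by measurable
  let ?K = "growth_const TYPE('a) q \<sigma> s g c"
  let ?R = "radial_const TYPE('a) ((1 - \<sigma>) * q) + radial_const TYPE('a) (\<sigma> * q)"
  have K: "?K \<ge> 0"
    unfolding growth_const_def using q \<sigma> g by (simp add: radial_const_nonneg)
  have R: "?R \<ge> 0" using q \<sigma> by (simp add: radial_const_nonneg)
  let ?T = "trace_const TYPE('a) q \<sigma> (g * q) * ?K"
  define V where "V x y = ennreal (norm (v x - v y) powr q / k x y)" for x y
  define D where "D x y = ennreal (H x y powr q / k x y)" for x y
  define m where "m x y = ennreal ((min 1 (norm (x - y))) powr q / k x y)" for x y :: 'a
  have [measurable]: "(\<lambda>(x, y). V x y) \<in> borel_measurable (lborel \<Otimes>\<^sub>M lborel)"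
    unfolding V_def k_def by measurable
  have [measurable]: "(\<lambda>(x, y). D x y) \<in> borel_measurable (lborel \<Otimes>\<^sub>M lborel)"
    unfolding D_def k_def by measurable
  have [measurable]: "(\<lambda>(x, y). m x y) \<in> borel_measurable (lborel \<Otimes>\<^sub>M lborel)"
    unfolding m_def k_def by measurable
  have [measurable]: "(\<lambda>x. D x y) \<in> borel_measurable borel" "(\<lambda>x. m x y) \<in> borel_measurable borel" for y
    unfolding D_def m_def k_def by measurable
  have [measurable]: "(\<lambda>y. \<integral>\<^sup>+x. D x y \<partial>lborel) \<in> borel_measurable borel"
    "(\<lambda>y. \<integral>\<^sup>+x. m x y \<partial>lborel) \<in> borel_measurable borel"
    unfolding D_def m_def k_def by measurable
  have pw: "ennreal (norm (F x \<bullet> v x - F y \<bullet> v y) powr q / k x y)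
      \<le> ennreal (3 powr q) * (ennreal (c0 powr q) * V x y + ennreal (w y powr q) * D x y
          + ennreal (c1 powr q) * (ennreal (w y powr q) * m x y))" for x y
  proof -
    have "norm (F x \<bullet> v x - F y \<bullet> v y) = norm (F x \<bullet> (v x - v y) + (F x - F y) \<bullet> v y)"
      by (simp add: inner_diff_left inner_diff_right)
    also have "\<dots> \<le> norm (F x) * norm (v x - v y) + norm (F x - F y) * norm (v y)"
      using Cauchy_Schwarz_ineq2[of "F x" "v x - v y"] Cauchy_Schwarz_ineq2[of "F x - F y" "v y"]
      by (intro order_trans[OF norm_triangle_ineq] add_mono) auto
    also have "\<dots> \<le> c0 * norm (v x - v y) + (H x y + c1 * min 1 (norm (x - y))) * w y"
      unfolding w_def by (intro add_mono mult_right_mono F0 F1) auto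
    also have "\<dots> = c0 * norm (v x - v y) + H x y * w y + c1 * min 1 (norm (x - y)) * w y"
      by (simp add: algebra_simps)
    finally have "norm (F x \<bullet> v x - F y \<bullet> v y) powr q
        \<le> (c0 * norm (v x - v y) + H x y * w y + c1 * min 1 (norm (x - y)) * w y) powr q"
      using q by (intro powr_mono2) auto
    also have "\<dots> \<le> 3 powr q * ((c0 * norm (v x - v y)) powr q + (H x y * w y) powr q
        + (c1 * min 1 (norm (x - y)) * w y) powr q)"
      using c01 H0 q by (intro powr_sum3_le) (auto simp: w_def)
    also have "\<dots> = 3 powr q * (c0 powr q * norm (v x - v y) powr q + w y powr q * H x y powr q
        + c1 powr q * (w y powr q * (min 1 (norm (x - y))) powr q))"
      using c01 H0 by (simp add: powr_mult w_def mult_ac)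
    finally have "norm (F x \<bullet> v x - F y \<bullet> v y) powr q / k x y
        \<le> 3 powr q * (c0 powr q * norm (v x - v y) powr q + w y powr q * H x y powr q
        + c1 powr q * (w y powr q * (min 1 (norm (x - y))) powr q)) / k x y"
      by (intro divide_right_mono k0)
    also have "\<dots> = 3 powr q * (c0 powr q * (norm (v x - v y) powr q / k x y) + w y powr q * (H x y powr q / k x y)
        + c1 powr q * (w y powr q * ((min 1 (norm (x - y))) powr q / k x y)))"
      by (simp only: divide_inverse distrib_right mult.assoc)
    finally show ?thesis
      unfolding V_def D_def m_def using k0
      by (simp add: ennreal_mult[symmetric] ennreal_plus[symmetric] ennreal_leI del: ennreal_plus)
  qed
  have "(\<integral>\<^sup>+x. (\<integral>\<^sup>+y. ennreal (norm (F x \<bullet> v x - F y \<bullet> v y) powr q / k x y) \<partial>lborel) \<partial>lborel)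
      \<le> (\<integral>\<^sup>+x. (\<integral>\<^sup>+y. ennreal (3 powr q) * (ennreal (c0 powr q) * V x y + ennreal (w y powr q) * D x y
          + ennreal (c1 powr q) * (ennreal (w y powr q) * m x y)) \<partial>lborel) \<partial>lborel)"
    by (intro nn_integral_mono pw)
  also have "\<dots> = ennreal (3 powr q) * (ennreal (c0 powr q) * (\<integral>\<^sup>+x. (\<integral>\<^sup>+y. V x y \<partial>lborel) \<partial>lborel)
      + (\<integral>\<^sup>+x. (\<integral>\<^sup>+y. ennreal (w y powr q) * D x y \<partial>lborel) \<partial>lborel)
      + ennreal (c1 powr q) * (\<integral>\<^sup>+x. (\<integral>\<^sup>+y. ennreal (w y powr q) * m x y \<partial>lborel) \<partial>lborel))"
    by (simp add: nn_integral_add nn_integral_cmult)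
  also have "(\<integral>\<^sup>+x. (\<integral>\<^sup>+y. ennreal (w y powr q) * D x y \<partial>lborel) \<partial>lborel)
      = (\<integral>\<^sup>+y. (\<integral>\<^sup>+x. ennreal (w y powr q) * D x y \<partial>lborel) \<partial>lborel)"
    by (rule lborel_pair.Fubini'[symmetric]) measurable
  also have "\<dots> = (\<integral>\<^sup>+y. ennreal (w y powr q) * (\<integral>\<^sup>+x. D x y \<partial>lborel) \<partial>lborel)"
    by (simp add: nn_integral_cmult)
  also have "(\<integral>\<^sup>+x. (\<integral>\<^sup>+y. ennreal (w y powr q) * m x y \<partial>lborel) \<partial>lborel)
      = (\<integral>\<^sup>+y. (\<integral>\<^sup>+x. ennreal (w y powr q) * m x y \<partial>lborel) \<partial>lborel)"
    by (rule lborel_pair.Fubini'[symmetric]) measurable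
  also have "\<dots> = (\<integral>\<^sup>+y. ennreal (w y powr q) * (\<integral>\<^sup>+x. m x y \<partial>lborel) \<partial>lborel)"
    by (simp add: nn_integral_cmult)
  also have "ennreal (3 powr q) * (ennreal (c0 powr q) * (\<integral>\<^sup>+x. (\<integral>\<^sup>+y. V x y \<partial>lborel) \<partial>lborel)
      + (\<integral>\<^sup>+y. ennreal (w y powr q) * (\<integral>\<^sup>+x. D x y \<partial>lborel) \<partial>lborel)
      + ennreal (c1 powr q) * (\<integral>\<^sup>+y. ennreal (w y powr q) * (\<integral>\<^sup>+x. m x y \<partial>lborel) \<partial>lborel))
    \<le> ennreal (3 powr q) * (ennreal (c0 powr q) * 1 + ennreal ?T + ennreal (c1 powr q) * ennreal ?R)"
  proof (intro mult_left_mono add_mono)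
    show "(\<integral>\<^sup>+x. (\<integral>\<^sup>+y. V x y \<partial>lborel) \<partial>lborel) \<le> 1" using vE unfolding V_def k_def .
    \<comment> \<open>The trace inequality concerns scalar functions; the energy of the modulus is at most that of the field.\<close>
    have wE: "(\<integral>\<^sup>+x. (\<integral>\<^sup>+y. ennreal (\<bar>w x - w y\<bar> powr q / norm (x - y) powr (d + \<sigma> * q)) \<partial>lborel) \<partial>lborel) \<le> 1"
      by (rule order_trans[OF _ vE], intro nn_integral_mono ennreal_leI divide_right_mono powr_mono2)
         (use q norm_triangle_ineq3 in \<open>auto simp: w_def\<close>)
    show "(\<integral>\<^sup>+y. ennreal (w y powr q) * (\<integral>\<^sup>+x. D x y \<partial>lborel) \<partial>lborel) \<le> ennreal ?T"
    proof (rule trace_inequality)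
      show "(\<integral>\<^sup>+y. (if dist y a < \<rho> then \<integral>\<^sup>+x. D x y \<partial>lborel else 0) \<partial>lborel)
          \<le> ennreal (?K * \<rho> powr (real DIM('a) - \<sigma> * q + g * q))" if "0 < \<rho>" "\<rho> \<le> 1" for a \<rho>
        using difference_density_growth[OF H H0 q \<sigma>(2) g(2,3)[unfolded d_def] hol c E[unfolded d_def] that, of a]
        unfolding D_def k_def d_def .
    qed (use q \<sigma> g K vL wE in \<open>auto simp: w_def d_def\<close>)
    have "(\<integral>\<^sup>+y. ennreal (w y powr q) * (\<integral>\<^sup>+x. m x y \<partial>lborel) \<partial>lborel)
        \<le> (\<integral>\<^sup>+y. ennreal (w y powr q) * ennreal ?R \<partial>lborel)"
      unfolding m_def k_def d_def by (intro nn_integral_mono mult_left_mono nn_integral_min_kernel q \<sigma>) auto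
    also have "\<dots> = (\<integral>\<^sup>+y. ennreal (w y powr q) \<partial>lborel) * ennreal ?R" by (simp add: nn_integral_multc)
    also have "\<dots> \<le> 1 * ennreal ?R" using vL unfolding w_def by (intro mult_right_mono) auto
    finally show "(\<integral>\<^sup>+y. ennreal (w y powr q) * (\<integral>\<^sup>+x. m x y \<partial>lborel) \<partial>lborel) \<le> ennreal ?R" by simp
  qed auto
  also have "\<dots> = ennreal (multiplier_const TYPE('a) q \<sigma> s g c c0 c1)"
  proof -
    have "trace_const TYPE('a) q \<sigma> (g * q) \<ge> 0"
    proof -
      have "2 powr (- (g * q) / (2 * q)) < (1::real)" "2 powr (- (g * q) / 2) < (1::real)"
        using g q by (auto simp: powr_less_one)
      then show ?thesis unfolding trace_const_def Let_def by simp
    qed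
    then have "?T \<ge> 0" using K by simp
    then show ?thesis
      using R unfolding multiplier_const_def
      by (simp add: ennreal_mult[symmetric] ennreal_plus[symmetric] del: ennreal_plus)
  qed
  finally show ?thesis unfolding k_def .
qed

section \<open>Functions with weak derivatives in a fractional space are continuously differentiable\<close>

text \<open>The Slobodeckij energy of a function with a Borel representative, written over the whole space
  with Lebesgue-Borel measure; \<open>e\<close> stands for the dimension plus \<open>\<sigma> P\<close>.\<close>

definition local_energy ::
  "real \<Rightarrow> real \<Rightarrow> 'a::euclidean_space set \<Rightarrow> ('a \<Rightarrow> real) \<Rightarrow> ennreal" where
  "local_energy P e \<Omega> w = (\<integral>\<^sup>+a. (\<integral>\<^sup>+b. indicator \<Omega> a * (indicator \<Omega> b *
     ennreal (\<bar>w a - w b\<bar> powr P / norm (a - b) powr e)) \<partial>lborel) \<partial>lborel)"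

lemma dilated_bound:
  fixes x :: "'a::euclidean_space"
  assumes "\<And>x. \<rho> x \<le> M" "t > 0"
  shows "dilated t \<rho> x \<le> M * t powr (- real DIM('a))"
  using assms(1)[of "x /\<^sub>R t"] assms(2)
  by (simp add: dilated_def powr_minus_divide powr_realpow divide_right_mono)

text \<open>Values above the threshold are bounded by their \<open>P\<close>-th power, as in Chebyshev's inequality. This
replaces Hoelder's inequality, with a threshold that is chosen to balance the two parts.\<close>

lemma powr_threshold_split:
  fixes u \<kappa> P :: real
  assumes "u \<ge> 0" "\<kappa> > 0" "P \<ge> 1"
  shows "u \<le> \<kappa> + \<kappa> powr (1 - P) * u powr P"
proof (cases "u \<le> \<kappa>")
  case False
  then have "u = u powr (1 - P) * u powr P" using assms by (simp flip: powr_add)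
  also have "\<dots> \<le> \<kappa> powr (1 - P) * u powr P"
    using False assms by (intro mult_right_mono powr_mono2') auto
  finally show ?thesis using assms by simp
qed (simp add: add_increasing2)

text \<open>Two mollified values differ by an average of \<open>|G a - G b|\<close> over a product of balls. This
  average is compared with the energy by splitting at the level at which both parts balance.\<close>

lemma mollified_difference_bound:
  fixes G :: "'a::euclidean_space \<Rightarrow> real"
  defines "d \<equiv> real DIM('a)"
  assumes \<rho>: "mollifier \<rho>" and M: "\<And>x. \<rho> x \<le> M" and P: "P \<ge> 1"
    and G [measurable]: "G \<in> borel_measurable borel" and GK: "integrable lebesgue (\<lambda>x. indicator K x * G x)"
    and K: "K \<subseteq> \<Omega>" and \<Omega>: "open \<Omega>"
    and E: "local_energy P (d + s * P) \<Omega> G \<le> 1"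
    and t: "t > 0" "t' > 0" and x: "ball x (2 * t) \<subseteq> K" "ball y (2 * t') \<subseteq> K"
    and l: "norm (x - y) + 2 * t + 2 * t' \<le> l" and s: "s > 0"
  shows "\<bar>conv (dilated t \<rho>) (\<lambda>x. indicator K x * G x) x - conv (dilated t' \<rho>) (\<lambda>x. indicator K x * G x) y\<bar>
    \<le> (1 + M\<^sup>2) * (l powr (s + d / P) * (t * t') powr (- d / P))"
proof -
  let ?G = "\<lambda>x. indicator K x * G x"
  define \<phi> where "\<phi> a = dilated t \<rho> (x - a)" for a
  define \<phi>' where "\<phi>' b = dilated t' \<rho> (y - b)" for b
  \<comment> \<open>The threshold at which the two parts of the split contribute equally.\<close>
  define \<kappa> where "\<kappa> = l powr (s + d / P) * (t * t') powr (- d / P)"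
  have l0: "l > 0" using l t norm_ge_zero[of "x - y"] by linarith
  have \<kappa>: "\<kappa> > 0" using l0 t by (simp add: \<kappa>_def)
  have \<rho>m: "\<rho> \<in> borel_measurable borel"
    using \<rho> by (auto simp: mollifier_def intro: smooth_borel test_function_smooth)
  have dm [measurable]: "dilated t \<rho> \<in> borel_measurable borel" for t
    unfolding dilated_def by (intro borel_measurable_divide borel_measurable_const measurable_compose[OF _ \<rho>m]) auto
  have [measurable]: "\<phi> \<in> borel_measurable borel" "\<phi>' \<in> borel_measurable borel"
    unfolding \<phi>_def \<phi>'_def by measurable
  have pos: "\<phi> a \<ge> 0" "\<phi>' a \<ge> 0" for a
    unfolding \<phi>_def \<phi>'_def using dilated_nonneg[OF \<rho>] t by auto
  have int1: "(\<integral>\<^sup>+a. ennreal (\<phi> a) \<partial>lborel) = 1" "(\<integral>\<^sup>+a. ennreal (\<phi>' a) \<partial>lborel) = 1"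
  proof -
    have "(\<integral>\<^sup>+a. ennreal (dilated r \<rho> (z - a)) \<partial>lborel) = 1" if "r > 0" for z r
      using nn_integral_eq_integral[OF dilated_integrable[OF \<rho> that, of z]] dilated_integral[OF \<rho> that, of z]
        dilated_nonneg[OF \<rho> that]
      by (simp add: nn_integral_completion)
    then show "(\<integral>\<^sup>+a. ennreal (\<phi> a) \<partial>lborel) = 1" "(\<integral>\<^sup>+a. ennreal (\<phi>' a) \<partial>lborel) = 1"
      unfolding \<phi>_def \<phi>'_def using t by auto
  qed
  have test: "test_function UNIV (dilated r \<rho>)" if "r > 0" for r
    using test_function_mono[OF dilated_test_function[OF \<rho> that]] by blast
  define I where "I = conv (dilated t' \<rho>) ?G y"
  have avg: "ennreal \<bar>conv (dilated r \<rho>) ?G z - c\<bar> \<le> (\<integral>\<^sup>+a. ennreal (dilated r \<rho> (z - a)) * ennreal \<bar>?G a - c\<bar> \<partial>lborel)"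
    if r: "r > 0" for r z c
  proof -
    have i: "integrable lebesgue (\<lambda>a. dilated r \<rho> (z - a) * ?G a)" "integrable lebesgue (\<lambda>a. dilated r \<rho> (z - a) * c)"
      using conv_integrable[OF test[OF r] GK] dilated_integrable[OF \<rho> r] by auto
    have "conv (dilated r \<rho>) ?G z - c = (\<integral>a. dilated r \<rho> (z - a) * ?G a - dilated r \<rho> (z - a) * c \<partial>lebesgue)"
      unfolding Bochner_Integration.integral_diff[OF i] conv_def by (simp add: dilated_integral[OF \<rho> r])
    then have "ennreal \<bar>conv (dilated r \<rho>) ?G z - c\<bar>
        \<le> (\<integral>\<^sup>+a. ennreal \<bar>dilated r \<rho> (z - a) * ?G a - dilated r \<rho> (z - a) * c\<bar> \<partial>lebesgue)"
      using integral_norm_bound_ennreal[OF Bochner_Integration.integrable_diff[OF i]] by (simp only: real_norm_def)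
    also have "\<dots> = (\<integral>\<^sup>+a. ennreal (dilated r \<rho> (z - a)) * ennreal \<bar>?G a - c\<bar> \<partial>lebesgue)"
      by (intro nn_integral_cong)
         (simp add: right_diff_distrib[symmetric] abs_mult ennreal_mult dilated_nonneg[OF \<rho> r])
    finally show ?thesis by (simp add: nn_integral_completion)
  qed
  define e where "e a b = indicator \<Omega> a * (indicator \<Omega> b *
        ennreal (\<bar>G a - G b\<bar> powr P / norm (a - b) powr (d + s * P)))" for a b
  have [measurable]: "\<Omega> \<in> sets borel" using \<Omega> by simp
  have [measurable]: "(\<lambda>b. e a b) \<in> borel_measurable borel" for a unfolding e_def by measurable
  have [measurable]: "(\<lambda>a. \<integral>\<^sup>+b. e a b \<partial>lborel) \<in> borel_measurable borel" unfolding e_def by measurable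
  define A where "A = \<kappa> powr (1 - P) * l powr (d + s * P)"
  have A0: "A \<ge> 0" by (simp add: A_def)
  have M0: "M \<ge> 0" using M[of 0] \<rho> by (auto simp: mollifier_def intro: order_trans)
  have \<phi>b: "\<phi> a \<le> M * t powr (- d)" "\<phi>' b \<le> M * t' powr (- d)" for a b
    unfolding \<phi>_def \<phi>'_def d_def using dilated_bound[of \<rho> M] M t by blast+
  let ?c = "ennreal (A * (M * t powr (- d)) * (M * t' powr (- d)))"
  have pw: "ennreal (\<phi> a) * (ennreal (\<phi>' b) * ennreal \<bar>?G a - ?G b\<bar>)
      \<le> ennreal \<kappa> * (ennreal (\<phi> a) * ennreal (\<phi>' b)) + ?c * e a b" for a b
  proof (cases "a \<in> ball x (2 * t) \<and> b \<in> ball y (2 * t')")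
    case True
    then have ab: "a \<in> K" "b \<in> K" "a \<in> \<Omega>" "b \<in> \<Omega>" using x K by auto
    have "norm (a - b) \<le> norm (x - y) + norm (x - a) + norm (y - b)"
      using norm_triangle_ineq4[of "x - y" "x - a"] norm_triangle_ineq[of "x - y - (x - a)" "y - b"]
      by (simp add: algebra_simps)
    then have nl: "norm (a - b) \<le> l" using True l by (simp add: dist_norm)
    have "\<bar>G a - G b\<bar> powr P \<le> l powr (d + s * P) * (\<bar>G a - G b\<bar> powr P / norm (a - b) powr (d + s * P))"
    proof (cases "a = b")
      case False
      then have "\<bar>G a - G b\<bar> powr P
          = norm (a - b) powr (d + s * P) * (\<bar>G a - G b\<bar> powr P / norm (a - b) powr (d + s * P))" by simp
      also have "\<dots> \<le> l powr (d + s * P) * (\<bar>G a - G b\<bar> powr P / norm (a - b) powr (d + s * P))"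
        using nl s P by (intro mult_right_mono powr_mono2) (auto simp: d_def)
      finally show ?thesis .
    qed (use P in simp)
    then have "\<bar>G a - G b\<bar> \<le> \<kappa> + A * (\<bar>G a - G b\<bar> powr P / norm (a - b) powr (d + s * P))"
      using powr_threshold_split[of "\<bar>G a - G b\<bar>" \<kappa> P] \<kappa> P
      mult_left_mono[of "\<bar>G a - G b\<bar> powr P" _ "\<kappa> powr (1 - P)"]
      unfolding A_def by (smt (verit, best) mult.assoc powr_ge_zero)
    then have "\<phi> a * (\<phi>' b * \<bar>G a - G b\<bar>)
        \<le> \<phi> a * (\<phi>' b * (\<kappa> + A * (\<bar>G a - G b\<bar> powr P / norm (a - b) powr (d + s * P))))"
      by (intro mult_left_mono pos)
    also have "\<dots> = \<kappa> * (\<phi> a * \<phi>' b) + A * (\<phi> a * \<phi>' b) * (\<bar>G a - G b\<bar> powr P / norm (a - b) powr (d + s * P))"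
      by (simp add: algebra_simps)
    also have "\<dots> \<le> \<kappa> * (\<phi> a * \<phi>' b) + A * ((M * t powr (- d)) * (M * t' powr (- d))) * (\<bar>G a - G b\<bar> powr P / norm (a - b) powr (d + s * P))"
      using M0 by (intro add_left_mono mult_right_mono mult_left_mono mult_mono \<phi>b pos A0) auto
    finally have "\<phi> a * (\<phi>' b * \<bar>G a - G b\<bar>) \<le> \<kappa> * (\<phi> a * \<phi>' b)
        + A * (M * t powr (- d)) * (M * t' powr (- d)) * (\<bar>G a - G b\<bar> powr P / norm (a - b) powr (d + s * P))"
      by (simp only: mult.assoc)
    from ennreal_leI[OF this] show ?thesis
      using ab pos \<kappa> A0 M0 unfolding e_def by (simp add: ennreal_mult[symmetric] ennreal_plus[symmetric] del: ennreal_plus)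
  next
    case False
    then have "\<phi> a = 0 \<or> \<phi>' b = 0"
      unfolding \<phi>_def \<phi>'_def using dilated_outside[OF \<rho>] t by (auto simp: dist_norm)
    then show ?thesis by auto
  qed
  have "ennreal \<bar>conv (dilated t \<rho>) ?G x - I\<bar> \<le> (\<integral>\<^sup>+a. ennreal (\<phi> a) * ennreal \<bar>?G a - I\<bar> \<partial>lborel)"
    unfolding \<phi>_def by (rule avg[OF t(1)])
  also have "\<dots> \<le> (\<integral>\<^sup>+a. (\<integral>\<^sup>+b. ennreal \<kappa> * (ennreal (\<phi> a) * ennreal (\<phi>' b)) + ?c * e a b \<partial>lborel) \<partial>lborel)"
  proof (rule nn_integral_mono)
    fix a
    have "ennreal \<bar>?G a - I\<bar> = ennreal \<bar>I - ?G a\<bar>" by (simp add: abs_minus_commute)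
    also have "\<dots> \<le> (\<integral>\<^sup>+b. ennreal (\<phi>' b) * ennreal \<bar>?G b - ?G a\<bar> \<partial>lborel)"
      unfolding I_def \<phi>'_def by (rule avg[OF t(2)])
    finally have le: "ennreal \<bar>?G a - I\<bar> \<le> (\<integral>\<^sup>+b. ennreal (\<phi>' b) * ennreal \<bar>?G b - ?G a\<bar> \<partial>lborel)" .
    show "ennreal (\<phi> a) * ennreal \<bar>?G a - I\<bar>
        \<le> (\<integral>\<^sup>+b. ennreal \<kappa> * (ennreal (\<phi> a) * ennreal (\<phi>' b)) + ?c * e a b \<partial>lborel)"
    proof -
      have m: "(\<lambda>b. ennreal (\<phi>' b) * ennreal \<bar>?G b - ?G a\<bar>) \<in> borel_measurable lebesgue"
        by (rule borel_measurable_times_ennreal[OF measurable_compose[OF borel_imp_lebesgue[OF \<open>\<phi>' \<in> borel_measurable borel\<close>] measurable_ennreal]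
              measurable_compose[OF borel_measurable_abs[OF borel_measurable_diff[OF
                  borel_measurable_integrable[OF GK] borel_measurable_const]] measurable_ennreal]])
      have "ennreal (\<phi> a) * ennreal \<bar>?G a - I\<bar>
          \<le> ennreal (\<phi> a) * (\<integral>\<^sup>+b. ennreal (\<phi>' b) * ennreal \<bar>?G b - ?G a\<bar> \<partial>lebesgue)"
        using le by (intro mult_left_mono) (auto simp: nn_integral_completion)
      also have "\<dots> = (\<integral>\<^sup>+b. ennreal (\<phi> a) * (ennreal (\<phi>' b) * ennreal \<bar>?G b - ?G a\<bar>) \<partial>lebesgue)"
        by (rule nn_integral_cmult[OF m, symmetric])
      also have "\<dots> \<le> (\<integral>\<^sup>+b. ennreal \<kappa> * (ennreal (\<phi> a) * ennreal (\<phi>' b)) + ?c * e a b \<partial>lebesgue)"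
      proof (rule nn_integral_mono)
        fix b
        show "ennreal (\<phi> a) * (ennreal (\<phi>' b) * ennreal \<bar>?G b - ?G a\<bar>)
            \<le> ennreal \<kappa> * (ennreal (\<phi> a) * ennreal (\<phi>' b)) + ?c * e a b"
          using pw[of a b] by (simp only: abs_minus_commute[of "?G b" "?G a"])
      qed
      finally show ?thesis by (simp only: nn_integral_completion)
    qed
  qed
  also have "\<dots> = (\<integral>\<^sup>+a. ennreal \<kappa> * ennreal (\<phi> a) + ?c * (\<integral>\<^sup>+b. e a b \<partial>lborel) \<partial>lborel)"
    by (intro nn_integral_cong) (simp add: nn_integral_add nn_integral_cmult int1)
  also have "\<dots> = ennreal \<kappa> + ?c * (\<integral>\<^sup>+a. (\<integral>\<^sup>+b. e a b \<partial>lborel) \<partial>lborel)"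
    by (simp add: nn_integral_add nn_integral_cmult int1)
  also have "\<dots> \<le> ennreal \<kappa> + ?c * 1"
    using E unfolding e_def local_energy_def by (intro add_left_mono mult_left_mono) auto
  also have "\<dots> = ennreal (\<kappa> + A * (M * t powr (- d)) * (M * t' powr (- d)))"
    using \<kappa> A0 M0 by (simp add: ennreal_plus[symmetric] del: ennreal_plus)
  finally have "\<bar>conv (dilated t \<rho>) ?G x - I\<bar> \<le> \<kappa> + A * (M * t powr (- d)) * (M * t' powr (- d))"
    using \<kappa> A0 M0 by (subst (asm) ennreal_le_iff) auto
  also have "A * (M * t powr (- d)) * (M * t' powr (- d)) = M\<^sup>2 * \<kappa>"
  proof -
    have "\<kappa> powr P = l powr (d + s * P) * (t powr (- d) * t' powr (- d))"
      using l0 t P by (simp add: \<kappa>_def powr_mult powr_powr algebra_simps)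
    then have "A * (t powr (- d) * t' powr (- d)) = \<kappa> powr (1 - P) * \<kappa> powr P" by (simp add: A_def)
    also have "\<dots> = \<kappa>" using \<kappa> by (simp flip: powr_add)
    finally show ?thesis by (simp add: power2_eq_square algebra_simps)
  qed
  finally show ?thesis unfolding I_def \<kappa>_def by (simp add: algebra_simps)
qed

lemma geometric_cauchy_limit:
  fixes f :: "nat \<Rightarrow> real"
  assumes step: "\<And>n. \<bar>f (Suc n) - f n\<bar> \<le> c * \<theta> ^ n" and \<theta>: "0 \<le> \<theta>" "\<theta> < 1"
  shows "\<bar>lim f - f n\<bar> \<le> c * \<theta> ^ n / (1 - \<theta>)"
proof -
  have c: "c \<ge> 0" using step[of 0] by simp
  have geo: "(\<lambda>k. c * \<theta> ^ (k + n)) sums (c * \<theta> ^ n / (1 - \<theta>))" for n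
    using sums_mult[OF geometric_sums[of \<theta>], of "c * \<theta> ^ n"] \<theta> by (simp add: power_add mult_ac)
  have sm: "summable (\<lambda>k. f (Suc (k + n)) - f (k + n))" for n
    using step by (intro summable_comparison_test'[OF sums_summable[OF geo[of n]]]) auto
  have tel: "(\<Sum>k<m. f (Suc (k + n)) - f (k + n)) = f (m + n) - f n" for m n
    using sum_lessThan_telescope[of "\<lambda>k. f (k + n)" m] by simp
  have L: "(\<lambda>m. f (m + n)) \<longlonglongrightarrow> f n + (\<Sum>k. f (Suc (k + n)) - f (k + n))" for n
  proof -
    have "(\<lambda>m. f n + (f (m + n) - f n)) \<longlonglongrightarrow> f n + (\<Sum>k. f (Suc (k + n)) - f (k + n))"
      using summable_LIMSEQ[OF sm[of n]] unfolding tel by (intro tendsto_add tendsto_const)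
    then show ?thesis by simp
  qed
  from L[of 0] have "f \<longlonglongrightarrow> f 0 + (\<Sum>k. f (Suc (k + 0)) - f (k + 0))" by simp
  then have lim: "f \<longlonglongrightarrow> lim f" by (simp add: limI)
  then have "lim f = f n + (\<Sum>k. f (Suc (k + n)) - f (k + n))"
    using LIMSEQ_unique[OF L[of n]] LIMSEQ_ignore_initial_segment[OF lim, of n] by simp
  moreover have "\<bar>\<Sum>k. f (Suc (k + n)) - f (k + n)\<bar> \<le> (\<Sum>k. c * \<theta> ^ (k + n))"
  proof (rule order_trans[OF summable_rabs])
    show sa: "summable (\<lambda>k. \<bar>f (Suc (k + n)) - f (k + n)\<bar>)"
      using step by (intro summable_comparison_test'[OF sums_summable[OF geo[of n]]]) auto
    show "(\<Sum>k. \<bar>f (Suc (k + n)) - f (k + n)\<bar>) \<le> (\<Sum>k. c * \<theta> ^ (k + n))"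
      by (rule suminf_le[OF step sa sums_summable[OF geo]])
  qed
  ultimately show ?thesis using sums_unique[OF geo[of n]] by simp
qed

text \<open>The shrinking scales at which a function on \<open>ball 0 R\<close> is mollified: a point at distance at least
  \<open>\<delta>\<close> from the boundary sees only the compact set \<open>cball 0 (R - \<delta> / 2)\<close>.\<close>

definition moll_scale :: "real \<Rightarrow> nat \<Rightarrow> real" where
  "moll_scale \<delta> n = \<delta> / 4 / 2 ^ n"

definition moll_seq ::
  "('a::euclidean_space \<Rightarrow> real) \<Rightarrow> real \<Rightarrow> real \<Rightarrow> ('a \<Rightarrow> real) \<Rightarrow> nat \<Rightarrow> 'a \<Rightarrow> real" where
  "moll_seq \<rho> R \<delta> f n = conv (dilated (moll_scale \<delta> n) \<rho>) (\<lambda>a. indicator (cball 0 (R - \<delta> / 2)) a * f a)"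

lemma moll_scale: "\<delta> > 0 \<Longrightarrow> moll_scale \<delta> n > 0" "\<delta> > 0 \<Longrightarrow> 2 * moll_scale \<delta> n \<le> \<delta> / 2"
  by (auto simp: moll_scale_def field_simps)

lemma moll_ball_subset:
  fixes x :: "'a::real_normed_vector"
  assumes "x \<in> ball 0 (R - \<delta>)" "\<delta> > 0"
  shows "ball x (2 * moll_scale \<delta> n) \<subseteq> cball 0 (R - \<delta> / 2)"
proof
  fix y assume "y \<in> ball x (2 * moll_scale \<delta> n)"
  then have "norm (x - y) < \<delta> / 2" using moll_scale(2)[OF assms(2), of n] by (simp add: dist_norm)
  moreover have "norm y \<le> norm x + norm (x - y)" using norm_triangle_ineq4[of x "x - y"] by simp
  ultimately show "y \<in> cball 0 (R - \<delta> / 2)" using assms(1) by simp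
qed

text \<open>Two mollified values at comparable scales \<open>t\<close> and at points of distance at most \<open>t\<close> differ by at most a multiple of
\<open>t powr (s - d / P)\<close>. Summing over the dyadic scales gives convergence, and comparing at the scale
\<open>|x - y|\<close> gives the Hoelder bound. For distant points the coarsest scale is used.\<close>

lemma moll_seq_limit_hoelder:
  fixes \<rho> :: "'a::euclidean_space \<Rightarrow> real"
  defines "d \<equiv> real DIM('a)"
  assumes \<rho>: "mollifier \<rho>" and P: "P \<ge> 1" and s: "s > 0" and g: "s - d / P > 0" and \<delta>: "0 < \<delta>" "\<delta> < R"
  shows "\<exists>C\<ge>0. \<exists>c\<ge>0. \<forall>G. G \<in> borel_measurable borel \<longrightarrow>
     integrable lebesgue (\<lambda>a. indicator (cball 0 (R - \<delta> / 2)) a * G a) \<longrightarrow>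
     local_energy P (d + s * P) (ball 0 R) G \<le> 1 \<longrightarrow>
     (\<forall>x\<in>ball 0 (R - \<delta>). \<forall>n. \<bar>lim (\<lambda>n. moll_seq \<rho> R \<delta> G n x) - moll_seq \<rho> R \<delta> G n x\<bar>
        \<le> c * (2 powr (- (s - d / P))) ^ n) \<and>
     (\<forall>x\<in>ball 0 (R - \<delta>). \<forall>y\<in>ball 0 (R - \<delta>).
        \<bar>lim (\<lambda>n. moll_seq \<rho> R \<delta> G n x) - lim (\<lambda>n. moll_seq \<rho> R \<delta> G n y)\<bar> \<le> C * norm (x - y) powr (s - d / P))"
proof -
  obtain M where M: "M > 0" "\<And>x. \<bar>\<rho> x\<bar> \<le> M"
    by (rule test_function_bounded) (use \<rho> in \<open>auto simp: mollifier_def\<close>)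
  have M': "\<rho> x \<le> M" for x using M(2)[of x] by simp
  define g where "g = s - d / P"
  define m where "m = s + d / P"
  define \<theta> where "\<theta> = 2 powr (- g)"
  have g0: "g > 0" using g by (simp add: g_def)
  have dP: "d / P \<ge> 0" using P by (simp add: d_def)
  have m0: "m > 0" using s dP by (simp add: m_def)
  have \<theta>: "0 < \<theta>" "\<theta> < 1" using g0 by (auto simp: \<theta>_def powr_less_one)
  let ?t = "moll_scale \<delta>"
  have t: "?t n > 0" for n using moll_scale[OF \<delta>(1)] by blast
  have tS: "?t (Suc n) = ?t n / 2" for n by (simp add: moll_scale_def)
  have tg: "?t n powr g = ?t 0 powr g * \<theta> ^ n" for n
    using \<delta> by (simp add: moll_scale_def \<theta>_def powr_divide powr_realpow[symmetric] powr_powr powr_mult powr_minus_divide mult.commute)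
  define C1 where "C1 = 1 + M\<^sup>2"
  have C1: "C1 \<ge> 0" by (simp add: C1_def)
  have scale: "(k * \<tau>) powr m * (\<tau> * (\<tau> / j)) powr (- d / P) = k powr m * j powr (d / P) * \<tau> powr g"
    if "k > 0" "\<tau> > 0" "j > 0" for k \<tau> j
  proof -
    have "(\<tau> * (\<tau> / j)) powr (- d / P) = j powr (d / P) * \<tau> powr (- 2 * d / P)"
    proof -
      have "(\<tau> * (\<tau> / j)) powr (- d / P) = (\<tau> powr (- d / P) * \<tau> powr (- d / P)) * (1 / j powr (- d / P))"
        using that by (simp add: powr_mult powr_divide)
      also have "\<tau> powr (- d / P) * \<tau> powr (- d / P) = \<tau> powr (- 2 * d / P)"
        by (simp flip: powr_add)
      also have "1 / j powr (- d / P) = j powr (d / P)" by (simp add: powr_minus_divide)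
      finally show ?thesis by simp
    qed
    moreover have "\<tau> powr m * \<tau> powr (- 2 * d / P) = \<tau> powr g"
      by (simp add: m_def g_def flip: powr_add)
    ultimately show ?thesis using that by (simp add: powr_mult mult.commute mult.left_commute)
  qed
  define c1 where "c1 = C1 * (4 powr m * 2 powr (d / P)) * ?t 0 powr g"
  define c where "c = c1 / (1 - \<theta>)"
  have c0: "c \<ge> 0" using C1 \<theta> by (simp add: c_def c1_def)
  \<comment> \<open>The Hoelder constants for points closer than the coarsest scale and for all others.\<close>
  define Cn where "Cn = (2 * c / ?t 0 powr g + C1 * 5 powr m) * 2 powr g"
  define Cf where "Cf = (2 * c + C1 * ((2 * R + \<delta>) powr m * (?t 0 * ?t 0) powr (- d / P))) / ?t 0 powr g"
  have Cn0: "Cn \<ge> 0" and Cf0: "Cf \<ge> 0" using c0 C1 by (auto simp: Cn_def Cf_def)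
  show ?thesis
  proof (rule exI[of _ "Cn + Cf"], rule conjI, rule add_nonneg_nonneg[OF Cn0 Cf0],
      rule exI[of _ c], rule conjI, rule c0, intro conjI allI impI ballI)
    fix G :: "'a \<Rightarrow> real"
    assume G: "G \<in> borel_measurable borel" "integrable lebesgue (\<lambda>a. indicator (cball 0 (R - \<delta> / 2)) a * G a)"
      and E: "local_energy P (d + s * P) (ball 0 R) G \<le> 1"
    let ?f = "moll_seq \<rho> R \<delta> G"
    let ?L = "\<lambda>x. lim (\<lambda>n. ?f n x)"
    have K: "cball 0 (R - \<delta> / 2) \<subseteq> ball (0::'a) R" using \<delta> by auto
    have diff: "\<bar>?f n x - ?f k y\<bar> \<le> C1 * (l powr m * (?t n * ?t k) powr (- d / P))"
      if "x \<in> ball 0 (R - \<delta>)" "y \<in> ball 0 (R - \<delta>)" "norm (x - y) + 2 * ?t n + 2 * ?t k \<le> l" for x y n k l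
      unfolding moll_seq_def C1_def m_def d_def
      by (rule mollified_difference_bound[OF \<rho> M' P G K open_ball E[unfolded d_def]])
         (use that t s in \<open>simp_all add: moll_ball_subset[OF _ \<delta>(1)]\<close>)
    have step: "\<bar>?f (Suc n) x - ?f n x\<bar> \<le> c1 * \<theta> ^ n" if x: "x \<in> ball 0 (R - \<delta>)" for x n
    proof -
      have "\<bar>?f n x - ?f (Suc n) x\<bar> \<le> C1 * ((4 * ?t n) powr m * (?t n * (?t n / 2)) powr (- d / P))"
        using diff[OF x x, of n "Suc n" "4 * ?t n"] t[of n] by (simp add: tS)
      also have "\<dots> = c1 * \<theta> ^ n"
        using scale[of 4 "?t n" 2] t[of n] by (simp add: c1_def tg[of n])
      finally show ?thesis by (simp add: abs_minus_commute)
    qed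
    have lim: "\<bar>?L x - ?f n x\<bar> \<le> c * \<theta> ^ n" if x: "x \<in> ball 0 (R - \<delta>)" for x n
      using geometric_cauchy_limit[OF step[OF x], of n] \<theta> by (simp add: c_def)
    then show "\<bar>?L x - ?f n x\<bar> \<le> c * (2 powr (- (s - d / P))) ^ n" if "x \<in> ball 0 (R - \<delta>)" for x n
      using that unfolding \<theta>_def g_def .
    fix x y :: 'a assume x: "x \<in> ball 0 (R - \<delta>)" and y: "y \<in> ball 0 (R - \<delta>)"
    have tri: "\<bar>?L x - ?L y\<bar> \<le> 2 * (c * \<theta> ^ n) + \<bar>?f n x - ?f n y\<bar>" for n
      using lim[OF x, of n] lim[OF y, of n] by linarith
    show "\<bar>?L x - ?L y\<bar> \<le> (Cn + Cf) * norm (x - y) powr (s - d / P)"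
    proof (cases "norm (x - y) \<le> ?t 0")
      case True
      show ?thesis
      proof (cases "x = y")
        case False
        let ?z = "norm (x - y)"
        have z: "?z > 0" using False by simp
        obtain n where n: "2 ^ n \<le> ?t 0 / ?z" "?t 0 / ?z < 2 ^ Suc n"
          using dyadic_index[of "?t 0 / ?z"] True z by auto
        have tn: "?t n = ?t 0 / 2 ^ n" by (simp add: moll_scale_def)
        have zt: "?z \<le> ?t n" "?t n \<le> 2 * ?z" using n z by (simp_all add: tn field_simps)
        have "\<bar>?f n x - ?f n y\<bar> \<le> C1 * ((5 * ?t n) powr m * (?t n * (?t n / 1)) powr (- d / P))"
          using diff[OF x y, of n n "5 * ?t n"] zt by simp
        also have "\<dots> = C1 * 5 powr m * ?t n powr g"
          using scale[of 5 "?t n" 1] t[of n] by simp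
        finally have "\<bar>?L x - ?L y\<bar> \<le> 2 * (c * \<theta> ^ n) + C1 * 5 powr m * ?t n powr g"
          using tri[of n] by linarith
        also have "\<theta> ^ n = ?t n powr g / ?t 0 powr g" using tg[of n] t[of 0] by simp
        finally have "\<bar>?L x - ?L y\<bar> \<le> (2 * c / ?t 0 powr g + C1 * 5 powr m) * ?t n powr g"
          by (simp add: algebra_simps)
        also have "\<dots> \<le> (2 * c / ?t 0 powr g + C1 * 5 powr m) * (2 * ?z) powr g"
          using zt t[of n] g0 c0 C1 by (intro mult_left_mono powr_mono2) auto
        also have "\<dots> = Cn * ?z powr g" by (simp add: Cn_def powr_mult)
        also have "\<dots> \<le> (Cn + Cf) * ?z powr g" using Cf0 by (intro mult_right_mono) auto
        finally show ?thesis unfolding g_def .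
      qed simp
    next
      case False
      let ?z = "norm (x - y)"
      have "norm (x - y) \<le> norm x + norm y" by (rule norm_triangle_ineq4)
      then have l: "norm (x - y) + 2 * ?t 0 + 2 * ?t 0 \<le> 2 * R + \<delta>"
        using x y \<delta> by (simp add: moll_scale_def)
      have "\<bar>?L x - ?L y\<bar> \<le> 2 * c + C1 * ((2 * R + \<delta>) powr m * (?t 0 * ?t 0) powr (- d / P))"
        using tri[of 0] diff[OF x y l] by simp
      also have "\<dots> = Cf * ?t 0 powr g" using t[of 0] by (simp add: Cf_def)
      also have "\<dots> \<le> Cf * ?z powr g" using False t[of 0] g0 Cf0 by (intro mult_left_mono powr_mono2) auto
      also have "\<dots> \<le> (Cn + Cf) * ?z powr g" using Cn0 by (intro mult_right_mono) auto
      finally show ?thesis unfolding g_def .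
    qed
  qed
qed

text \<open>For fixed \<open>x\<close> the function \<open>a \<mapsto> \<phi> (x - a)\<close> is a test function on \<open>\<Omega>\<close>; the sign from reflecting \<open>\<phi>\<close> cancels
the sign in the definition of the weak derivative.\<close>

lemma conv_weak_deriv:
  fixes u :: "'a::euclidean_space \<Rightarrow> real"
  assumes w: "has_weak_deriv \<Omega> [i] u w" and i: "i \<in> Basis" and \<Omega>: "open \<Omega>"
    and \<phi>: "test_function (ball 0 r) \<phi>" and K: "ball x r \<subseteq> K" "K \<subseteq> \<Omega>"
  shows "conv (partial_deriv [i] \<phi>) (\<lambda>a. indicator K a * u a) x = conv \<phi> (\<lambda>a. indicator K a * w a) x"
proof -
  let ?\<tau> = "\<lambda>a. 1 * \<phi> ((-1) *\<^sub>R a + x)"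
  have "test_function {a. (-1) *\<^sub>R a + x \<in> ball 0 r} ?\<tau>" by (rule test_function_affine[OF \<phi>]) simp
  moreover have "{a. (-1) *\<^sub>R a + x \<in> ball 0 r} = ball x r" by (auto simp: dist_norm norm_minus_commute)
  ultimately have \<tau>: "test_function (ball x r) ?\<tau>" by simp
  then have "test_function \<Omega> ?\<tau>" using K by (auto intro: test_function_mono)
  from has_weak_derivD[OF w this \<Omega>] i
  have eq: "(\<integral>a. partial_deriv [i] ?\<tau> a * u a \<partial>lebesgue) = - (\<integral>a. ?\<tau> a * w a \<partial>lebesgue)" by simp
  have d: "partial_deriv [i] ?\<tau> a = - partial_deriv [i] \<phi> (x - a)" for a
    using partial_deriv_affine[OF test_function_smooth[OF \<phi>], of i 1 "-1" x a] by simp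
  have \<phi>': "test_function (ball 0 r) (partial_deriv [i] \<phi>)"
    using i by (intro test_function_partial_deriv \<phi>) simp
  have out: "\<phi> (x - a) = 0" "partial_deriv [i] \<phi> (x - a) = 0" if "a \<notin> K" for a
  proof -
    have "a \<notin> ball x r" using that K(1) by blast
    then have "x - a \<notin> ball 0 r" by (simp add: dist_norm norm_minus_commute)
    then show "\<phi> (x - a) = 0" "partial_deriv [i] \<phi> (x - a) = 0"
      using test_function_outside \<phi> \<phi>' by blast+
  qed
  have "conv (partial_deriv [i] \<phi>) (\<lambda>a. indicator K a * u a) x = (\<integral>a. partial_deriv [i] \<phi> (x - a) * u a \<partial>lebesgue)"
    unfolding conv_def
    by (intro Bochner_Integration.integral_cong refl) (metis indicator_simps mult_1 mult_zero_left out(2))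
  also have "\<dots> = (\<integral>a. ?\<tau> a * w a \<partial>lebesgue)" using eq unfolding d by simp
  also have "\<dots> = conv \<phi> (\<lambda>a. indicator K a * w a) x"
    unfolding conv_def
  proof (intro Bochner_Integration.integral_cong refl)
    fix a
    show "?\<tau> a * w a = \<phi> (x - a) * (indicator K a * w a)" by (cases "a \<in> K") (auto simp: out)
  qed
  finally show ?thesis .
qed

text \<open>The mollifications of \<open>u\<close> converge to \<open>u\<close> because \<open>u\<close> is continuous. Their gradients are the mollifications of
the weak gradient, which converge uniformly away from the boundary. So \<open>u\<close> is differentiable and its
gradient is the Hoelder continuous limit.\<close>

lemma fractional_weak_gradient_C1:
  fixes \<rho> :: "'a::euclidean_space \<Rightarrow> real"
  defines "d \<equiv> real DIM('a)"
  assumes \<rho>: "mollifier \<rho>" and P: "P \<ge> 1" and s: "s > 0" and g: "s - d / P > 0" and \<delta>: "0 < \<delta>" "\<delta> < R"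
  shows "\<exists>C\<ge>0. \<forall>(u :: 'a \<Rightarrow> real) G. continuous_on (ball 0 R) u \<longrightarrow>
     (\<forall>i\<in>Basis. has_weak_deriv (ball 0 R) [i] u (G i) \<and> G i \<in> borel_measurable borel \<and>
       local_energy P (d + s * P) (ball 0 R) (G i) \<le> 1) \<longrightarrow>
     (\<exists>D. (\<forall>x\<in>ball 0 (R - \<delta>). (u has_derivative (\<lambda>h. \<Sum>i\<in>Basis. (h \<bullet> i) * D i x)) (at x)) \<and>
       (\<forall>i\<in>Basis. \<forall>x\<in>ball 0 (R - \<delta>). \<forall>y\<in>ball 0 (R - \<delta>). \<bar>D i x - D i y\<bar> \<le> C * norm (x - y) powr (s - d / P)))"
proof -
  let ?E = "local_energy P (d + s * P) (ball (0::'a) R)"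
  let ?B = "ball (0::'a) (R - \<delta>)" and ?K = "cball (0::'a) (R - \<delta> / 2)"
  let ?L = "\<lambda>G x. lim (\<lambda>n. moll_seq \<rho> R \<delta> G n x)"
  let ?\<theta> = "2 powr (- (s - d / P)) :: real"
  obtain C c where C: "C \<ge> 0" "c \<ge> 0" and *: "\<And>G. G \<in> borel_measurable borel \<Longrightarrow>
     integrable lebesgue (\<lambda>a. indicator ?K a * G a) \<Longrightarrow> ?E G \<le> 1 \<Longrightarrow>
     (\<forall>x\<in>?B. \<forall>n. \<bar>?L G x - moll_seq \<rho> R \<delta> G n x\<bar> \<le> c * ?\<theta> ^ n) \<and>
     (\<forall>x\<in>?B. \<forall>y\<in>?B. \<bar>?L G x - ?L G y\<bar> \<le> C * norm (x - y) powr (s - d / P))"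
  proof -
    have "\<exists>C\<ge>0. \<exists>c\<ge>0. \<forall>G. G \<in> borel_measurable borel \<longrightarrow>
       integrable lebesgue (\<lambda>a. indicator ?K a * G a) \<longrightarrow> ?E G \<le> 1 \<longrightarrow>
       (\<forall>x\<in>?B. \<forall>n. \<bar>?L G x - moll_seq \<rho> R \<delta> G n x\<bar> \<le> c * ?\<theta> ^ n) \<and>
       (\<forall>x\<in>?B. \<forall>y\<in>?B. \<bar>?L G x - ?L G y\<bar> \<le> C * norm (x - y) powr (s - d / P))"
      unfolding d_def by (rule moll_seq_limit_hoelder[OF \<rho> P s g[unfolded d_def] \<delta>])
    then show ?thesis using that by blast
  qed
  show ?thesis
  proof (intro exI[of _ C] conjI C allI impI)
    fix u :: "'a \<Rightarrow> real" and G :: "'a \<Rightarrow> 'a \<Rightarrow> real"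
    assume u: "continuous_on (ball 0 R) u"
      and G: "\<forall>i\<in>Basis. has_weak_deriv (ball 0 R) [i] u (G i) \<and> G i \<in> borel_measurable borel \<and> ?E (G i) \<le> 1"
    have K: "compact ?K" "?K \<subseteq> ball 0 R" using \<delta> by auto
    have GK: "integrable lebesgue (\<lambda>a. indicator ?K a * G i a)" if "i \<in> Basis" for i
      using loc_integrable_onD[OF _ K, of "G i"] G that by (auto simp: has_weak_deriv_def)
    have uK: "integrable lebesgue (\<lambda>a. indicator ?K a * u a)"
      using loc_integrable_onD[OF continuous_loc_integrable[OF u] K] by simp
    let ?D = "\<lambda>i x. ?L (G i) x"
    have conv: "\<bar>?D i x - moll_seq \<rho> R \<delta> (G i) n x\<bar> \<le> c * ?\<theta> ^ n" if "i \<in> Basis" "x \<in> ?B" for i x n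
      using *[OF _ GK[OF that(1)]] G that by blast
    have hoel: "\<bar>?D i x - ?D i y\<bar> \<le> C * norm (x - y) powr (s - d / P)" if "i \<in> Basis" "x \<in> ?B" "y \<in> ?B" for i x y
      using *[OF _ GK[OF that(1)]] G that by blast
    have B0: "0 \<in> ?B" using \<delta> by simp
    have tl: "test_function (ball 0 (2 * moll_scale \<delta> n)) (dilated (moll_scale \<delta> n) \<rho>)" for n
      by (rule dilated_test_function[OF \<rho> moll_scale(1)[OF \<delta>(1)]])
    have der: "(moll_seq \<rho> R \<delta> u n has_derivative (\<lambda>h. \<Sum>i\<in>Basis. (h \<bullet> i) * moll_seq \<rho> R \<delta> (G i) n x)) (at x within ?B)"
      if x: "x \<in> ?B" for n x
    proof -
      have "test_function UNIV (dilated (moll_scale \<delta> n) \<rho>)" using test_function_mono[OF tl] by blast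
      from conv_has_derivative[OF this uK, of x]
      have "(moll_seq \<rho> R \<delta> u n has_derivative (\<lambda>h. \<Sum>i\<in>Basis. (h \<bullet> i) *
          conv (partial_deriv [i] (dilated (moll_scale \<delta> n) \<rho>)) (\<lambda>a. indicator ?K a * u a) x)) (at x)"
        unfolding moll_seq_def .
      moreover have "conv (partial_deriv [i] (dilated (moll_scale \<delta> n) \<rho>)) (\<lambda>a. indicator ?K a * u a) x
          = moll_seq \<rho> R \<delta> (G i) n x" if "i \<in> Basis" for i
        unfolding moll_seq_def using G that
        by (intro conv_weak_deriv[OF _ that open_ball tl moll_ball_subset[OF x \<delta>(1)] K(2)]) blast
      ultimately show ?thesis by (simp add: has_derivative_at_withinI)
    qed
    have lim_u: "(\<lambda>n. moll_seq \<rho> R \<delta> u n x) \<longlonglongrightarrow> u x" if x: "x \<in> ?B" for x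
    proof (rule LIMSEQ_I)
      fix e :: real assume e: "e > 0"
      have "x \<in> ball 0 R" using x \<delta> by simp
      then have "isCont u x" using u by (simp add: continuous_on_eq_continuous_at)
      then obtain r where r: "r > 0" "\<And>y. dist y x < r \<Longrightarrow> dist (u y) (u x) < e / 2"
        using e unfolding continuous_at_eps_delta by (metis half_gt_zero)
      obtain N where N: "\<delta> / 2 / r < 2 ^ N" using real_arch_pow[of 2 "\<delta> / 2 / r"] by auto
      show "\<exists>no. \<forall>n\<ge>no. norm (moll_seq \<rho> R \<delta> u n x - u x) < e"
      proof (intro exI[of _ N] allI impI)
        fix n assume "n \<ge> N"
        then have "(2::real) ^ N \<le> 2 ^ n" by simp
        with N have "\<delta> / 2 / r < 2 ^ n" by linarith
        then have small: "2 * moll_scale \<delta> n < r" using r(1) by (simp add: moll_scale_def field_simps)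
        have "\<bar>moll_seq \<rho> R \<delta> u n x - u x\<bar> \<le> e / 2"
          unfolding moll_seq_def
        proof (rule conv_average_bound[OF \<rho> moll_scale(1)[OF \<delta>(1)] uK])
          fix a assume a: "dist x a < 2 * moll_scale \<delta> n"
          then have "a \<in> ?K" using moll_ball_subset[OF x \<delta>(1), of n] by auto
          moreover have "dist (u a) (u x) < e / 2" using a small by (intro r(2)) (simp add: dist_commute)
          ultimately show "\<bar>indicator ?K a * u a - u x\<bar> \<le> e / 2" by (simp add: dist_real_def)
        qed
        then show "norm (moll_seq \<rho> R \<delta> u n x - u x) < e" using e by simp
      qed
    qed
    have "\<exists>h. \<forall>x\<in>?B. (\<lambda>n. moll_seq \<rho> R \<delta> u n x) \<longlonglongrightarrow> h x \<and>
        (h has_derivative (\<lambda>h. \<Sum>i\<in>Basis. (h \<bullet> i) * ?D i x)) (at x within ?B)"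
    proof (rule has_derivative_sequence[OF convex_ball der _ B0 lim_u[OF B0]])
      fix e :: real assume e: "e > 0"
      have "(\<lambda>n. d * c * ?\<theta> ^ n) \<longlonglongrightarrow> d * c * 0"
        using g by (intro tendsto_mult tendsto_const LIMSEQ_realpow_zero) (auto simp: powr_less_one)
      then have "\<forall>\<^sub>F n in sequentially. d * c * ?\<theta> ^ n < e" using e by (simp add: order_tendsto_iff)
      then show "\<forall>\<^sub>F n in sequentially. \<forall>x\<in>?B. \<forall>h. norm ((\<Sum>i\<in>Basis. (h \<bullet> i) * moll_seq \<rho> R \<delta> (G i) n x)
          - (\<Sum>i\<in>Basis. (h \<bullet> i) * ?D i x)) \<le> e * norm h"
      proof (eventually_elim, intro ballI allI)
        fix n x and h :: 'a assume n: "d * c * ?\<theta> ^ n < e" and x: "x \<in> ?B"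
        have "norm ((\<Sum>i\<in>Basis. (h \<bullet> i) * moll_seq \<rho> R \<delta> (G i) n x) - (\<Sum>i\<in>Basis. (h \<bullet> i) * ?D i x))
            = norm (\<Sum>i\<in>Basis. (h \<bullet> i) * (moll_seq \<rho> R \<delta> (G i) n x - ?D i x))"
          by (simp add: sum_subtractf right_diff_distrib)
        also have "\<dots> \<le> (\<Sum>i\<in>(Basis::'a set). norm h * (c * ?\<theta> ^ n))"
        proof (rule order_trans[OF norm_sum], rule sum_mono)
          fix i :: 'a assume i: "i \<in> Basis"
          show "norm ((h \<bullet> i) * (moll_seq \<rho> R \<delta> (G i) n x - ?D i x)) \<le> norm h * (c * ?\<theta> ^ n)"
            using conv[OF i x, of n] Basis_le_norm[OF i, of h]
            by (simp only: real_norm_def abs_mult) (intro mult_mono, auto simp: abs_minus_commute)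
        qed
        also have "\<dots> = (d * c * ?\<theta> ^ n) * norm h" by (simp add: d_def)
        also have "\<dots> \<le> e * norm h" using n by (intro mult_right_mono) auto
        finally show "norm ((\<Sum>i\<in>Basis. (h \<bullet> i) * moll_seq \<rho> R \<delta> (G i) n x)
          - (\<Sum>i\<in>Basis. (h \<bullet> i) * ?D i x)) \<le> e * norm h" .
      qed
    qed
    then obtain h where h: "\<And>x. x \<in> ?B \<Longrightarrow> (\<lambda>n. moll_seq \<rho> R \<delta> u n x) \<longlonglongrightarrow> h x"
      "\<And>x. x \<in> ?B \<Longrightarrow> (h has_derivative (\<lambda>h. \<Sum>i\<in>Basis. (h \<bullet> i) * ?D i x)) (at x within ?B)" by blast
    have hu: "h x = u x" if "x \<in> ?B" for x using LIMSEQ_unique[OF h(1) lim_u] that by blast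
    have "(u has_derivative (\<lambda>h. \<Sum>i\<in>Basis. (h \<bullet> i) * ?D i x)) (at x)" if x: "x \<in> ?B" for x
    proof -
      have "(h has_derivative (\<lambda>h. \<Sum>i\<in>Basis. (h \<bullet> i) * ?D i x)) (at x)"
        using h(2)[OF x] at_within_open[OF x open_ball] by simp
      from has_derivative_transform_within_open[OF this open_ball x hu] show ?thesis .
    qed
    then show "\<exists>D. (\<forall>x\<in>?B. (u has_derivative (\<lambda>h. \<Sum>i\<in>Basis. (h \<bullet> i) * D i x)) (at x)) \<and>
       (\<forall>i\<in>Basis. \<forall>x\<in>?B. \<forall>y\<in>?B. \<bar>D i x - D i y\<bar> \<le> C * norm (x - y) powr (s - d / P))"
      using hoel by (intro exI[of _ ?D]) blast
  qed
qed

section \<open>Sobolev norms of order less than one\<close>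

lemma ex_borel_representative:
  fixes f :: "'a::euclidean_space \<Rightarrow> 'b::euclidean_space"
  assumes "f \<in> borel_measurable lebesgue"
  shows "\<exists>f'\<in>borel_measurable borel. AE x in lebesgue. f x = f' x"
proof -
  have "\<exists>g. g \<in> borel_measurable borel \<and> (AE x in lebesgue. f x \<bullet> j = g x)" for j
  proof -
    have "(\<lambda>x. f x \<bullet> j) \<in> borel_measurable lebesgue"
      using assms by (intro borel_measurable_inner borel_measurable_const)
    from completion_ex_borel_measurable_real[OF this] show ?thesis
      by (auto simp: AE_completion)
  qed
  then obtain g where g: "\<And>j. g j \<in> borel_measurable borel" "\<And>j. AE x in lebesgue. f x \<bullet> j = g j x" by metis
  have "AE x in lebesgue. \<forall>j\<in>Basis. f x \<bullet> j = g j x"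
    using g(2) by (intro AE_finite_allI) auto
  then have "AE x in lebesgue. f x = (\<Sum>j\<in>Basis. g j x *\<^sub>R j)"
  proof eventually_elim
    case (elim x)
    have "(\<Sum>j\<in>Basis. (f x \<bullet> j) *\<^sub>R j) = (\<Sum>j\<in>Basis. g j x *\<^sub>R j)"
      using elim by (intro sum.cong) auto
    then show ?case by (simp add: euclidean_representation)
  qed
  moreover have "(\<lambda>x. \<Sum>j\<in>Basis. g j x *\<^sub>R j) \<in> borel_measurable borel"
    by (intro borel_measurable_sum borel_measurable_scaleR g(1) borel_measurable_const)
  ultimately show ?thesis by (rule bexI)
qed

lemma loc_integrable_on_cong_AE:
  fixes u w :: "'a::euclidean_space \<Rightarrow> 'b::euclidean_space"
  assumes u: "loc_integrable_on u \<Omega>" and w: "w \<in> borel_measurable lebesgue"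
    and AE: "AE x in lebesgue. x \<in> \<Omega> \<longrightarrow> w x = u x"
  shows "loc_integrable_on w \<Omega>"
  unfolding loc_integrable_on_def
proof (intro allI impI)
  fix K assume K: "compact K \<and> K \<subseteq> \<Omega>"
  then have Ks: "K \<in> sets lebesgue" by (auto intro: fmeasurableD[OF lmeasurable_compact])
  have a: "integrable (lebesgue_on K) u" using u K by (auto simp: loc_integrable_on_def)
  have b: "AE x in lebesgue_on K. u x = w x"
    using AE K Ks by (subst AE_restrict_space_iff) (auto elim: eventually_mono)
  have c: "w \<in> borel_measurable (lebesgue_on K)" using w by (rule measurable_restrict_space1)
  show "integrable (lebesgue_on K) w" by (rule integrable_cong_AE_imp[OF a c b])
qed

lemma lp_energy_cong_AE:
  "AE x in lebesgue. u x = w x \<Longrightarrow> lp_energy p UNIV u = lp_energy p UNIV w"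
  unfolding lp_energy_def lebesgue_on_UNIV_eq
  by (rule nn_integral_cong_AE) (auto elim: eventually_mono)

lemma slobodeckij_energy_cong_AE:
  assumes "AE x in lebesgue. u x = w x"
  shows "slobodeckij_energy \<sigma> p UNIV u = slobodeckij_energy \<sigma> p UNIV w"
  unfolding slobodeckij_energy_def lebesgue_on_UNIV_eq
proof (rule nn_integral_cong_AE, use assms in eventually_elim)
  fix x assume x: "u x = w x"
  show "(\<integral>\<^sup>+y. ennreal (norm (u x - u y) powr p / norm (x - y) powr (real DIM('a) + \<sigma> * p)) \<partial>lebesgue) =
      (\<integral>\<^sup>+y. ennreal (norm (w x - w y) powr p / norm (x - y) powr (real DIM('a) + \<sigma> * p)) \<partial>lebesgue)"
    using assms x by (intro nn_integral_cong_AE) (auto elim: eventually_mono)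
qed

lemma has_weak_deriv_weak_deriv:
  assumes "\<exists>w. has_weak_deriv \<Omega> \<alpha> u w"
  shows "has_weak_deriv \<Omega> \<alpha> u (weak_deriv \<Omega> \<alpha> u)"
  unfolding weak_deriv_def by (rule someI_ex[OF assms])

lemma weak_gradient_measurable:
  fixes \<phi> :: "'a::euclidean_space \<Rightarrow> real"
  assumes wd: "weakly_differentiable_on \<phi> UNIV"
  shows "weak_gradient UNIV \<phi> \<in> borel_measurable lebesgue"
proof -
  have "weak_deriv UNIV [i] \<phi> \<in> borel_measurable lebesgue" if "i \<in> Basis" for i
  proof (rule loc_integrable_UNIV_measurable)
    have "\<exists>w. has_weak_deriv UNIV [i] \<phi> w"
      using wd that unfolding weakly_differentiable_on_def by simp
    then have "has_weak_deriv UNIV [i] \<phi> (weak_deriv UNIV [i] \<phi>)"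
      by (rule has_weak_deriv_weak_deriv)
    then show "loc_integrable_on (weak_deriv UNIV [i] \<phi>) UNIV" by (simp add: has_weak_deriv_def)
  qed
  then show ?thesis unfolding weak_gradient_def[abs_def]
    by (intro borel_measurable_sum borel_measurable_scaleR borel_measurable_const)
qed

text \<open>For order below \<open>1\<close> only the weak derivative of order zero enters. It is the function itself up to a
null set, which the energies ignore.\<close>

lemma sobolev_energy_order_lt_1:
  fixes u :: "'a::euclidean_space \<Rightarrow> 'b::euclidean_space" and \<rho> :: "'a \<Rightarrow> real"
  assumes \<rho>: "mollifier \<rho>" and u: "loc_integrable_on u UNIV" and \<sigma>: "0 < \<sigma>" "\<sigma> < 1"
  shows "sobolev_energy \<sigma> q UNIV u = lp_energy q UNIV u + slobodeckij_energy \<sigma> q UNIV u"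
    and "\<exists>w. has_weak_deriv UNIV [] u w"
proof -
  have w: "has_weak_deriv UNIV [] u u" unfolding has_weak_deriv_def using u by simp
  then show "\<exists>w. has_weak_deriv UNIV [] u w" by blast
  have "has_weak_deriv UNIV [] u (weak_deriv UNIV [] u)"
    unfolding weak_deriv_def by (rule someI[of "has_weak_deriv UNIV [] u", OF w])
  from has_weak_deriv_unique[OF \<rho> this w] have AE: "AE x in lebesgue. weak_deriv UNIV [] u x = u x" by simp
  have f: "nat \<lfloor>\<sigma>\<rfloor> = 0" "frac \<sigma> = \<sigma>" using \<sigma> by (auto simp: frac_eq floor_eq_iff)
  have "deriv_indices 0 = {[] :: 'a list}" by (auto simp: deriv_indices_def)
  then show "sobolev_energy \<sigma> q UNIV u = lp_energy q UNIV u + slobodeckij_energy \<sigma> q UNIV u"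
    unfolding sobolev_energy_def f using \<sigma>
    by (simp add: lp_energy_cong_AE[OF AE] slobodeckij_energy_cong_AE[OF AE])
qed

lemma sobolev_space_loc_integrable:
  assumes "u \<in> sobolev_space \<sigma> q UNIV"
  shows "loc_integrable_on u UNIV"
proof -
  have "[] \<in> deriv_indices 0" by (simp add: deriv_indices_def)
  then show ?thesis using assms unfolding sobolev_space_def has_weak_deriv_def by blast
qed

lemma ennreal_root_le:
  assumes "a \<le> ennreal (A powr p * c)" "A \<ge> 0" "c \<ge> 0" "p > 0"
  shows "ennreal_root p a \<le> ennreal (A * c powr (1 / p))"
proof -
  have "a \<noteq> \<infinity>" using assms(1) by (metis ennreal_neq_top infinity_ennreal_def neq_top_trans)
  moreover have "enn2real a \<le> A powr p * c"
    using assms by (simp add: enn2real_leI)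
  then have "enn2real a powr (1 / p) \<le> (A powr p * c) powr (1 / p)"
    using assms by (intro powr_mono2) auto
  then have "enn2real a powr (1 / p) \<le> A * c powr (1 / p)"
    using assms by (simp add: powr_mult powr_powr)
  ultimately show ?thesis by (simp add: ennreal_root_def ennreal_leI)
qed

lemma slobodeckij_energy_UNIV:
  fixes u :: "'a::euclidean_space \<Rightarrow> 'b::euclidean_space"
  shows "slobodeckij_energy \<sigma> p UNIV u = (\<integral>\<^sup>+x. (\<integral>\<^sup>+y. ennreal (norm (u x - u y) powr p /
     norm (x - y) powr (real DIM('a) + \<sigma> * p)) \<partial>lborel) \<partial>lborel)"
  unfolding slobodeckij_energy_def lebesgue_on_UNIV_eq nn_integral_completion ..

lemma lp_energy_UNIV: "lp_energy p UNIV u = (\<integral>\<^sup>+x. ennreal (norm (u x) powr p) \<partial>lborel)"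
  unfolding lp_energy_def lebesgue_on_UNIV_eq nn_integral_completion ..

text \<open>The weak gradient of \<open>\<phi>\<close> and the admissible fields \<open>v\<close> are replaced by Borel functions that agree with them almost
everywhere. Then \<open>multiplier_slobodeckij_bound\<close> applies with \<open>F\<close>, and the factor \<open>A\<close> comes out by
homogeneity.\<close>

lemma multiplier_norm_le:
  fixes \<phi> :: "'a::euclidean_space \<Rightarrow> real" and F :: "'a \<Rightarrow> 'a" and \<rho> :: "'a \<Rightarrow> real"
  defines "d \<equiv> real DIM('a)"
  assumes \<rho>: "mollifier \<rho>" and wd: "weakly_differentiable_on \<phi> UNIV"
    and gr: "AE x in lebesgue. weak_gradient UNIV \<phi> x = A *\<^sub>R F x" and A: "A \<ge> 0"
    and H: "(\<lambda>(x, y). H x y) \<in> borel_measurable (lborel \<Otimes>\<^sub>M lborel)"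
    and H0: "\<And>x y. H x y \<ge> 0" and q: "0 < q" "q < P" and \<sigma>: "0 < \<sigma>" "\<sigma> < s" "\<sigma> < 1"
    and g: "0 < g" "g < \<sigma>" "g \<le> s - d / P" and hol: "\<And>x y. H x y \<le> c * norm (x - y) powr g" and c: "c \<ge> 0"
    and E: "(\<integral>\<^sup>+y. (\<integral>\<^sup>+x. ennreal (H x y powr P / norm (x - y) powr (d + s * P)) \<partial>lborel) \<partial>lborel) \<le> 1"
    and F: "F \<in> borel_measurable borel" and F0: "\<And>x. norm (F x) \<le> c0"
    and F1: "\<And>x y. norm (F x - F y) \<le> H x y + c1 * min 1 (norm (x - y))" and c01: "c0 \<ge> 0" "c1 \<ge> 0"
  shows "multiplier_norm (1 + \<sigma>) q \<phi>
    \<le> ennreal (A * (c0 powr q + max 0 (multiplier_const TYPE('a) q \<sigma> s g c c0 c1)) powr (1 / q))"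
proof -
  let ?m = "max 0 (multiplier_const TYPE('a) q \<sigma> s g c c0 c1)"
  have "sobolev_norm \<sigma> q UNIV (\<lambda>x. weak_gradient UNIV \<phi> x \<bullet> v x) \<le> ennreal (A * (c0 powr q + ?m) powr (1 / q))"
    if v: "sobolev_norm \<sigma> q UNIV v = 1" for v :: "'a \<Rightarrow> 'a"
  proof -
    have vs: "v \<in> sobolev_space \<sigma> q UNIV" using v by (auto simp: sobolev_norm_def split: if_splits)
    have vl: "loc_integrable_on v UNIV" by (rule sobolev_space_loc_integrable[OF vs])
    have "ennreal_root q (sobolev_energy \<sigma> q UNIV v) = 1" using v vs by (simp add: sobolev_norm_def)
    then have "sobolev_energy \<sigma> q UNIV v \<noteq> \<infinity>" "enn2real (sobolev_energy \<sigma> q UNIV v) powr (1 / q) = 1"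
      by (auto simp: ennreal_root_def split: if_splits)
    moreover have "enn2real (sobolev_energy \<sigma> q UNIV v)
        = (enn2real (sobolev_energy \<sigma> q UNIV v) powr (1 / q)) powr q"
      using q by (simp add: powr_powr)
    ultimately have fin: "sobolev_energy \<sigma> q UNIV v < top" and "enn2real (sobolev_energy \<sigma> q UNIV v) = 1"
      by (simp_all add: less_top[symmetric])
    then have "sobolev_energy \<sigma> q UNIV v = 1"
      using ennreal_enn2real[OF fin] by simp
    then have e1: "lp_energy q UNIV v + slobodeckij_energy \<sigma> q UNIV v = 1"
      using sobolev_energy_order_lt_1(1)[OF \<rho> vl \<sigma>(1,3)] by simp
    have ev: "lp_energy q UNIV v \<le> 1" "slobodeckij_energy \<sigma> q UNIV v \<le> 1"
      unfolding e1[symmetric] by simp_all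
    obtain v' where v': "v' \<in> borel_measurable borel" "AE x in lebesgue. v x = v' x"
      using ex_borel_representative[OF loc_integrable_UNIV_measurable[OF vl]] by blast
    let ?z = "\<lambda>x. weak_gradient UNIV \<phi> x \<bullet> v x" and ?y = "\<lambda>x. A * (F x \<bullet> v' x)"
    have zy: "AE x in lebesgue. ?z x = ?y x" using gr v'(2) by eventually_elim simp
    have yL: "lp_energy q UNIV ?y \<le> ennreal (A powr q * c0 powr q)"
    proof -
      have "lp_energy q UNIV ?y \<le> (\<integral>\<^sup>+x. ennreal (A powr q * c0 powr q) * ennreal (norm (v' x) powr q) \<partial>lborel)"
        unfolding lp_energy_UNIV
      proof (rule nn_integral_mono)
        fix x
        have "\<bar>F x \<bullet> v' x\<bar> \<le> c0 * norm (v' x)"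
          by (rule order_trans[OF Cauchy_Schwarz_ineq2 mult_right_mono[OF F0 norm_ge_zero]])
        from mult_left_mono[OF this A] have "norm (?y x) \<le> A * (c0 * norm (v' x))"
          unfolding real_norm_def abs_mult using A by (simp only: abs_of_nonneg)
        then have "norm (?y x) powr q \<le> (A * (c0 * norm (v' x))) powr q"
          using q by (intro powr_mono2) auto
        also have "\<dots> = A powr q * c0 powr q * norm (v' x) powr q"
          using A c01 by (simp add: powr_mult)
        finally show "ennreal (norm (?y x) powr q) \<le> ennreal (A powr q * c0 powr q) * ennreal (norm (v' x) powr q)"
          by (simp add: ennreal_mult[symmetric] ennreal_leI)
      qed
      also have "\<dots> = ennreal (A powr q * c0 powr q) * lp_energy q UNIV v'"
        unfolding lp_energy_UNIV using v'(1) by (intro nn_integral_cmult) measurable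
      also have "lp_energy q UNIV v' = lp_energy q UNIV v" by (rule lp_energy_cong_AE[OF v'(2), symmetric])
      finally show ?thesis using mult_left_mono[OF ev(1), of "ennreal (A powr q * c0 powr q)"] by simp
    qed
    have "slobodeckij_energy \<sigma> q UNIV (\<lambda>x. F x \<bullet> v' x) \<le> ennreal (multiplier_const TYPE('a) q \<sigma> s g c c0 c1)"
      unfolding slobodeckij_energy_UNIV
    proof (rule multiplier_slobodeckij_bound[OF H H0 q \<sigma> g(1,2) g(3)[unfolded d_def] hol c E[unfolded d_def] F F0 F1 c01 v'(1)])
      show "(\<integral>\<^sup>+x. ennreal (norm (v' x) powr q) \<partial>lborel) \<le> 1"
        using ev(1) lp_energy_cong_AE[OF v'(2), of q] lp_energy_UNIV[of q v'] by (simp only:)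
      show "(\<integral>\<^sup>+x. (\<integral>\<^sup>+y. ennreal (norm (v' x - v' y) powr q / norm (x - y) powr (real DIM('a) + \<sigma> * q)) \<partial>lborel) \<partial>lborel) \<le> 1"
        using ev(2) slobodeckij_energy_cong_AE[OF v'(2), of \<sigma> q] slobodeckij_energy_UNIV[of \<sigma> q v'] by (simp only:)
    qed
    also have "\<dots> \<le> ennreal ?m" by (intro ennreal_leI) simp
    finally have ys: "slobodeckij_energy \<sigma> q UNIV (\<lambda>x. F x \<bullet> v' x) \<le> ennreal ?m" .
    have "slobodeckij_energy \<sigma> q UNIV ?y = ennreal (A powr q) * slobodeckij_energy \<sigma> q UNIV (\<lambda>x. F x \<bullet> v' x)"
    proof -
      have "ennreal (norm (?y x - ?y y) powr q / k) = ennreal (A powr q) * ennreal (norm (F x \<bullet> v' x - F y \<bullet> v' y) powr q / k)"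
        if "k \<ge> 0" for x y k
        using A that by (simp add: right_diff_distrib[symmetric] abs_mult powr_mult ennreal_mult[symmetric])
      moreover have "(\<lambda>(x, y). ennreal (norm (F x \<bullet> v' x - F y \<bullet> v' y) powr q / norm (x - y) powr (real DIM('a) + \<sigma> * q)))
          \<in> borel_measurable (lborel \<Otimes>\<^sub>M lborel)"
        using F v'(1) by measurable
      ultimately show ?thesis
        using F v'(1) unfolding slobodeckij_energy_UNIV by (simp add: nn_integral_cmult)
    qed
    with ys have yS: "slobodeckij_energy \<sigma> q UNIV ?y \<le> ennreal (A powr q * ?m)"
      using mult_left_mono[OF ys, of "ennreal (A powr q)"] by (simp add: ennreal_mult)
    have "lp_energy q UNIV ?z + slobodeckij_energy \<sigma> q UNIV ?z \<le> ennreal (A powr q * c0 powr q) + ennreal (A powr q * ?m)"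
      unfolding lp_energy_cong_AE[OF zy] slobodeckij_energy_cong_AE[OF zy] by (intro add_mono yL yS)
    also have "\<dots> = ennreal (A powr q * (c0 powr q + ?m))" by (simp add: ennreal_plus[symmetric] distrib_left del: ennreal_plus)
    finally have ez: "lp_energy q UNIV ?z + slobodeckij_energy \<sigma> q UNIV ?z \<le> ennreal (A powr q * (c0 powr q + ?m))" .
    have wgm: "weak_gradient UNIV \<phi> \<in> borel_measurable lebesgue" by (rule weak_gradient_measurable[OF wd])
    have zm: "?z \<in> borel_measurable lebesgue"
      by (rule borel_measurable_inner[OF wgm loc_integrable_UNIV_measurable[OF vl]])
    have F': "F \<in> borel_measurable lborel" using F by simp
    have zl: "loc_integrable_on ?z UNIV"
    proof (rule loc_integrable_on_cong_AE[OF _ zm])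
      show "loc_integrable_on (\<lambda>x. A * (F x \<bullet> v x)) UNIV"
        unfolding loc_integrable_on_def
      proof (intro allI impI)
        fix K :: "'a set" assume "compact K \<and> K \<subseteq> UNIV"
        then have vK: "integrable (lebesgue_on K) v" using vl by (auto simp: loc_integrable_on_def)
        have "integrable (lebesgue_on K) (\<lambda>x. F x \<bullet> v x)"
        proof (rule Bochner_Integration.integrable_bound)
          show "integrable (lebesgue_on K) (\<lambda>x. c0 * norm (v x))" using vK by simp
          show "(\<lambda>x. F x \<bullet> v x) \<in> borel_measurable (lebesgue_on K)"
            by (rule borel_measurable_inner[OF measurable_restrict_space1[OF measurable_completion[OF F']]
                  borel_measurable_integrable[OF vK]])
          have "norm (F x \<bullet> v x) \<le> norm (c0 * norm (v x))" for x
            using Cauchy_Schwarz_ineq2[of "F x" "v x"] mult_right_mono[OF F0, of "norm (v x)" x] by simp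
          then show "AE x in lebesgue_on K. norm (F x \<bullet> v x) \<le> norm (c0 * norm (v x))" by simp
        qed
        then show "integrable (lebesgue_on K) (\<lambda>x. A * (F x \<bullet> v x))" by simp
      qed
      show "AE x in lebesgue. x \<in> UNIV \<longrightarrow> ?z x = A * (F x \<bullet> v x)" using gr by eventually_elim simp
    qed
    have en: "sobolev_energy \<sigma> q UNIV ?z \<le> ennreal (A powr q * (c0 powr q + ?m))"
      using ez sobolev_energy_order_lt_1(1)[OF \<rho> zl \<sigma>(1,3)] by simp
    have "nat \<lfloor>\<sigma>\<rfloor> = 0" using \<sigma> by (simp add: floor_eq_iff)
    moreover have "deriv_indices 0 = {[] :: 'a list}" by (auto simp: deriv_indices_def)
    ultimately have "?z \<in> sobolev_space \<sigma> q UNIV"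
      unfolding sobolev_space_def lebesgue_on_UNIV_eq
      using zm sobolev_energy_order_lt_1(2)[OF \<rho> zl \<sigma>(1,3)] le_less_trans[OF en ennreal_less_top] by simp
    then show ?thesis
      unfolding sobolev_norm_def using ennreal_root_le[OF en A] q by simp
  qed
  then show ?thesis using wd by (auto simp: multiplier_norm_def intro: SUP_least)
qed

section \<open>Rescaling and Borel representatives\<close>

lemma nn_integral_lborel_scale:
  fixes f :: "'a::euclidean_space \<Rightarrow> ennreal"
  assumes "f \<in> borel_measurable borel" "r > 0"
  shows "(\<integral>\<^sup>+x. f (r *\<^sub>R x) \<partial>lborel) = ennreal (r powr (- real DIM('a))) * (\<integral>\<^sup>+x. f x \<partial>lborel)"
proof -
  have "(\<integral>\<^sup>+x. f x \<partial>lborel) = ennreal (r ^ DIM('a)) * (\<integral>\<^sup>+x. f (r *\<^sub>R x) \<partial>lborel)"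
    using assms by (subst lborel_affine[of r 0])
      (simp_all add: nn_integral_density nn_integral_distr nn_integral_cmult)
  then have "ennreal (r powr (- real DIM('a))) * (\<integral>\<^sup>+x. f x \<partial>lborel)
      = ennreal (r powr (- real DIM('a)) * r ^ DIM('a)) * (\<integral>\<^sup>+x. f (r *\<^sub>R x) \<partial>lborel)"
    using assms by (simp add: ennreal_mult mult.assoc)
  also have "r powr (- real DIM('a)) * r ^ DIM('a) = 1"
    using assms by (simp add: powr_minus_divide powr_realpow)
  finally show ?thesis by simp
qed

lemma slobodeckij_energy_local:
  fixes u w :: "'a::euclidean_space \<Rightarrow> real"
  assumes \<Omega>: "open \<Omega>" and AE: "AE x in lebesgue. x \<in> \<Omega> \<longrightarrow> u x = w x"
  shows "slobodeckij_energy \<sigma> p \<Omega> u = local_energy p (real DIM('a) + \<sigma> * p) \<Omega> w"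
proof -
  let ?k = "\<lambda>u x y. ennreal (norm (u x - u y) powr p / norm (x - y) powr (real DIM('a) + \<sigma> * p))"
  have \<Omega>s: "\<Omega> \<inter> space lebesgue \<in> sets lebesgue" using \<Omega> by simp
  have "slobodeckij_energy \<sigma> p \<Omega> u
      = (\<integral>\<^sup>+x. (\<integral>\<^sup>+y. ?k u x y * indicator \<Omega> y \<partial>lebesgue) * indicator \<Omega> x \<partial>lebesgue)"
    unfolding slobodeckij_energy_def nn_integral_restrict_space[OF \<Omega>s] ..
  also have "\<dots> = (\<integral>\<^sup>+x. (\<integral>\<^sup>+y. indicator \<Omega> x * (indicator \<Omega> y * ?k w x y) \<partial>lebesgue) \<partial>lebesgue)"
  proof (rule nn_integral_cong_AE, use AE in eventually_elim)
    fix x assume x: "x \<in> \<Omega> \<longrightarrow> u x = w x"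
    show "(\<integral>\<^sup>+y. ?k u x y * indicator \<Omega> y \<partial>lebesgue) * indicator \<Omega> x
        = (\<integral>\<^sup>+y. indicator \<Omega> x * (indicator \<Omega> y * ?k w x y) \<partial>lebesgue)"
    proof (cases "x \<in> \<Omega>")
      case True
      have "(\<integral>\<^sup>+y. ?k u x y * indicator \<Omega> y \<partial>lebesgue) = (\<integral>\<^sup>+y. indicator \<Omega> x * (indicator \<Omega> y * ?k w x y) \<partial>lebesgue)"
      proof (rule nn_integral_cong_AE, use AE in eventually_elim)
        fix y assume "y \<in> \<Omega> \<longrightarrow> u y = w y"
        then show "?k u x y * indicator \<Omega> y = indicator \<Omega> x * (indicator \<Omega> y * ?k w x y)"
          using x True by (cases "y \<in> \<Omega>") auto
      qed
      then show ?thesis using True by simp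
    qed simp
  qed
  finally show ?thesis unfolding local_energy_def nn_integral_completion real_norm_def .
qed

lemma local_energy_rescale:
  fixes w :: "'a::euclidean_space \<Rightarrow> real"
  assumes [measurable]: "w \<in> borel_measurable borel" and r: "r > 0" and k: "k \<ge> 0"
  shows "local_energy P e (ball 0 R) (\<lambda>y. k * w (r *\<^sub>R y))
    = ennreal (k powr P * r powr (e - 2 * real DIM('a))) * local_energy P e (ball 0 (R * r)) w"
proof -
  let ?f = "\<lambda>a b. indicator (ball 0 (R * r)) a * (indicator (ball 0 (R * r)) b *
     ennreal (\<bar>w a - w b\<bar> powr P / norm (a - b) powr e)) :: ennreal"
  have pt: "indicator (ball 0 R) a * (indicator (ball 0 R) b *
      ennreal (\<bar>k * w (r *\<^sub>R a) - k * w (r *\<^sub>R b)\<bar> powr P / norm (a - b) powr e))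
    = ennreal (k powr P * r powr e) * ?f (r *\<^sub>R a) (r *\<^sub>R b)" for a b :: 'a
  proof -
    have i: "indicator (ball 0 R) x = (indicator (ball 0 (R * r)) (r *\<^sub>R x) :: ennreal)" for x :: 'a
      using r by (simp add: indicator_def mult.commute[of R])
    have "\<bar>k * w (r *\<^sub>R a) - k * w (r *\<^sub>R b)\<bar> powr P / norm (a - b) powr e
        = (k powr P * r powr e) * (\<bar>w (r *\<^sub>R a) - w (r *\<^sub>R b)\<bar> powr P / norm (r *\<^sub>R a - r *\<^sub>R b) powr e)"
      using r k by (simp add: right_diff_distrib[symmetric] scaleR_diff_right[symmetric] abs_mult powr_mult)
    then have "ennreal (\<bar>k * w (r *\<^sub>R a) - k * w (r *\<^sub>R b)\<bar> powr P / norm (a - b) powr e)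
        = ennreal (k powr P * r powr e) * ennreal (\<bar>w (r *\<^sub>R a) - w (r *\<^sub>R b)\<bar> powr P / norm (r *\<^sub>R a - r *\<^sub>R b) powr e)"
      by (simp only:) (rule ennreal_mult, auto)
    then show ?thesis unfolding i by (simp only: mult.left_commute)
  qed
  have [measurable]: "ball (0::'a) (R * r) \<in> sets borel" by simp
  have m1: "(\<lambda>a. \<integral>\<^sup>+b. ?f a b \<partial>lborel) \<in> borel_measurable borel" by measurable
  have m2: "?f a \<in> borel_measurable borel" for a by measurable
  have "local_energy P e (ball 0 R) (\<lambda>y. k * w (r *\<^sub>R y))
      = (\<integral>\<^sup>+a. (\<integral>\<^sup>+b. ennreal (k powr P * r powr e) * ?f (r *\<^sub>R a) (r *\<^sub>R b) \<partial>lborel) \<partial>lborel)"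
    unfolding local_energy_def pt ..
  also have "\<dots> = (\<integral>\<^sup>+a. ennreal (k powr P * r powr e) * (\<integral>\<^sup>+b. ?f (r *\<^sub>R a) (r *\<^sub>R b) \<partial>lborel) \<partial>lborel)"
    by (intro nn_integral_cong nn_integral_cmult) measurable
  also have "\<dots> = ennreal (k powr P * r powr e) * (\<integral>\<^sup>+a. (\<integral>\<^sup>+b. ?f (r *\<^sub>R a) (r *\<^sub>R b) \<partial>lborel) \<partial>lborel)"
    by (rule nn_integral_cmult) measurable
  also have "(\<integral>\<^sup>+a. (\<integral>\<^sup>+b. ?f (r *\<^sub>R a) (r *\<^sub>R b) \<partial>lborel) \<partial>lborel)
      = (\<integral>\<^sup>+a. ennreal (r powr (- real DIM('a))) * (\<integral>\<^sup>+b. ?f (r *\<^sub>R a) b \<partial>lborel) \<partial>lborel)"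
    by (intro nn_integral_cong nn_integral_lborel_scale m2 r)
  also have "\<dots> = ennreal (r powr (- real DIM('a))) * (\<integral>\<^sup>+a. (\<integral>\<^sup>+b. ?f (r *\<^sub>R a) b \<partial>lborel) \<partial>lborel)"
    by (rule nn_integral_cmult) measurable
  also have "(\<integral>\<^sup>+a. (\<integral>\<^sup>+b. ?f (r *\<^sub>R a) b \<partial>lborel) \<partial>lborel)
      = ennreal (r powr (- real DIM('a))) * local_energy P e (ball 0 (R * r)) w"
    unfolding local_energy_def by (rule nn_integral_lborel_scale[OF m1 r])
  also have "ennreal (k powr P * r powr e) * (ennreal (r powr (- real DIM('a))) *
      (ennreal (r powr (- real DIM('a))) * local_energy P e (ball 0 (R * r)) w))
    = ennreal (k powr P * r powr e * (r powr (- real DIM('a)) * r powr (- real DIM('a)))) * local_energy P e (ball 0 (R * r)) w"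
    by (simp add: ennreal_mult mult.assoc)
  also have "k powr P * r powr e * (r powr (- real DIM('a)) * r powr (- real DIM('a)))
      = k powr P * r powr (e - 2 * real DIM('a))"
    by (simp add: mult.assoc flip: powr_add)
  finally show ?thesis .
qed

lemma has_weak_deriv_cong_AE:
  fixes u w w' :: "'a::euclidean_space \<Rightarrow> real"
  assumes w: "has_weak_deriv \<Omega> \<alpha> u w" and w': "w' \<in> borel_measurable borel"
    and AE: "AE x in lebesgue. x \<in> \<Omega> \<longrightarrow> w' x = w x" and \<Omega>: "open \<Omega>"
  shows "has_weak_deriv \<Omega> \<alpha> u w'"
proof -
  have l: "loc_integrable_on u \<Omega>" "loc_integrable_on w \<Omega>" using w by (auto simp: has_weak_deriv_def)
  have "(\<integral>x. \<phi> x *\<^sub>R w' x \<partial>lebesgue_on \<Omega>) = (\<integral>x. \<phi> x *\<^sub>R w x \<partial>lebesgue_on \<Omega>)"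
    if \<phi>: "test_function \<Omega> \<phi>" for \<phi>
  proof -
    have \<Omega>s: "\<Omega> \<in> sets lebesgue" using \<Omega> by simp
    have a: "(\<lambda>x. \<phi> x *\<^sub>R w' x) \<in> borel_measurable lebesgue"
      by (intro borel_imp_lebesgue borel_measurable_scaleR smooth_borel[OF test_function_smooth[OF \<phi>]] w')
    have b: "(\<lambda>x. \<phi> x *\<^sub>R w x) \<in> borel_measurable lebesgue"
      by (rule borel_measurable_integrable[OF test_function_times_integrable[OF \<phi> l(2)]])
    have "AE x in lebesgue. \<phi> x *\<^sub>R w' x = \<phi> x *\<^sub>R w x"
      using AE by eventually_elim (metis mult_zero_left real_scaleR_def test_function_outside[OF \<phi>])
    then show ?thesis
      unfolding test_function_integral_lebesgue_on[OF \<phi> \<Omega>s] by (rule integral_cong_AE[OF a b])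
  qed
  moreover have "loc_integrable_on w' \<Omega>"
    by (rule loc_integrable_on_cong_AE[OF l(2) borel_imp_lebesgue[OF w'] AE])
  ultimately show ?thesis using w unfolding has_weak_deriv_def by simp
qed

lemma loc_integrable_ball_ex_borel:
  fixes w :: "'a::euclidean_space \<Rightarrow> real"
  assumes "loc_integrable_on w (ball 0 R)"
  shows "\<exists>w'\<in>borel_measurable borel. AE x in lebesgue. x \<in> ball 0 R \<longrightarrow> w' x = w x"
proof -
  let ?K = "\<lambda>n::nat. cball (0::'a) (R - 1 / real (Suc n))"
  have "(\<lambda>x. indicator (ball 0 R) x *\<^sub>R w x) \<in> borel_measurable lebesgue"
  proof (rule loc_integrable_measurable[OF assms])
    show "compact (?K n) \<and> ?K n \<subseteq> ball 0 R" for n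
    proof -
      have "cball (0::'a) (R - a) \<subseteq> ball 0 R" if "a > 0" for a using that by auto
      from this[of "1 / real (Suc n)"] show ?thesis by simp
    qed
    show "\<forall>\<^sub>F n in sequentially. x \<in> ?K n" if "x \<in> ball 0 R" for x
    proof -
      have "(\<lambda>n. inverse (real (Suc n))) \<longlonglongrightarrow> 0" by (rule LIMSEQ_inverse_real_of_nat)
      moreover have "0 < R - norm x" using that by simp
      ultimately have "\<forall>\<^sub>F n in sequentially. inverse (real (Suc n)) < R - norm x"
        by (rule order_tendstoD(2))
      then show ?thesis by eventually_elim (simp add: inverse_eq_divide)
    qed
  qed
  then obtain w' where w': "w' \<in> borel_measurable borel"
    "AE x in lebesgue. indicator (ball 0 R) x *\<^sub>R w x = w' x"
    using ex_borel_representative by blast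
  from w'(2) have "AE x in lebesgue. x \<in> ball 0 R \<longrightarrow> w' x = w x" by eventually_elim auto
  with w'(1) show ?thesis by blast
qed

lemma has_weak_deriv_rescale:
  fixes u w :: "'a::euclidean_space \<Rightarrow> real"
  assumes uw: "has_weak_deriv (ball 0 (R * r)) [i] u w" and r: "r > 0" and i: "i \<in> Basis"
    and w: "w \<in> borel_measurable borel" and u: "continuous_on (ball 0 (R * r)) u"
  shows "has_weak_deriv (ball 0 R) [i] (\<lambda>y. k * u (r *\<^sub>R y)) (\<lambda>y. k * r * w (r *\<^sub>R y))"
proof -
  have lw: "loc_integrable_on w (ball 0 (R * r))" using uw by (simp add: has_weak_deriv_def)
  have in_ball: "r *\<^sub>R y \<in> ball 0 (R * r) \<longleftrightarrow> y \<in> ball 0 R" for y :: 'a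
    using r by (simp add: mult.commute[of R])
  have "continuous_on (ball 0 R) (\<lambda>y. k * u (r *\<^sub>R y))"
    by (intro continuous_intros continuous_on_compose2[OF u]) (use in_ball in blast)
  then have l1: "loc_integrable_on (\<lambda>y. k * u (r *\<^sub>R y)) (ball 0 R)" by (rule continuous_loc_integrable)
  have l2: "loc_integrable_on (\<lambda>y. k * r * w (r *\<^sub>R y)) (ball 0 R)"
    unfolding loc_integrable_on_def
  proof (intro allI impI)
    fix K :: "'a set" assume K: "compact K \<and> K \<subseteq> ball 0 R"
    let ?K = "(\<lambda>y. r *\<^sub>R y) ` K"
    have K': "compact ?K" "?K \<subseteq> ball 0 (R * r)"
      using K in_ball by (auto intro!: compact_continuous_image continuous_intros simp del: mem_ball)
    have Kb: "?K \<in> sets borel" using K'(1) by (simp add: compact_imp_closed)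
    let ?f = "\<lambda>x. indicator ?K x *\<^sub>R w x"
    have fb: "?f \<in> borel_measurable borel" using w Kb by (intro borel_measurable_scaleR borel_measurable_indicator)
    have "integrable lebesgue ?f" by (rule loc_integrable_onD[OF lw K'])
    then have fin: "(\<integral>\<^sup>+x. ennreal (norm (?f x)) \<partial>lborel) < \<infinity>"
      by (simp add: integrable_iff_bounded nn_integral_completion)
    have "(\<integral>\<^sup>+y. ennreal (norm (?f (r *\<^sub>R y))) \<partial>lborel) < \<infinity>"
      using fin fb nn_integral_lborel_scale[of "\<lambda>x. ennreal (norm (?f x))" r] r
      by (simp add: ennreal_mult_less_top)
    moreover have "(\<lambda>y. ?f (r *\<^sub>R y)) \<in> borel_measurable borel"
      by (rule measurable_compose[OF _ fb]) simp
    ultimately have "integrable lborel (\<lambda>y. ?f (r *\<^sub>R y))" by (simp add: integrable_iff_bounded)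
    then have "integrable lebesgue (\<lambda>y. ?f (r *\<^sub>R y))"
      using \<open>(\<lambda>y. ?f (r *\<^sub>R y)) \<in> borel_measurable borel\<close> by (simp add: integrable_completion)
    moreover have "(\<lambda>y. ?f (r *\<^sub>R y)) = (\<lambda>y. indicator K y *\<^sub>R w (r *\<^sub>R y))"
      using r by (intro ext) (simp add: indicator_def image_iff)
    ultimately have "integrable lebesgue (\<lambda>y. indicator K y *\<^sub>R w (r *\<^sub>R y))" by (simp only:)
    moreover have "K \<inter> space lebesgue \<in> sets lebesgue"
      using K by (auto intro: fmeasurableD[OF lmeasurable_compact])
    ultimately have "integrable (lebesgue_on K) (\<lambda>y. w (r *\<^sub>R y))"
      using integrable_restrict_space by blast
    then show "integrable (lebesgue_on K) (\<lambda>y. k * r * w (r *\<^sub>R y))" by simp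
  qed
  have "(\<integral>y. partial_deriv [i] \<phi> y *\<^sub>R (k * u (r *\<^sub>R y)) \<partial>lebesgue_on (ball 0 R))
      = (-1) ^ length [i] *\<^sub>R (\<integral>y. \<phi> y *\<^sub>R (k * r * w (r *\<^sub>R y)) \<partial>lebesgue_on (ball 0 R))"
    if \<phi>: "test_function (ball 0 R) \<phi>" for \<phi>
  proof -
    \<comment> \<open>A test function on the unscaled ball; the shape of the term is that of the lemmas on affine
      substitutions.\<close>
    let ?\<phi> = "\<lambda>x. 1 * \<phi> ((1 / r) *\<^sub>R x + 0)"
    have "test_function {x. (1 / r) *\<^sub>R x + 0 \<in> ball 0 R} ?\<phi>"
      by (rule test_function_affine[OF \<phi>]) (use r in simp)
    moreover have "{x. (1 / r) *\<^sub>R x + 0 \<in> ball (0::'a) R} = ball 0 (R * r)" using r by (auto simp: field_simps)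
    ultimately have t: "test_function (ball 0 (R * r)) ?\<phi>" by simp
    note s = test_function_smooth[OF \<phi>]
    have d: "partial_deriv [i] ?\<phi> x = (1 / r) * partial_deriv [i] \<phi> ((1 / r) *\<^sub>R x)" for x
      using partial_deriv_affine[OF s, of i 1 "1 / r" 0 x] by simp
    have \<phi>': "test_function (ball 0 R) (partial_deriv [i] \<phi>)"
      using i by (intro test_function_partial_deriv \<phi>) simp
    note s' = test_function_smooth[OF \<phi>']
    have eq: "(\<integral>x. (1 / r) * partial_deriv [i] \<phi> ((1 / r) *\<^sub>R x) * u x \<partial>lebesgue) = - (\<integral>x. \<phi> ((1 / r) *\<^sub>R x) * w x \<partial>lebesgue)"
      using has_weak_derivD[OF uw t open_ball] i unfolding d by simp
    have sc: "(\<integral>x. f (r *\<^sub>R x) \<partial>lebesgue) = (\<integral>x. f x \<partial>lebesgue) / r ^ DIM('a)"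
      if "f \<in> borel_measurable borel" for f :: "'a \<Rightarrow> real"
      using lebesgue_integral_affine[of r f 0] that r by simp
    have sm: "(\<lambda>x. \<theta> ((1 / r) *\<^sub>R x)) \<in> borel_measurable borel" if "smooth \<theta>" for \<theta> :: "'a \<Rightarrow> real"
      by (rule measurable_compose[OF _ smooth_borel[OF that]]) simp
    have eqA: "(\<integral>x. (1 / r) * partial_deriv [i] \<phi> ((1 / r) *\<^sub>R x) * u x \<partial>lebesgue)
        = (\<integral>x. (1 / r) * partial_deriv [i] \<phi> ((1 / r) *\<^sub>R x) * (indicator (ball 0 (R * r)) x *\<^sub>R u x) \<partial>lebesgue)"
    proof (intro Bochner_Integration.integral_cong refl)
      fix x :: 'a
      show "(1 / r) * partial_deriv [i] \<phi> ((1 / r) *\<^sub>R x) * u x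
        = (1 / r) * partial_deriv [i] \<phi> ((1 / r) *\<^sub>R x) * (indicator (ball 0 (R * r)) x *\<^sub>R u x)"
      proof (cases "x \<in> ball 0 (R * r)")
        case False
        then have "(1 / r) *\<^sub>R x \<notin> ball 0 R" using in_ball[of "(1 / r) *\<^sub>R x"] r by simp
        from test_function_outside[OF \<phi>' this] show ?thesis by simp
      qed simp
    qed
    have ub: "(\<lambda>x. indicator (ball 0 (R * r)) x *\<^sub>R u x) \<in> borel_measurable borel"
      by (rule borel_measurable_continuous_on_indicator[OF _ u]) simp
    have "(\<lambda>x. (1 / r) * partial_deriv [i] \<phi> ((1 / r) *\<^sub>R x) * (indicator (ball 0 (R * r)) x *\<^sub>R u x)) \<in> borel_measurable borel"
      by (intro borel_measurable_times borel_measurable_const sm[OF s'] ub)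
    note sA = sc[OF this]
    have "(\<lambda>x. \<phi> ((1 / r) *\<^sub>R x) * w x) \<in> borel_measurable borel"
      by (intro borel_measurable_times sm[OF s] w)
    note sB = sc[OF this]
    have red: "(1 / r) *\<^sub>R r *\<^sub>R y = y" for y :: 'a using r by simp
    have "(\<integral>y. (1 / r) * partial_deriv [i] \<phi> y * (indicator (ball 0 (R * r)) (r *\<^sub>R y) *\<^sub>R u (r *\<^sub>R y)) \<partial>lebesgue)
        = - (\<integral>y. \<phi> y * w (r *\<^sub>R y) \<partial>lebesgue)"
      unfolding sA[unfolded red] sB[unfolded red] eqA[symmetric] eq by simp
    moreover have "(1 / r) * partial_deriv [i] \<phi> y * (indicator (ball 0 (R * r)) (r *\<^sub>R y) *\<^sub>R u (r *\<^sub>R y))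
        = (1 / r) * (partial_deriv [i] \<phi> y * u (r *\<^sub>R y))" for y
      using in_ball[of y] test_function_outside[OF \<phi>', of y] by (cases "y \<in> ball 0 R") (simp_all del: mem_ball)
    ultimately have "(1 / r) * (\<integral>y. partial_deriv [i] \<phi> y * u (r *\<^sub>R y) \<partial>lebesgue) = - (\<integral>y. \<phi> y * w (r *\<^sub>R y) \<partial>lebesgue)"
      by (simp only: integral_mult_right_zero)
    then have *: "(\<integral>y. partial_deriv [i] \<phi> y * u (r *\<^sub>R y) \<partial>lebesgue) = - (r * (\<integral>y. \<phi> y * w (r *\<^sub>R y) \<partial>lebesgue))"
      using r by (simp add: field_simps)
    have b: "ball 0 R \<in> sets (lebesgue :: 'a measure)" by simp
    have "(\<integral>y. partial_deriv [i] \<phi> y *\<^sub>R (k * u (r *\<^sub>R y)) \<partial>lebesgue) = k * (\<integral>y. partial_deriv [i] \<phi> y * u (r *\<^sub>R y) \<partial>lebesgue)"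
      by (subst integral_mult_right_zero[symmetric]) (simp add: mult.left_commute)
    moreover have "(\<integral>y. \<phi> y *\<^sub>R (k * r * w (r *\<^sub>R y)) \<partial>lebesgue) = k * r * (\<integral>y. \<phi> y * w (r *\<^sub>R y) \<partial>lebesgue)"
      by (subst integral_mult_right_zero[symmetric]) (simp add: mult.left_commute)
    ultimately show ?thesis
      unfolding test_function_integral_lebesgue_on[OF \<phi>' b] test_function_integral_lebesgue_on[OF \<phi> b] using * by simp
  qed
  then show ?thesis unfolding has_weak_deriv_def using l1 l2 by blast
qed

section \<open>The gradient of a cut-off function\<close>

lemma test_function_uniform_bounds:
  fixes f :: "'a::euclidean_space \<Rightarrow> real"
  assumes f: "test_function \<Omega> f"
  obtains M where "M \<ge> 1" "\<And>x. \<bar>f x\<bar> \<le> M" "\<And>x y. \<bar>f x - f y\<bar> \<le> M * norm (x - y)"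
    "\<And>i x. i \<in> Basis \<Longrightarrow> \<bar>partial_deriv [i] f x\<bar> \<le> M"
    "\<And>i x y. i \<in> Basis \<Longrightarrow> \<bar>partial_deriv [i] f x - partial_deriv [i] f y\<bar> \<le> M * norm (x - y)"
proof -
  have one: "\<exists>M\<ge>0. \<forall>x y. \<bar>g x\<bar> \<le> M \<and> \<bar>g x - g y\<bar> \<le> M * norm (x - y)" if g: "test_function \<Omega> g" for g
  proof -
    obtain M where M: "M > 0" "\<And>x. \<bar>g x\<bar> \<le> M" by (rule test_function_bounded[OF g]) (rule that)
    obtain L where L: "L > 0" "\<And>x y. \<bar>g x - g y\<bar> \<le> L * norm (x - y)"
      by (rule test_function_lipschitz[OF g]) (rule that)
    show ?thesis
    proof (intro exI[of _ "M + L"] conjI allI)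
      show "M + L \<ge> 0" using M L by simp
      fix x y
      show "\<bar>g x\<bar> \<le> M + L" using M(2)[of x] L(1) by linarith
      show "\<bar>g x - g y\<bar> \<le> (M + L) * norm (x - y)"
        by (rule order_trans[OF L(2)]) (use M(1) in \<open>auto intro: mult_right_mono\<close>)
    qed
  qed
  have "\<forall>i\<in>Basis. \<exists>M\<ge>0. \<forall>x y. \<bar>partial_deriv [i] f x\<bar> \<le> M \<and>
      \<bar>partial_deriv [i] f x - partial_deriv [i] f y\<bar> \<le> M * norm (x - y)"
  proof
    fix i :: 'a assume "i \<in> Basis"
    then have "set [i] \<subseteq> Basis" by simp
    then show "\<exists>M\<ge>0. \<forall>x y. \<bar>partial_deriv [i] f x\<bar> \<le> M \<and>
        \<bar>partial_deriv [i] f x - partial_deriv [i] f y\<bar> \<le> M * norm (x - y)"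
      by (rule one[OF test_function_partial_deriv[OF f]])
  qed
  then obtain M where M: "\<And>i. i \<in> Basis \<Longrightarrow> M i \<ge> 0"
    "\<And>i x. i \<in> Basis \<Longrightarrow> \<bar>partial_deriv [i] f x\<bar> \<le> M i"
    "\<And>i x y. i \<in> Basis \<Longrightarrow> \<bar>partial_deriv [i] f x - partial_deriv [i] f y\<bar> \<le> M i * norm (x - y)"
    by metis
  obtain M0 where M0: "M0 \<ge> 0" "\<And>x. \<bar>f x\<bar> \<le> M0" "\<And>x y. \<bar>f x - f y\<bar> \<le> M0 * norm (x - y)"
    using one[OF f] by blast
  define N where "N = 1 + M0 + (\<Sum>i\<in>Basis. M i)"
  have s: "(\<Sum>i\<in>Basis. M i) \<ge> 0" using M(1) by (intro sum_nonneg)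
  have Ni: "M i \<le> N" if "i \<in> Basis" for i
    using member_le_sum[of i Basis M] M(1) that M0(1) by (simp add: N_def)
  have N0: "M0 \<le> N" using s by (simp add: N_def)
  show ?thesis
  proof (rule that[of N])
    show "N \<ge> 1" using s M0(1) by (simp add: N_def)
    show "\<bar>f x\<bar> \<le> N" for x by (rule order_trans[OF M0(2) N0])
    show "\<bar>f x - f y\<bar> \<le> N * norm (x - y)" for x y
      by (rule order_trans[OF M0(3) mult_right_mono[OF N0 norm_ge_zero]])
    show "\<bar>partial_deriv [i] f x\<bar> \<le> N" if "i \<in> Basis" for i x
      by (rule order_trans[OF M(2)[OF that] Ni[OF that]])
    show "\<bar>partial_deriv [i] f x - partial_deriv [i] f y\<bar> \<le> N * norm (x - y)" if "i \<in> Basis" for i x y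
      by (rule order_trans[OF M(3)[OF that] mult_right_mono[OF Ni[OF that] norm_ge_zero]])
  qed
qed

lemma compact_subset_smaller_ball:
  fixes K :: "'a::real_normed_vector set"
  assumes "compact K" "K \<subseteq> ball 0 R" "R > 0"
  obtains \<delta> where "0 < \<delta>" "\<delta> < R" "K \<subseteq> ball 0 (R - \<delta>)"
proof (cases "K = {}")
  case True
  then show ?thesis using that[of "R / 2"] assms(3) by simp
next
  case False
  have "continuous_on K norm" by (intro continuous_intros)
  from continuous_attains_sup[OF assms(1) False this]
  obtain x where x: "x \<in> K" "\<And>y. y \<in> K \<Longrightarrow> norm y \<le> norm x" by blast
  have "norm x < R" using x(1) assms(2) by auto
  show ?thesis
  proof (rule that[of "(R - norm x) / 2"])
    show "0 < (R - norm x) / 2" using \<open>norm x < R\<close> by simp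
    have "(R - norm x) / 2 \<le> R / 2" by (intro divide_right_mono) auto
    also have "R / 2 < R" using assms(3) by simp
    finally show "(R - norm x) / 2 < R" .
    show "K \<subseteq> ball 0 (R - (R - norm x) / 2)"
    proof
      fix y assume "y \<in> K"
      then have "norm y \<le> norm x" by (rule x(2))
      then show "y \<in> ball 0 (R - (R - norm x) / 2)" using \<open>norm x < R\<close> by (simp add: field_simps)
    qed
  qed
qed

lemma integrable_imp_loc_integrable:
  fixes f :: "'a::euclidean_space \<Rightarrow> 'b::euclidean_space"
  assumes "integrable lebesgue f"
  shows "loc_integrable_on f \<Omega>"
  unfolding loc_integrable_on_def
proof (intro allI impI)
  fix K assume "compact K \<and> K \<subseteq> \<Omega>"
  then have K: "K \<in> sets lebesgue" by (auto intro: fmeasurableD[OF lmeasurable_compact])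
  then have "K \<inter> space lebesgue \<in> sets lebesgue" by simp
  from integrable_restrict_space[OF this, of f] show "integrable (lebesgue_on K) f"
    using integrable_mult_indicator[OF K assms] by blast
qed

lemma hoelder_continuous_on:
  fixes f :: "'a::real_normed_vector \<Rightarrow> real"
  assumes "\<And>x y. x \<in> S \<Longrightarrow> y \<in> S \<Longrightarrow> \<bar>f x - f y\<bar> \<le> C * norm (x - y) powr g" "g > 0"
  shows "continuous_on S f"
  unfolding continuous_on_def
proof
  fix x assume x: "x \<in> S"
  have "((\<lambda>y. f y - f x) \<longlongrightarrow> 0) (at x within S)"
  proof (rule Lim_null_comparison)
    show "\<forall>\<^sub>F y in at x within S. norm (f y - f x) \<le> C * norm (y - x) powr g"
      unfolding eventually_at_filter using assms(1) x by (auto intro: always_eventually)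
    have "((\<lambda>y. norm (y - x)) \<longlongrightarrow> 0) (at x within S)"
      by (auto intro!: tendsto_eq_intros)
    then have "((\<lambda>y. norm (y - x) powr g) \<longlongrightarrow> 0 powr g) (at x within S)"
      using assms(2) by (intro tendsto_powr') auto
    from tendsto_mult[OF tendsto_const[of C] this] show "((\<lambda>y. C * norm (y - x) powr g) \<longlongrightarrow> 0) (at x within S)"
      using assms(2) by simp
  qed
  then show "(f \<longlongrightarrow> f x) (at x within S)" by (simp add: LIM_zero_iff)
qed

lemma powr_sum_le:
  fixes f :: "'a \<Rightarrow> real"
  assumes "finite I" "\<And>i. i \<in> I \<Longrightarrow> f i \<ge> 0" "P \<ge> 0"
  shows "(\<Sum>i\<in>I. f i) powr P \<le> real (card I) powr P * (\<Sum>i\<in>I. f i powr P)"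
proof (cases "I = {}")
  case False
  then have "Max (f ` I) \<in> f ` I" using assms(1) by (intro Max_in) auto
  then obtain j where j: "j \<in> I" "f j = Max (f ` I)" by force
  have jm: "f i \<le> f j" if "i \<in> I" for i unfolding j(2) using that assms(1) by simp
  have "(\<Sum>i\<in>I. f i) \<le> real (card I) * f j" using sum_bounded_above[of I f "f j"] jm by simp
  then have "(\<Sum>i\<in>I. f i) powr P \<le> (real (card I) * f j) powr P"
    using assms by (intro powr_mono2 sum_nonneg) auto
  also have "\<dots> = real (card I) powr P * f j powr P" using assms j(1) by (simp add: powr_mult)
  also have "\<dots> \<le> real (card I) powr P * (\<Sum>i\<in>I. f i powr P)"
    using assms(1) j(1) by (intro mult_left_mono member_le_sum) auto
  finally show ?thesis .
qed simp

text \<open>Where both values of the cut-off \<open>a\<close> are nonzero the modulus of continuity of \<open>f\<close> enters. If one of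
  them vanishes, the other is small near it, because \<open>a\<close> is Lipschitz; so \<open>f\<close> needs no regularity
  across the boundary of the support.\<close>

lemma cutoff_product_modulus:
  fixes a f :: "'a::real_normed_vector \<Rightarrow> real"
  assumes a: "\<And>x. \<bar>a x\<bar> \<le> M" "\<And>x y. \<bar>a x - a y\<bar> \<le> M * norm (x - y)" "M \<ge> 0"
    and f: "\<And>x. a x \<noteq> 0 \<Longrightarrow> \<bar>f x\<bar> \<le> Q" "Q \<ge> 0"
  shows "\<bar>a x * f x - a y * f y\<bar>
    \<le> (if a x \<noteq> 0 \<and> a y \<noteq> 0 then M * \<bar>f x - f y\<bar> else 0) + 2 * M * Q * min 1 (norm (x - y))"
proof -
  have ad: "\<bar>a x - a y\<bar> \<le> 2 * M * min 1 (norm (x - y))"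
  proof (cases "norm (x - y) \<le> 1")
    case True
    have "\<bar>a x - a y\<bar> \<le> M * norm (x - y)" by (rule a(2))
    also have "\<dots> \<le> 2 * M * norm (x - y)" using a(3) by (intro mult_right_mono) auto
    finally show ?thesis using True by simp
  next
    case False
    then show ?thesis using a(1)[of x] a(1)[of y] by simp
  qed
  have m0: "2 * M * min 1 (norm (x - y)) \<ge> 0" using a(3) by simp
  have bound: "\<bar>a x - a y\<bar> * \<bar>f z\<bar> \<le> 2 * M * Q * min 1 (norm (x - y))" if "a z \<noteq> 0" for z
    using mult_mono[OF ad f(1)[OF that] m0 abs_ge_zero] by (simp add: mult_ac)
  consider "a x \<noteq> 0" "a y \<noteq> 0" | "a x \<noteq> 0" "a y = 0" | "a x = 0" "a y \<noteq> 0" | "a x = 0" "a y = 0" by blast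
  then show ?thesis
  proof cases
    case 1
    have "a x * f x - a y * f y = a x * (f x - f y) + (a x - a y) * f y" by (simp add: algebra_simps)
    then have "\<bar>a x * f x - a y * f y\<bar> \<le> \<bar>a x\<bar> * \<bar>f x - f y\<bar> + \<bar>a x - a y\<bar> * \<bar>f y\<bar>"
      by (metis abs_mult abs_triangle_ineq)
    also have "\<dots> \<le> M * \<bar>f x - f y\<bar> + 2 * M * Q * min 1 (norm (x - y))"
      by (intro add_mono bound 1 mult_right_mono a) auto
    finally show ?thesis using 1 by simp
  next
    case 2
    then show ?thesis using bound[OF 2(1)] by (simp add: abs_mult)
  next
    case 3
    then show ?thesis using bound[OF 3(2)] by (simp add: abs_mult)
  next
    case 4
    then show ?thesis using a(3) f(2) by simp
  qed
qed

text \<open>The gradient of \<open>\<eta> u\<close> is \<open>u \<nabla>\<eta> + \<eta> \<nabla>u\<close>. The first summand is Lipschitz. The differences of the second are bounded by those of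
\<open>\<nabla>u\<close> on the support of \<open>\<eta>\<close>, which constitute \<open>H\<close>, up to a Lipschitz term. Dividing by \<open>h0\<close>
normalises the energy of \<open>H\<close>: on the set where \<open>\<eta>\<close> does not vanish the classical gradient of \<open>u\<close> agrees almost
everywhere with the weak one, whose energy is at most \<open>1\<close>.\<close>

lemma localized_gradient:
  fixes \<rho> \<eta> :: "'a::euclidean_space \<Rightarrow> real"
  defines "d \<equiv> real DIM('a)"
  assumes \<rho>: "mollifier \<rho>" and \<eta>: "test_function (ball 0 2) \<eta>"
    and P: "P \<ge> 1" and s: "s > 0" and g: "s - d / P > 0"
  shows "\<exists>h0\<ge>0. \<exists>c\<ge>0. \<exists>c0\<ge>0. \<exists>c1\<ge>0. \<forall>(u :: 'a \<Rightarrow> real) G.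
     continuous_on (ball 0 2) u \<and> u 0 = 0 \<and> (u has_derivative (\<lambda>h. 0)) (at 0) \<and>
     (\<forall>i\<in>Basis. has_weak_deriv (ball 0 2) [i] u (G i) \<and> G i \<in> borel_measurable borel \<and>
        local_energy P (d + s * P) (ball 0 2) (G i) \<le> 1) \<longrightarrow>
     (\<exists>(F :: 'a \<Rightarrow> 'a) H. (\<forall>i\<in>Basis. has_weak_deriv UNIV [i] (\<lambda>x. \<eta> x * u x) (\<lambda>x. h0 * (F x \<bullet> i))) \<and>
        F \<in> borel_measurable borel \<and> (\<forall>x. norm (F x) \<le> c0) \<and>
        (\<lambda>(x, y). H x y) \<in> borel_measurable (lborel \<Otimes>\<^sub>M lborel) \<and> (\<forall>x y. H x y \<ge> 0) \<and>
        (\<forall>x y. H x y \<le> c * norm (x - y) powr (s - d / P)) \<and> (\<forall>x y. H x y \<noteq> 0 \<longrightarrow> norm (x - y) \<le> 4) \<and>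
        (\<forall>x y. norm (F x - F y) \<le> H x y + c1 * min 1 (norm (x - y))) \<and>
        (\<integral>\<^sup>+y. (\<integral>\<^sup>+x. ennreal (H x y powr P / norm (x - y) powr (d + s * P)) \<partial>lborel) \<partial>lborel) \<le> 1)"
proof -
  obtain K where K: "compact K" "K \<subseteq> ball 0 2" "\<And>x. x \<notin> K \<Longrightarrow> \<eta> x = 0"
    "\<And>x \<alpha>. x \<notin> K \<Longrightarrow> set \<alpha> \<subseteq> Basis \<Longrightarrow> partial_deriv \<alpha> \<eta> x = 0"
    by (rule test_function_support[OF \<eta>]) (rule that)
  obtain \<delta> where \<delta>: "0 < \<delta>" "\<delta> < 2" "K \<subseteq> ball 0 (2 - \<delta>)"
    by (rule compact_subset_smaller_ball[OF K(1,2)]) (simp, rule that)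
  obtain M where M: "M \<ge> 1" "\<And>x. \<bar>\<eta> x\<bar> \<le> M" "\<And>x y. \<bar>\<eta> x - \<eta> y\<bar> \<le> M * norm (x - y)"
    "\<And>i x. i \<in> Basis \<Longrightarrow> \<bar>partial_deriv [i] \<eta> x\<bar> \<le> M"
    "\<And>i x y. i \<in> Basis \<Longrightarrow> \<bar>partial_deriv [i] \<eta> x - partial_deriv [i] \<eta> y\<bar> \<le> M * norm (x - y)"
    by (rule test_function_uniform_bounds[OF \<eta>]) (rule that)
  let ?g = "s - d / P" and ?B = "ball (0::'a) (2 - \<delta>)"
  obtain C where C: "C \<ge> 0" and C1: "\<And>(u :: 'a \<Rightarrow> real) G. continuous_on (ball 0 2) u \<Longrightarrow>
     (\<forall>i\<in>Basis. has_weak_deriv (ball 0 2) [i] u (G i) \<and> G i \<in> borel_measurable borel \<and>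
        local_energy P (d + s * P) (ball 0 2) (G i) \<le> 1) \<Longrightarrow>
     (\<exists>D. (\<forall>x\<in>?B. (u has_derivative (\<lambda>h. \<Sum>i\<in>Basis. (h \<bullet> i) * D i x)) (at x)) \<and>
       (\<forall>i\<in>Basis. \<forall>x\<in>?B. \<forall>y\<in>?B. \<bar>D i x - D i y\<bar> \<le> C * norm (x - y) powr ?g))"
    using fractional_weak_gradient_C1[OF \<rho> P s g[unfolded d_def] \<delta>(1,2)] unfolding d_def by blast
  have d1: "d \<ge> 1" unfolding d_def using DIM_positive[where 'a = 'a] by simp
  define CD where "CD = C * 2 powr ?g"
  have CD: "CD \<ge> 0" using C by (simp add: CD_def)
  define Q where "Q = 2 * (d * CD)"
  have Q: "Q \<ge> 0" "CD \<le> Q" "d * CD \<le> Q"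
    using CD d1 mult_right_mono[of 1 d CD] by (auto simp: Q_def)
  \<comment> \<open>The factor \<open>M\<close> is the bound on \<open>\<eta>\<close>. One factor \<open>d\<close> bounds the \<open>P\<close>-th power of a sum over the coordinates
    by the sum of the \<open>P\<close>-th powers, the other one the number of these summands.\<close>
  define h0 where "h0 = M * d\<^sup>2"
  have d2: "d\<^sup>2 \<ge> 1" using d1 by simp
  have h0: "h0 \<ge> 1" unfolding h0_def using mult_mono[of 1 M 1 "d\<^sup>2"] M(1) d2 by simp
  define c1 where "c1 = 4 * d * M * Q"
  have c1: "c1 \<ge> 0" using d1 M(1) Q(1) by (simp add: c1_def)
  define c0 where "c0 = 2 * d * M * Q"
  have c0: "c0 \<ge> 0" using d1 M(1) Q(1) by (simp add: c0_def)
  show ?thesis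
  proof (rule exI[of _ h0], rule conjI, use h0 in simp, rule exI[of _ C], rule conjI, rule C,
      rule exI[of _ c0], rule conjI, rule c0, rule exI[of _ c1], rule conjI, rule c1, intro allI impI, elim conjE)
    fix u :: "'a \<Rightarrow> real" and G :: "'a \<Rightarrow> 'a \<Rightarrow> real"
    assume u: "continuous_on (ball 0 2) u" and u0: "u 0 = 0" and u0': "(u has_derivative (\<lambda>h. 0)) (at 0)"
      and G: "\<forall>i\<in>Basis. has_weak_deriv (ball 0 2) [i] u (G i) \<and> G i \<in> borel_measurable borel \<and>
        local_energy P (d + s * P) (ball 0 2) (G i) \<le> 1"
    obtain D0 where D0: "\<And>x. x \<in> ?B \<Longrightarrow> (u has_derivative (\<lambda>h. \<Sum>i\<in>Basis. (h \<bullet> i) * D0 i x)) (at x)"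
      "\<And>i x y. i \<in> Basis \<Longrightarrow> x \<in> ?B \<Longrightarrow> y \<in> ?B \<Longrightarrow> \<bar>D0 i x - D0 i y\<bar> \<le> C * norm (x - y) powr ?g"
      using C1[OF u G] by blast
    \<comment> \<open>Extended by zero to a Borel function; the cut-off hides the values off the ball.\<close>
    define D where "D i x = indicator ?B x *\<^sub>R D0 i x" for i x
    have D: "\<And>x. x \<in> ?B \<Longrightarrow> (u has_derivative (\<lambda>h. \<Sum>i\<in>Basis. (h \<bullet> i) * D i x)) (at x)"
      "\<And>i x y. i \<in> Basis \<Longrightarrow> x \<in> ?B \<Longrightarrow> y \<in> ?B \<Longrightarrow> \<bar>D i x - D i y\<bar> \<le> C * norm (x - y) powr ?g"
      using D0 by (simp_all add: D_def del: mem_ball)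
    have DcB: "continuous_on ?B (D i)" if "i \<in> Basis" for i
      by (rule hoelder_continuous_on[OF D(2)[OF that] g])
    have Dm: "D i \<in> borel_measurable borel" if "i \<in> Basis" for i
    proof -
      have "continuous_on ?B (D0 i)" by (rule hoelder_continuous_on[OF D0(2)[OF that] g])
      then show ?thesis unfolding D_def[abs_def] by (intro borel_measurable_continuous_on_indicator) auto
    qed
    have B0: "0 \<in> ?B" using \<delta> by simp
    have D00: "D i 0 = 0" if i: "i \<in> Basis" for i
    proof -
      have "(\<lambda>h. \<Sum>j\<in>Basis. (h \<bullet> j) * D j 0) = (\<lambda>h. 0)" by (rule has_derivative_unique[OF D(1)[OF B0] u0'])
      then have "(\<Sum>j\<in>Basis. (i \<bullet> j) * D j 0) = 0" by (rule fun_cong)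
      moreover have "(\<Sum>j\<in>Basis. (i \<bullet> j) * D j 0) = (\<Sum>j\<in>Basis. if j = i then D j 0 else 0)"
        using i by (intro sum.cong) (auto simp: inner_Basis)
      ultimately show ?thesis using i by simp
    qed
    have Db: "\<bar>D i x\<bar> \<le> CD" if i: "i \<in> Basis" and x: "x \<in> ?B" for i x
    proof -
      have "\<bar>D i x - D i 0\<bar> \<le> C * norm (x - 0) powr ?g" by (rule D(2)[OF i x B0])
      also have "\<dots> \<le> CD"
        unfolding CD_def using x \<delta> g C by (intro mult_left_mono powr_mono2) auto
      finally show ?thesis using D00[OF i] by simp
    qed
    have uLip: "\<bar>u x - u y\<bar> \<le> d * CD * norm (x - y)" if "x \<in> ?B" "y \<in> ?B" for x y
    proof -
      have "norm (u x - u y) \<le> (d * CD) * norm (x - y)"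
      proof (rule differentiable_bound[OF convex_ball _ _ that])
        fix z assume z: "z \<in> ?B"
        show "(u has_derivative (\<lambda>h. \<Sum>i\<in>Basis. (h \<bullet> i) * D i z)) (at z within ?B)"
          by (rule has_derivative_at_withinI[OF D(1)[OF z]])
        show "onorm (\<lambda>h. \<Sum>i\<in>Basis. (h \<bullet> i) * D i z) \<le> d * CD"
        proof (rule onorm_le)
          fix h :: 'a
          have "norm (\<Sum>i\<in>Basis. (h \<bullet> i) * D i z) \<le> (\<Sum>i\<in>(Basis::'a set). norm h * CD)"
          proof (rule order_trans[OF norm_sum], rule sum_mono)
            fix i :: 'a assume i: "i \<in> Basis"
            show "norm ((h \<bullet> i) * D i z) \<le> norm h * CD"
              unfolding real_norm_def abs_mult
              by (intro mult_mono Basis_le_norm[OF i] Db[OF i z]) auto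
          qed
          then show "norm (\<Sum>i\<in>Basis. (h \<bullet> i) * D i z) \<le> d * CD * norm h" by (simp add: d_def mult_ac)
        qed
      qed
      then show ?thesis by simp
    qed
    have ub: "\<bar>u x\<bar> \<le> Q" if x: "x \<in> ?B" for x
    proof -
      have "\<bar>u x\<bar> \<le> d * CD * norm x" using uLip[OF x B0] u0 by simp
      also have "\<dots> \<le> d * CD * 2" using x \<delta> CD d1 by (intro mult_left_mono) auto
      finally show ?thesis by (simp add: Q_def mult_ac)
    qed
    have KB: "x \<in> ?B" if "x \<in> K" for x using that \<delta>(3) by blast
    have \<eta>B: "x \<in> ?B" if "\<eta> x \<noteq> 0" for x using that K(3)[of x] KB by blast
    have \<eta>'B: "x \<in> ?B" if "partial_deriv [i] \<eta> x \<noteq> 0" "i \<in> Basis" for x i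
      using that K(4)[of x "[i]"] KB by auto
    define N where "N i x = partial_deriv [i] \<eta> x * u x" for i x
    define Z where "Z i x = \<eta> x * D i x" for i x
    have \<eta>s: "smooth \<eta>" by (rule test_function_smooth[OF \<eta>])
    have \<eta>i: "test_function (ball 0 2) (partial_deriv [i] \<eta>)" if "i \<in> Basis" for i
      using that by (intro test_function_partial_deriv \<eta>) simp
    have cover: "?B \<union> - K = UNIV" using KB by blast
    have oK: "open (- K)" using K(1) by (simp add: compact_imp_closed open_Compl)
    have ucB: "continuous_on ?B u" by (rule continuous_on_subset[OF u]) (use \<delta> in auto)
    have glue: "continuous_on UNIV f" if "continuous_on ?B f" "\<And>x. x \<notin> K \<Longrightarrow> f x = 0" for f :: "'a \<Rightarrow> real"
    proof -
      have "continuous_on (- K) f"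
        using that(2) by (intro continuous_on_eq[OF continuous_on_const[of "- K" 0]]) auto
      then have "continuous_on (?B \<union> - K) f"
        by (intro continuous_on_open_Un open_ball oK that(1))
      then show ?thesis by (simp only: cover)
    qed
    have Nc: "continuous_on UNIV (N i)" if "i \<in> Basis" for i
      unfolding N_def[abs_def] using K(4)[of _ "[i]"] that
      by (intro glue continuous_on_mult smooth_continuous_on test_function_smooth[OF \<eta>i] ucB) auto
    have Zc: "continuous_on UNIV (Z i)" if "i \<in> Basis" for i
      unfolding Z_def[abs_def] using K(3)
      by (intro glue continuous_on_mult smooth_continuous_on[OF \<eta>s] DcB that) auto
    have Uc: "continuous_on UNIV (\<lambda>x. \<eta> x * u x)"
      using K(3) by (intro glue continuous_on_mult smooth_continuous_on[OF \<eta>s] ucB) auto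
    have Ud: "((\<lambda>x. \<eta> x * u x) has_derivative (\<lambda>h. \<Sum>i\<in>Basis. (h \<bullet> i) * (N i x + Z i x))) (at x)" for x
    proof (cases "x \<in> ?B")
      case True
      show ?thesis
        by (rule has_derivative_eq_rhs[OF has_derivative_mult[OF smooth_has_derivative[OF \<eta>s] D(1)[OF True]]])
           (simp add: fun_eq_iff N_def Z_def sum_distrib_left sum_distrib_right sum.distrib[symmetric] algebra_simps)
    next
      case False
      then have x: "x \<in> - K" using KB by blast
      have "N i x + Z i x = 0" if "i \<in> Basis" for i
        using x K(3)[of x] K(4)[of x "[i]"] that by (simp add: N_def Z_def)
      then have z: "(\<lambda>h. \<Sum>i\<in>Basis. (h \<bullet> i) * (N i x + Z i x)) = (\<lambda>h. 0)" by simp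
      show ?thesis unfolding z
        by (rule has_derivative_transform_within_open[OF has_derivative_const oK x]) (simp add: K(3))
    qed
    have wd: "has_weak_deriv UNIV [i] (\<lambda>x. \<eta> x * u x) (\<lambda>x. N i x + Z i x)" if i: "i \<in> Basis" for i
    proof -
      have e: "(\<lambda>x. \<Sum>j\<in>Basis. (i \<bullet> j) * (N j x + Z j x)) = (\<lambda>x. N i x + Z i x)"
      proof
        fix x
        have "(\<Sum>j\<in>Basis. (i \<bullet> j) * (N j x + Z j x)) = (\<Sum>j\<in>Basis. if j = i then N j x + Z j x else 0)"
          using i by (intro sum.cong) (auto simp: inner_Basis)
        then show "(\<Sum>j\<in>Basis. (i \<bullet> j) * (N j x + Z j x)) = N i x + Z i x" using i by simp
      qed
      have "has_weak_deriv UNIV [i] (\<lambda>x. \<eta> x * u x) (\<lambda>x. \<Sum>j\<in>Basis. (i \<bullet> j) * (N j x + Z j x))"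
        by (rule C1_has_weak_deriv[OF Ud _ i], unfold e) (intro continuous_on_add Nc Zc i)
      then show ?thesis by (simp only: e)
    qed
    \<comment> \<open>Test functions multiplied by the cut-off are test functions on the ball, so the weak and the
      classical gradient of \<open>u\<close> are the same functional after multiplication with \<open>\<eta>\<close>.\<close>
    have DG: "AE x in lebesgue. \<eta> x \<noteq> 0 \<longrightarrow> D i x = G i x" if i: "i \<in> Basis" for i
    proof -
      have wG: "has_weak_deriv (ball 0 2) [i] u (G i)" using G i by blast
      have lG: "loc_integrable_on (G i) (ball 0 2)" using wG by (simp add: has_weak_deriv_def)
      have "AE x in lebesgue. \<eta> x * G i x - Z i x = 0"
      proof (rule fundamental_lemma[OF \<rho>])
        have "integrable lebesgue (\<lambda>x. \<eta> x * G i x)"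
          using test_function_times_integrable[OF \<eta> lG] by simp
        then have "loc_integrable_on (\<lambda>x. \<eta> x * G i x) UNIV"
          by (rule integrable_imp_loc_integrable)
        then show "loc_integrable_on (\<lambda>x. \<eta> x * G i x - Z i x) UNIV"
          using continuous_loc_integrable[OF Zc[OF i]] unfolding loc_integrable_on_def by auto
        fix \<phi> :: "'a \<Rightarrow> real" assume \<phi>: "test_function UNIV \<phi>"
        note \<phi>s = test_function_smooth[OF \<phi>]
        have \<phi>i: "test_function UNIV (partial_deriv [i] \<phi>)"
          using i by (intro test_function_partial_deriv \<phi>) simp
        have p: "test_function (ball 0 2) (\<lambda>x. \<phi> x * \<eta> x)" by (rule test_function_mult[OF \<phi>s \<eta>])
        have pd: "partial_deriv [i] (\<lambda>x. \<phi> x * \<eta> x) x = \<phi> x * partial_deriv [i] \<eta> x + partial_deriv [i] \<phi> x * \<eta> x" for x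
        proof -
          have "(\<phi> has_derivative frechet_derivative \<phi> (at x)) (at x)" "(\<eta> has_derivative frechet_derivative \<eta> (at x)) (at x)"
            using smooth_differentiable[OF \<phi>s] smooth_differentiable[OF \<eta>s] frechet_derivative_works by blast+
          from partial_deriv_eqI[OF has_derivative_mult[OF this], of i] show ?thesis
            by (simp add: partial_deriv_single)
        qed
        have i1: "integrable lebesgue (\<lambda>x. \<phi> x * N i x)"
          using test_function_times_integrable[OF \<phi> continuous_loc_integrable[OF Nc[OF i]]] by simp
        have i2: "integrable lebesgue (\<lambda>x. partial_deriv [i] \<phi> x * (\<eta> x * u x))"
          using test_function_times_integrable[OF \<phi>i continuous_loc_integrable[OF Uc]] by simp
        have i3: "integrable lebesgue (\<lambda>x. \<phi> x * Z i x)"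
          using test_function_times_integrable[OF \<phi> continuous_loc_integrable[OF Zc[OF i]]] by simp
        have i4: "integrable lebesgue (\<lambda>x. \<phi> x * (\<eta> x * G i x))"
          using test_function_times_integrable[OF p lG] by (simp add: mult.assoc)
        have "(\<integral>x. \<phi> x * N i x + partial_deriv [i] \<phi> x * (\<eta> x * u x) \<partial>lebesgue) = - (\<integral>x. \<phi> x * (\<eta> x * G i x) \<partial>lebesgue)"
          using has_weak_derivD[OF wG p open_ball] i unfolding pd N_def by (simp add: algebra_simps)
        then have e1: "(\<integral>x. \<phi> x * N i x \<partial>lebesgue) + (\<integral>x. partial_deriv [i] \<phi> x * (\<eta> x * u x) \<partial>lebesgue)
            = - (\<integral>x. \<phi> x * (\<eta> x * G i x) \<partial>lebesgue)"
          by (simp only: Bochner_Integration.integral_add[OF i1 i2])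
        have "(\<integral>x. partial_deriv [i] \<phi> x * (\<eta> x * u x) \<partial>lebesgue) = - (\<integral>x. \<phi> x * N i x + \<phi> x * Z i x \<partial>lebesgue)"
          using has_weak_derivD[OF wd[OF i] \<phi> open_UNIV] i by (simp add: distrib_left)
        then have e2: "(\<integral>x. partial_deriv [i] \<phi> x * (\<eta> x * u x) \<partial>lebesgue)
            = - ((\<integral>x. \<phi> x * N i x \<partial>lebesgue) + (\<integral>x. \<phi> x * Z i x \<partial>lebesgue))"
          by (simp only: Bochner_Integration.integral_add[OF i1 i3])
        have "(\<integral>x. \<phi> x * (\<eta> x * G i x) - \<phi> x * Z i x \<partial>lebesgue) = 0"
          unfolding Bochner_Integration.integral_diff[OF i4 i3] using e1 e2 by linarith
        then show "(\<integral>x. \<phi> x *\<^sub>R (\<eta> x * G i x - Z i x) \<partial>lebesgue) = 0"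
          by (simp add: right_diff_distrib)
      qed
      then show ?thesis by eventually_elim (auto simp: Z_def)
    qed
    define F where "F x = (\<Sum>i\<in>Basis. ((N i x + Z i x) / h0) *\<^sub>R i)" for x
    define H where "H x y = (if \<eta> x \<noteq> 0 \<and> \<eta> y \<noteq> 0 then (\<Sum>i\<in>Basis. \<bar>D i x - D i y\<bar>) / d\<^sup>2 else 0)" for x y
    have Fi: "F x \<bullet> i = (N i x + Z i x) / h0" if "i \<in> Basis" for x i
      unfolding F_def using that by (simp add: inner_sum_left inner_Basis if_distrib[of "\<lambda>t. _ * t"] cong: if_cong)
    have Fnorm: "norm (F x) \<le> (\<Sum>i\<in>Basis. \<bar>N i x + Z i x\<bar>) / h0" for x
    proof -
      have "norm (F x) \<le> (\<Sum>i\<in>Basis. \<bar>F x \<bullet> i\<bar>)" by (rule norm_le_l1)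
      also have "\<dots> = (\<Sum>i\<in>Basis. \<bar>N i x + Z i x\<bar>) / h0"
        using h0 by (simp add: Fi sum_divide_distrib)
      finally show ?thesis .
    qed
    have divh: "t / h0 \<le> t" if "t \<ge> 0" for t using that h0 by (simp add: divide_le_eq mult_left_mono[of 1 h0 t, simplified])
    have zero_bd: "\<bar>N i x\<bar> \<le> M * Q" "\<bar>Z i x\<bar> \<le> M * Q" if i: "i \<in> Basis" for i x
    proof -
      show "\<bar>N i x\<bar> \<le> M * Q"
      proof (cases "partial_deriv [i] \<eta> x = 0")
        case False
        show ?thesis unfolding N_def abs_mult
          using M(1) by (intro mult_mono M(4)[OF i] ub[OF \<eta>'B[OF False i]]) auto
      qed (use M(1) Q(1) in \<open>simp add: N_def\<close>)
      show "\<bar>Z i x\<bar> \<le> M * Q"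
      proof (cases "\<eta> x = 0")
        case False
        show ?thesis unfolding Z_def abs_mult
          using M(1) by (intro mult_mono M(2) order_trans[OF Db[OF i \<eta>B[OF False]] Q(2)]) auto
      qed (use M(1) Q(1) in \<open>simp add: Z_def\<close>)
    qed
    have F0: "norm (F x) \<le> c0" for x
    proof -
      have "(\<Sum>i\<in>Basis. \<bar>N i x + Z i x\<bar>) \<le> (\<Sum>i\<in>(Basis::'a set). 2 * (M * Q))"
      proof (rule sum_mono)
        fix i :: 'a assume i: "i \<in> Basis"
        show "\<bar>N i x + Z i x\<bar> \<le> 2 * (M * Q)"
          using abs_triangle_ineq[of "N i x" "Z i x"] zero_bd[OF i, of x] by linarith
      qed
      also have "\<dots> = c0" by (simp add: c0_def d_def)
      finally have le: "(\<Sum>i\<in>Basis. \<bar>N i x + Z i x\<bar>) \<le> c0" .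
      have "norm (F x) \<le> (\<Sum>i\<in>Basis. \<bar>N i x + Z i x\<bar>) / h0" by (rule Fnorm)
      also have "\<dots> \<le> (\<Sum>i\<in>Basis. \<bar>N i x + Z i x\<bar>)" by (intro divh sum_nonneg) auto
      finally show ?thesis using le by linarith
    qed
    have Ndiff: "\<bar>N i x - N i y\<bar> \<le> 2 * M * Q * min 1 (norm (x - y))" if i: "i \<in> Basis" for i x y
    proof -
      let ?a = "partial_deriv [i] \<eta>"
      consider "?a x \<noteq> 0 \<and> ?a y \<noteq> 0 \<and> norm (x - y) \<le> 1" | "?a x = 0 \<or> ?a y = 0" | "norm (x - y) > 1" by linarith
      then show ?thesis
      proof cases
        case 1
        then have xy: "x \<in> ?B" "y \<in> ?B" using \<eta>'B i by blast+
        have "N i x - N i y = ?a x * (u x - u y) + (?a x - ?a y) * u y" by (simp add: N_def algebra_simps)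
        then have "\<bar>N i x - N i y\<bar> \<le> \<bar>?a x\<bar> * \<bar>u x - u y\<bar> + \<bar>?a x - ?a y\<bar> * \<bar>u y\<bar>"
          by (metis abs_mult abs_triangle_ineq)
        also have "\<dots> \<le> M * (d * CD * norm (x - y)) + (M * norm (x - y)) * Q"
          using M(1) by (intro add_mono mult_mono M(4,5)[OF i] uLip[OF xy] ub[OF xy(2)]) auto
        also have "\<dots> \<le> M * (Q * norm (x - y)) + (M * norm (x - y)) * Q"
          using M(1) Q(3) by (intro add_mono mult_left_mono mult_right_mono) auto
        finally show ?thesis using 1 by (simp add: mult_ac)
      next
        case 2
        have "\<bar>?a x * u x - ?a y * u y\<bar>
            \<le> (if ?a x \<noteq> 0 \<and> ?a y \<noteq> 0 then M * \<bar>u x - u y\<bar> else 0) + 2 * M * Q * min 1 (norm (x - y))"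
          by (rule cutoff_product_modulus) (use M i ub \<eta>'B Q in auto)
        then show ?thesis using 2 by (auto simp: N_def)
      next
        case 3
        then show ?thesis using zero_bd(1)[OF i, of x] zero_bd(1)[OF i, of y] by simp
      qed
    qed
    have Zdiff: "\<bar>Z i x - Z i y\<bar> \<le> (if \<eta> x \<noteq> 0 \<and> \<eta> y \<noteq> 0 then M * \<bar>D i x - D i y\<bar> else 0) + 2 * M * Q * min 1 (norm (x - y))"
      if i: "i \<in> Basis" for i x y
      unfolding Z_def
    proof (rule cutoff_product_modulus[OF M(2,3)])
      show "\<bar>D i x\<bar> \<le> Q" if "\<eta> x \<noteq> 0" for x by (rule order_trans[OF Db[OF i \<eta>B[OF that]] Q(2)])
    qed (use M(1) Q(1) in auto)
    have F1: "norm (F x - F y) \<le> H x y + c1 * min 1 (norm (x - y))" for x y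
    proof -
      let ?m = "min 1 (norm (x - y))"
      let ?e = "\<lambda>i. if \<eta> x \<noteq> 0 \<and> \<eta> y \<noteq> 0 then M * \<bar>D i x - D i y\<bar> else 0"
      have "norm (F x - F y) \<le> (\<Sum>i\<in>Basis. \<bar>(F x - F y) \<bullet> i\<bar>)" by (rule norm_le_l1)
      also have "\<dots> \<le> (\<Sum>i\<in>Basis. (?e i + 4 * M * Q * ?m) / h0)"
      proof (rule sum_mono)
        fix i :: 'a assume i: "i \<in> Basis"
        have "\<bar>(F x - F y) \<bullet> i\<bar> = \<bar>(N i x - N i y) + (Z i x - Z i y)\<bar> / h0"
          using h0 by (simp add: inner_diff_left Fi[OF i] diff_divide_distrib[symmetric] abs_divide algebra_simps)
        also have "\<dots> \<le> (?e i + 4 * M * Q * ?m) / h0"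
          using Ndiff[OF i, of x y] Zdiff[OF i, of x y] h0
          by (intro divide_right_mono order_trans[OF abs_triangle_ineq]) auto
        finally show "\<bar>(F x - F y) \<bullet> i\<bar> \<le> (?e i + 4 * M * Q * ?m) / h0" .
      qed
      also have "\<dots> = (\<Sum>i\<in>Basis. ?e i) / h0 + (c1 * ?m) / h0"
        by (simp add: sum.distrib sum_divide_distrib[symmetric] add_divide_distrib c1_def d_def)
      also have "(\<Sum>i\<in>Basis. ?e i) / h0 = H x y"
        using M(1) by (simp add: H_def h0_def sum_distrib_left[symmetric])
      also have "(c1 * ?m) / h0 \<le> c1 * ?m" using c1 by (intro divh) simp
      finally show ?thesis by simp
    qed
    have H0: "H x y \<ge> 0" for x y unfolding H_def by (simp add: sum_nonneg)
    have Hm: "(\<lambda>(x, y). H x y) \<in> borel_measurable (lborel \<Otimes>\<^sub>M lborel)"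
    proof -
      have [measurable]: "\<eta> \<in> borel_measurable borel" by (rule smooth_borel[OF \<eta>s])
      have "(\<lambda>z. \<Sum>i\<in>Basis. \<bar>D i (fst z) - D i (snd z)\<bar>) \<in> borel_measurable (lborel \<Otimes>\<^sub>M lborel)"
      proof (rule borel_measurable_sum)
        fix i :: 'a assume "i \<in> Basis"
        then have [measurable]: "D i \<in> borel_measurable borel" by (rule Dm)
        show "(\<lambda>z. \<bar>D i (fst z) - D i (snd z)\<bar>) \<in> borel_measurable (lborel \<Otimes>\<^sub>M lborel)" by measurable
      qed
      note [measurable] = this
      show ?thesis unfolding H_def split_beta' by measurable
    qed
    have Hh: "H x y \<le> C * norm (x - y) powr ?g" for x y
    proof (cases "\<eta> x \<noteq> 0 \<and> \<eta> y \<noteq> 0")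
      case True
      have "(\<Sum>i\<in>Basis. \<bar>D i x - D i y\<bar>) \<le> (\<Sum>i\<in>(Basis::'a set). C * norm (x - y) powr ?g)"
        using True \<eta>B by (intro sum_mono D(2)) auto
      also have "\<dots> = d * (C * norm (x - y) powr ?g)" by (simp add: d_def)
      also have "\<dots> \<le> d\<^sup>2 * (C * norm (x - y) powr ?g)"
        using d1 C by (intro mult_right_mono) (auto simp: power2_eq_square)
      finally show ?thesis using True d1 by (simp add: H_def divide_le_eq mult.commute)
    next
      case False
      then have "H x y = 0" by (auto simp: H_def)
      then show ?thesis using C by simp
    qed
    have H4: "norm (x - y) \<le> 4" if "H x y \<noteq> 0" for x y
    proof -
      have "x \<in> ?B" "y \<in> ?B" using that \<eta>B unfolding H_def by (metis (full_types))+
      then show ?thesis using norm_triangle_ineq4[of x y] \<delta>(1) by simp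
    qed
    have HE: "(\<integral>\<^sup>+y. (\<integral>\<^sup>+x. ennreal (H x y powr P / norm (x - y) powr (d + s * P)) \<partial>lborel) \<partial>lborel) \<le> 1"
    proof -
      define e where "e i a b = (indicator (ball 0 2) a * (indicator (ball 0 2) b *
        ennreal (\<bar>G i a - G i b\<bar> powr P / norm (a - b) powr (d + s * P))) :: ennreal)" for i a b
      have em [measurable]: "(\<lambda>(a, b). e i a b) \<in> borel_measurable (lborel \<Otimes>\<^sub>M lborel)" if "i \<in> Basis" for i
      proof -
        have [measurable]: "G i \<in> borel_measurable borel" using G that by blast
        have [measurable]: "ball (0::'a) 2 \<in> sets borel" by simp
        show ?thesis unfolding e_def by measurable
      qed
      have em1: "(\<lambda>b. e i a b) \<in> borel_measurable lborel" if "i \<in> Basis" for i a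
        using measurable_Pair2[OF em[OF that], of a] by simp
      have em2: "(\<lambda>a. \<integral>\<^sup>+b. e i a b \<partial>lborel) \<in> borel_measurable lborel" if "i \<in> Basis" for i
        using lborel.borel_measurable_nn_integral[OF em[OF that]] by simp
      have AE: "AE x in lborel. \<eta> x \<noteq> 0 \<longrightarrow> (\<forall>i\<in>Basis. D i x = G i x)"
      proof -
        have "AE x in lebesgue. \<forall>i\<in>Basis. \<eta> x \<noteq> 0 \<longrightarrow> D i x = G i x"
          using DG by (intro AE_finite_allI) auto
        then have "AE x in lebesgue. \<eta> x \<noteq> 0 \<longrightarrow> (\<forall>i\<in>Basis. D i x = G i x)"
          by eventually_elim blast
        then show ?thesis by (simp add: AE_completion_iff)
      qed
      have pt: "ennreal (H x y powr P / norm (x - y) powr (d + s * P)) \<le> ennreal (d powr (- P)) * (\<Sum>i\<in>Basis. e i y x)"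
        if x: "\<eta> x \<noteq> 0 \<longrightarrow> (\<forall>i\<in>Basis. D i x = G i x)" and y: "\<eta> y \<noteq> 0 \<longrightarrow> (\<forall>i\<in>Basis. D i y = G i y)" for x y
      proof (cases "\<eta> x \<noteq> 0 \<and> \<eta> y \<noteq> 0")
        case True
        let ?k = "norm (x - y) powr (d + s * P)"
        have xy: "x \<in> ball 0 2" "y \<in> ball 0 2" using True \<eta>B \<delta>(1) by fastforce+
        have "(\<Sum>i\<in>Basis. \<bar>D i x - D i y\<bar>) = (\<Sum>i\<in>Basis. \<bar>G i y - G i x\<bar>)"
          using True x y by (intro sum.cong) (auto simp: abs_minus_commute)
        then have "H x y powr P = (\<Sum>i\<in>Basis. \<bar>G i y - G i x\<bar>) powr P / (d\<^sup>2) powr P"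
          using True d1 by (simp add: H_def powr_divide sum_nonneg)
        also have "\<dots> \<le> (real (card (Basis::'a set)) powr P * (\<Sum>i\<in>Basis. \<bar>G i y - G i x\<bar> powr P)) / (d\<^sup>2) powr P"
          using P by (intro divide_right_mono powr_sum_le) auto
        also have "\<dots> = d powr (- P) * (\<Sum>i\<in>Basis. \<bar>G i y - G i x\<bar> powr P)"
          using d1 by (simp add: d_def power2_eq_square powr_mult powr_minus_divide)
        finally have "H x y powr P / ?k \<le> d powr (- P) * (\<Sum>i\<in>Basis. \<bar>G i y - G i x\<bar> powr P) / ?k"
          by (intro divide_right_mono) auto
        also have "\<dots> = d powr (- P) * (\<Sum>i\<in>Basis. \<bar>G i y - G i x\<bar> powr P / norm (y - x) powr (d + s * P))"
          by (simp add: sum_divide_distrib[symmetric] norm_minus_commute)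
        finally have "ennreal (H x y powr P / ?k)
            \<le> ennreal (d powr (- P) * (\<Sum>i\<in>Basis. \<bar>G i y - G i x\<bar> powr P / norm (y - x) powr (d + s * P)))"
          by (rule ennreal_leI)
        also have "\<dots> = ennreal (d powr (- P)) * (\<Sum>i\<in>Basis. e i y x)"
        proof -
          have "e i y x = ennreal (\<bar>G i y - G i x\<bar> powr P / norm (y - x) powr (d + s * P))" for i
            using xy by (simp add: e_def)
          then show ?thesis by (simp add: ennreal_mult sum_nonneg sum_ennreal)
        qed
        finally show ?thesis .
      next
        case False
        then have "H x y = 0" by (auto simp: H_def)
        then show ?thesis using P by simp
      qed
      have "(\<integral>\<^sup>+y. (\<integral>\<^sup>+x. ennreal (H x y powr P / norm (x - y) powr (d + s * P)) \<partial>lborel) \<partial>lborel)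
          \<le> (\<integral>\<^sup>+y. (\<integral>\<^sup>+x. ennreal (d powr (- P)) * (\<Sum>i\<in>Basis. e i y x) \<partial>lborel) \<partial>lborel)"
      proof (rule nn_integral_mono_AE, use AE in eventually_elim)
        fix y assume y: "\<eta> y \<noteq> 0 \<longrightarrow> (\<forall>i\<in>Basis. D i y = G i y)"
        show "(\<integral>\<^sup>+x. ennreal (H x y powr P / norm (x - y) powr (d + s * P)) \<partial>lborel)
            \<le> (\<integral>\<^sup>+x. ennreal (d powr (- P)) * (\<Sum>i\<in>Basis. e i y x) \<partial>lborel)"
          by (rule nn_integral_mono_AE, use AE in eventually_elim) (rule pt[OF _ y])
      qed
      also have "\<dots> = (\<integral>\<^sup>+y. ennreal (d powr (- P)) * (\<Sum>i\<in>Basis. \<integral>\<^sup>+x. e i y x \<partial>lborel) \<partial>lborel)"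
        by (intro nn_integral_cong, subst nn_integral_cmult, rule borel_measurable_sum, rule em1, assumption,
            subst nn_integral_sum, rule em1, assumption, rule refl)
      also have "\<dots> = ennreal (d powr (- P)) * (\<Sum>i\<in>Basis. \<integral>\<^sup>+y. (\<integral>\<^sup>+x. e i y x \<partial>lborel) \<partial>lborel)"
        by (subst nn_integral_cmult, rule borel_measurable_sum, rule em2, assumption,
            subst nn_integral_sum, rule em2, assumption, rule refl)
      also have "\<dots> \<le> ennreal (d powr (- P)) * (\<Sum>i\<in>(Basis::'a set). 1)"
        using G unfolding e_def local_energy_def by (intro mult_left_mono sum_mono) auto
      also have "\<dots> = ennreal (d powr (- P) * d)"
        by (simp add: d_def ennreal_mult ennreal_of_nat_eq_real_of_nat)
      also have "\<dots> \<le> ennreal 1"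
      proof (rule ennreal_leI)
        have "d powr (- P) * d = d powr (1 - P)" using d1 by (simp add: powr_diff powr_minus_divide)
        also have "\<dots> \<le> d powr 0" using d1 P by (intro powr_mono) auto
        finally show "d powr (- P) * d \<le> 1" using d1 by simp
      qed
      finally show ?thesis by simp
    qed
    have Fm: "F \<in> borel_measurable borel"
      unfolding F_def[abs_def]
      by (intro borel_measurable_sum borel_measurable_scaleR borel_measurable_const borel_measurable_divide
          borel_measurable_add borel_measurable_continuous_onI Nc Zc)
    have Fw: "has_weak_deriv UNIV [i] (\<lambda>x. \<eta> x * u x) (\<lambda>x. h0 * (F x \<bullet> i))" if i: "i \<in> Basis" for i
    proof -
      have "(\<lambda>x. h0 * (F x \<bullet> i)) = (\<lambda>x. N i x + Z i x)" using h0 by (simp add: Fi[OF i])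
      then show ?thesis using wd[OF i] by (simp only:)
    qed
    show "\<exists>(F :: 'a \<Rightarrow> 'a) H. (\<forall>i\<in>Basis. has_weak_deriv UNIV [i] (\<lambda>x. \<eta> x * u x) (\<lambda>x. h0 * (F x \<bullet> i))) \<and>
        F \<in> borel_measurable borel \<and> (\<forall>x. norm (F x) \<le> c0) \<and>
        (\<lambda>(x, y). H x y) \<in> borel_measurable (lborel \<Otimes>\<^sub>M lborel) \<and> (\<forall>x y. H x y \<ge> 0) \<and>
        (\<forall>x y. H x y \<le> C * norm (x - y) powr (s - d / P)) \<and> (\<forall>x y. H x y \<noteq> 0 \<longrightarrow> norm (x - y) \<le> 4) \<and>
        (\<forall>x y. norm (F x - F y) \<le> H x y + c1 * min 1 (norm (x - y))) \<and>
        (\<integral>\<^sup>+y. (\<integral>\<^sup>+x. ennreal (H x y powr P / norm (x - y) powr (d + s * P)) \<partial>lborel) \<partial>lborel) \<le> 1"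
      by (intro exI[of _ F] exI[of _ H] conjI allI ballI impI Fw Fm F0 Hm H0 Hh H4 F1 HE)
  qed
qed

section \<open>The multiplier estimate\<close>

lemma has_weak_deriv_cmult:
  fixes f w :: "'a::euclidean_space \<Rightarrow> real"
  assumes "has_weak_deriv \<Omega> \<alpha> f w"
  shows "has_weak_deriv \<Omega> \<alpha> (\<lambda>x. a * f x) (\<lambda>x. a * w x)"
  using assms unfolding has_weak_deriv_def loc_integrable_on_def
  by (simp add: mult.left_commute[of _ a])

lemma weak_gradient_eq_AE:
  fixes \<phi> :: "'a::euclidean_space \<Rightarrow> real" and \<rho> :: "'a \<Rightarrow> real"
  assumes \<rho>: "mollifier \<rho>" and w: "\<And>i. i \<in> Basis \<Longrightarrow> has_weak_deriv UNIV [i] \<phi> (\<lambda>x. W x \<bullet> i)"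
  shows "weakly_differentiable_on \<phi> UNIV" "AE x in lebesgue. weak_gradient UNIV \<phi> x = W x"
proof -
  show "weakly_differentiable_on \<phi> UNIV" unfolding weakly_differentiable_on_def using w by blast
  have "AE x in lebesgue. weak_deriv UNIV [i] \<phi> x = W x \<bullet> i" if i: "i \<in> Basis" for i
  proof (rule has_weak_deriv_unique[OF \<rho> _ w[OF i]])
    show "has_weak_deriv UNIV [i] \<phi> (weak_deriv UNIV [i] \<phi>)"
      using w[OF i] by (intro has_weak_deriv_weak_deriv) blast
  qed (use i in simp)
  then have "AE x in lebesgue. \<forall>i\<in>Basis. weak_deriv UNIV [i] \<phi> x = W x \<bullet> i"
    by (intro AE_finite_allI) auto
  then show "AE x in lebesgue. weak_gradient UNIV \<phi> x = W x"
  proof eventually_elim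
    case (elim x)
    then have "weak_gradient UNIV \<phi> x = (\<Sum>i\<in>Basis. (W x \<bullet> i) *\<^sub>R i)"
      unfolding weak_gradient_def by (intro sum.cong) auto
    then show ?case by (simp only: euclidean_representation)
  qed
qed

lemma grad_linf_norm_le:
  fixes \<phi> :: "'a::euclidean_space \<Rightarrow> real"
  assumes wd: "weakly_differentiable_on \<phi> UNIV"
    and AE: "AE x in lebesgue. norm (weak_gradient UNIV \<phi> x) \<le> c"
  shows "grad_linf_norm \<phi> \<le> ennreal c"
proof -
  have "esssup lebesgue (\<lambda>x. ennreal (norm (weak_gradient UNIV \<phi> x))) \<le> ennreal c"
  proof (rule esssup_I)
    show "(\<lambda>x. ennreal (norm (weak_gradient UNIV \<phi> x))) \<in> borel_measurable lebesgue"
      by (rule measurable_compose[OF measurable_compose[OF weak_gradient_measurable[OF wd] borel_measurable_norm] measurable_ennreal])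
    show "AE x in lebesgue. ennreal (norm (weak_gradient UNIV \<phi> x)) \<le> ennreal c"
      using AE by eventually_elim (rule ennreal_leI)
  qed
  then show ?thesis using wd by (simp add: grad_linf_norm_def)
qed

lemma slobodeckij_le_sobolev_energy:
  fixes u :: "'a::euclidean_space \<Rightarrow> real"
  assumes s: "1 < s" "s < 2" and i: "i \<in> Basis"
  shows "slobodeckij_energy (s - 1) p \<Omega> (weak_deriv \<Omega> [i] u) \<le> sobolev_energy s p \<Omega> u"
proof -
  have fl: "\<lfloor>s\<rfloor> = 1" using s by (simp add: floor_eq_iff)
  then have fr: "frac s = s - 1" by (simp add: frac_def)
  have mem: "[i] \<in> deriv_indices 1" using i by (simp add: deriv_indices_def)
  have fin: "finite (deriv_indices 1 :: 'a list set)"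
    unfolding deriv_indices_def by (rule finite_lists_length_eq) simp
  have "slobodeckij_energy (s - 1) p \<Omega> (weak_deriv \<Omega> [i] u)
      \<le> (\<Sum>\<alpha>\<in>deriv_indices 1. slobodeckij_energy (s - 1) p \<Omega> (weak_deriv \<Omega> \<alpha> u))"
    by (rule member_le_sum[OF mem _ fin]) simp
  also have "\<dots> \<le> sobolev_energy s p \<Omega> u"
    unfolding sobolev_energy_def fr using s by (simp add: fl add_increasing)
  finally show ?thesis .
qed

text \<open>The growth of the density is estimated with a Hoelder exponent below \<open>\<sigma>\<close>. As \<open>H\<close> vanishes at points of distance
more than \<open>4\<close>, the exponent \<open>1 - 3 / P\<close> may be lowered at the cost of a constant. The order \<open>\<sigma>\<close> stays below \<open>1 - 1 / P\<close> because
\<open>1 - 1 / P\<close> exceeds \<open>2 / 3\<close>.\<close>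

lemma multiplier_norm_le_cutoff:
  fixes \<phi> :: "real^2 \<Rightarrow> real" and F :: "real^2 \<Rightarrow> real^2" and \<rho> :: "real^2 \<Rightarrow> real"
  assumes \<rho>: "mollifier \<rho>" and wd: "weakly_differentiable_on \<phi> UNIV"
    and gr: "AE x in lebesgue. weak_gradient UNIV \<phi> x = A *\<^sub>R F x" and A: "A \<ge> 0"
    and P: "P > 3" and q: "0 < q" "q < P" and \<sigma>: "0 < \<sigma>" "\<sigma> < 2/3"
    and H: "(\<lambda>(x, y). H x y) \<in> borel_measurable (lborel \<Otimes>\<^sub>M lborel)" "\<forall>x y. H x y \<ge> 0"
      "\<forall>x y. H x y \<le> c * norm (x - y) powr (1 - 3 / P)" "\<forall>x y. H x y \<noteq> 0 \<longrightarrow> norm (x - y) \<le> 4"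
      "(\<integral>\<^sup>+y. (\<integral>\<^sup>+x. ennreal (H x y powr P / norm (x - y) powr (P + 1)) \<partial>lborel) \<partial>lborel) \<le> 1"
    and c: "c \<ge> 0" and F: "F \<in> borel_measurable borel" "\<forall>x. norm (F x) \<le> c0"
      "\<forall>x y. norm (F x - F y) \<le> H x y + c1 * min 1 (norm (x - y))" and c01: "c0 \<ge> 0" "c1 \<ge> 0"
  shows "multiplier_norm (1 + \<sigma>) q \<phi> \<le> ennreal (A * (c0 powr q + max 0 (multiplier_const TYPE(real^2)
    q \<sigma> (1 - 1 / P) (min (1 - 3 / P) (\<sigma> / 2)) (c * 4 powr (1 - 3 / P)) c0 c1)) powr (1 / q))"
proof -
  let ?g = "1 - 3 / P" and ?g' = "min (1 - 3 / P) (\<sigma> / 2)" and ?c = "c * 4 powr (1 - 3 / P)"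
  have g: "?g > 0" using P by (simp add: field_simps)
  have d: "real DIM(real^2) = 2" by simp
  have s: "\<sigma> < 1 - 1 / P"
  proof -
    have "1 / P < 1 / 3" using P by (intro divide_strict_left_mono) auto
    then show ?thesis using \<sigma>(2) by linarith
  qed
  have e: "real DIM(real^2) + (1 - 1 / P) * P = P + 1" using P by (simp add: algebra_simps)
  have sg: "1 - 1 / P - real DIM(real^2) / P = ?g" unfolding d by (simp add: diff_divide_distrib[symmetric])
  have hol: "H x y \<le> ?c * norm (x - y) powr ?g'" for x y
  proof (cases "H x y = 0")
    case False
    let ?z = "norm (x - y)"
    have "?z powr ?g = ?z powr (?g - ?g') * ?z powr ?g'" by (simp flip: powr_add)
    also have "?z powr (?g - ?g') \<le> 4 powr (?g - ?g')"
      using H(4) False g by (intro powr_mono2) auto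
    also have "(4::real) powr (?g - ?g') \<le> 4 powr ?g" using g \<sigma> by (intro powr_mono) auto
    finally have "?z powr ?g \<le> 4 powr ?g * ?z powr ?g'" by (simp add: mult_right_mono)
    from mult_left_mono[OF this c] H(3) show ?thesis by (metis (no_types, lifting) mult.assoc order_trans)
  qed (use c in simp)
  show ?thesis
  proof (rule multiplier_norm_le[OF \<rho> wd gr A H(1) _ q \<sigma>(1) s _ _ _ _ hol _ _ F(1) _ _ c01])
    show "?g' \<le> 1 - 1 / P - real DIM(real^2) / P" unfolding sg by simp
    show "(\<integral>\<^sup>+y. (\<integral>\<^sup>+x. ennreal (H x y powr P / norm (x - y) powr (real DIM(real^2) + (1 - 1 / P) * P)) \<partial>lborel) \<partial>lborel) \<le> 1"
      unfolding e by (rule H(5))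
  qed (use H F c g \<sigma> in auto)
qed

theorem theorem3p3:
  fixes P :: real and \<eta> :: "real^2 \<Rightarrow> real"
  assumes "P > 3"
    and "test_function (ball 0 2) \<eta>"
    and "\<forall>y\<in>ball 0 1. \<eta> y = 1"
  shows "\<exists>C\<ge>0. \<forall>ra>0. \<forall>\<psi> :: real^2 \<Rightarrow> real.
           \<psi> \<in> sobolev_space (2 - 1 / P) P (ball 0 (2 * ra)) \<and>
           continuous_on (ball 0 (2 * ra)) \<psi> \<and>
           \<psi> 0 = 0 \<and> (\<psi> has_derivative (\<lambda>h. 0)) (at 0) \<longrightarrow>
           (\<forall>r. 0 < r \<and> r < ra \<longrightarrow>
              (let \<psi>h = (\<lambda>y. \<eta> y * rescaled r \<psi> y) in
                 multiplier_norm (4/3) (3/2) \<psi>h + multiplier_norm (16/15) (15/14) \<psi>h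
                   + grad_linf_norm \<psi>h
                 \<le> ennreal (C * r powr (1 - 3 / P))
                     * sobolev_norm (2 - 1 / P) P (ball 0 (2 * r)) \<psi>))"
proof -
  obtain \<rho> :: "real^2 \<Rightarrow> real" where \<rho>: "mollifier \<rho>" using mollifier_from_bump[OF assms(2,3)] by blast
  let ?s = "1 - 1 / P" and ?g = "1 - 3 / P" and ?B = "ball (0::real^2) 2"
  have P: "P > 3" "P \<ge> 1" "?s > 0" using assms(1) by (auto simp: field_simps)
  have e: "real DIM(real^2) + ?s * P = P + 1" using P by (simp add: algebra_simps)
  have sg: "?s - real DIM(real^2) / P = ?g" by (simp add: diff_divide_distrib[symmetric])
  have g: "?g > 0" using P by (simp add: field_simps)
  obtain h0 c c0 c1 where pos: "h0 \<ge> 0" "c \<ge> 0" "c0 \<ge> 0" "c1 \<ge> 0"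
    and loc: "\<forall>(u :: real^2 \<Rightarrow> real) G.
     continuous_on ?B u \<and> u 0 = 0 \<and> (u has_derivative (\<lambda>h. 0)) (at 0) \<and>
     (\<forall>i\<in>Basis. has_weak_deriv ?B [i] u (G i) \<and> G i \<in> borel_measurable borel \<and>
        local_energy P (P + 1) ?B (G i) \<le> 1) \<longrightarrow>
     (\<exists>(F :: real^2 \<Rightarrow> real^2) H. (\<forall>i\<in>Basis. has_weak_deriv UNIV [i] (\<lambda>x. \<eta> x * u x) (\<lambda>x. h0 * (F x \<bullet> i))) \<and>
        F \<in> borel_measurable borel \<and> (\<forall>x. norm (F x) \<le> c0) \<and>
        (\<lambda>(x, y). H x y) \<in> borel_measurable (lborel \<Otimes>\<^sub>M lborel) \<and> (\<forall>x y. H x y \<ge> 0) \<and>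
        (\<forall>x y. H x y \<le> c * norm (x - y) powr ?g) \<and> (\<forall>x y. H x y \<noteq> 0 \<longrightarrow> norm (x - y) \<le> 4) \<and>
        (\<forall>x y. norm (F x - F y) \<le> H x y + c1 * min 1 (norm (x - y))) \<and>
        (\<integral>\<^sup>+y. (\<integral>\<^sup>+x. ennreal (H x y powr P / norm (x - y) powr (P + 1)) \<partial>lborel) \<partial>lborel) \<le> 1)"
    using localized_gradient[OF \<rho> assms(2) P(2,3), unfolded sg e, OF g]
    by (elim exE conjE) (rule that)
  define m where "m \<sigma> q = (c0 powr q + max 0 (multiplier_const TYPE(real^2)
    q \<sigma> ?s (min ?g (\<sigma> / 2)) (c * 4 powr ?g) c0 c1)) powr (1 / q)" for \<sigma> q
  have m0: "m \<sigma> q \<ge> 0" for \<sigma> q by (simp add: m_def)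
  define C where "C = h0 * (m (1/3) (3/2) + m (1/15) (15/14) + c0)"
  have C: "C \<ge> 0" using pos m0 by (simp add: C_def)
  have main: "multiplier_norm (4/3) (3/2) (\<lambda>y. \<eta> y * rescaled r \<psi> y)
      + multiplier_norm (16/15) (15/14) (\<lambda>y. \<eta> y * rescaled r \<psi> y)
      + grad_linf_norm (\<lambda>y. \<eta> y * rescaled r \<psi> y) \<le> ennreal (C * (r powr ?g * N))"
    if r: "r > 0" and cont: "continuous_on (ball 0 (2 * r)) \<psi>" and \<psi>0: "\<psi> 0 = 0"
      and \<psi>': "(\<psi> has_derivative (\<lambda>h. 0)) (at 0)" and sp: "\<psi> \<in> sobolev_space (2 - 1 / P) P (ball 0 (2 * r))"
      and N: "N > 0" "sobolev_energy (2 - 1 / P) P (ball 0 (2 * r)) \<psi> \<le> ennreal (N powr P)"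
    for r N and \<psi> :: "real^2 \<Rightarrow> real"
  proof -
    \<comment> \<open>The normalisation that turns the energy of the rescaled gradient into at most 1.\<close>
    define A where "A = r powr ?g * N"
    have A: "A > 0" using r N by (simp add: A_def)
    define k where "k = 1 / (r * A)"
    have k: "k \<ge> 0" using r A by (simp add: k_def)
    let ?\<Omega> = "ball (0::real^2) (2 * r)"
    have sb: "1 < 2 - 1 / P" "2 - 1 / P < 2" "2 - 1 / P - 1 = ?s" using P by (auto simp: field_simps)
    have "\<lfloor>2 - 1 / P\<rfloor> = 1" using sb(1,2) by (intro floor_unique) auto
    then have "nat \<lfloor>2 - 1 / P\<rfloor> = 1" by simp
    then have ex: "\<exists>w. has_weak_deriv ?\<Omega> [i] \<psi> w" if "i \<in> Basis" for i
      using sp that unfolding sobolev_space_def deriv_indices_def by auto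
    have "\<exists>G. has_weak_deriv ?B [i] (\<lambda>y. k * \<psi> (r *\<^sub>R y)) G \<and> G \<in> borel_measurable borel \<and>
        local_energy P (P + 1) ?B G \<le> 1" if i: "i \<in> Basis" for i
    proof -
      note w0 = has_weak_deriv_weak_deriv[OF ex[OF i]]
      then have "loc_integrable_on (weak_deriv ?\<Omega> [i] \<psi>) ?\<Omega>" by (simp add: has_weak_deriv_def)
      from loc_integrable_ball_ex_borel[OF this] obtain w where w: "w \<in> borel_measurable borel"
        "AE x in lebesgue. x \<in> ?\<Omega> \<longrightarrow> w x = weak_deriv ?\<Omega> [i] \<psi> x" by blast
      have wd: "has_weak_deriv ?\<Omega> [i] \<psi> w" by (rule has_weak_deriv_cong_AE[OF w0 w open_ball])
      have "local_energy P (P + 1) ?\<Omega> w = slobodeckij_energy ?s P ?\<Omega> (weak_deriv ?\<Omega> [i] \<psi>)"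
      proof (rule slobodeckij_energy_local[where w = w and \<sigma> = ?s and p = P, unfolded e, symmetric])
        show "AE x in lebesgue. x \<in> ?\<Omega> \<longrightarrow> weak_deriv ?\<Omega> [i] \<psi> x = w x"
          using w(2) by eventually_elim simp
      qed simp
      also have "\<dots> \<le> ennreal (N powr P)"
        using slobodeckij_le_sobolev_energy[OF sb(1,2) i, of P ?\<Omega> \<psi>] N(2) unfolding sb(3) by (rule order_trans)
      finally have le: "local_energy P (P + 1) ?\<Omega> w \<le> ennreal (N powr P)" .
      have kr: "k * r \<ge> 0" using k r by simp
      have "local_energy P (P + 1) ?B (\<lambda>y. k * r * w (r *\<^sub>R y))
          = ennreal ((k * r) powr P * r powr (P + 1 - 2 * real DIM(real^2))) * local_energy P (P + 1) ?\<Omega> w"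
        by (rule local_energy_rescale[OF w(1) r kr])
      also have "\<dots> \<le> ennreal ((k * r) powr P * r powr (P + 1 - 2 * real DIM(real^2))) * ennreal (N powr P)"
        by (intro mult_left_mono le) simp
      also have "\<dots> = ennreal ((k * r) powr P * r powr (P + 1 - 2 * real DIM(real^2)) * N powr P)"
        by (simp add: ennreal_mult)
      also have "(k * r) powr P * r powr (P + 1 - 2 * real DIM(real^2)) * N powr P = 1"
      proof -
        have "?g * P = P - 3" using P by (simp add: algebra_simps)
        then have "A powr P = r powr (P - 3) * N powr P"
          using r N by (simp add: A_def powr_mult powr_powr)
        moreover have "k * r = 1 / A" using r by (simp add: k_def)
        moreover have "P + 1 - 2 * real DIM(real^2) = P - 3" by simp
        ultimately show ?thesis using A r N by (simp add: powr_divide)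
      qed
      finally have "local_energy P (P + 1) ?B (\<lambda>y. k * r * w (r *\<^sub>R y)) \<le> 1" by simp
      moreover have "has_weak_deriv ?B [i] (\<lambda>y. k * \<psi> (r *\<^sub>R y)) (\<lambda>y. k * r * w (r *\<^sub>R y))"
        by (rule has_weak_deriv_rescale[OF wd r i w(1) cont])
      moreover have "(\<lambda>y. k * r * w (r *\<^sub>R y)) \<in> borel_measurable borel"
        by (intro borel_measurable_times borel_measurable_const measurable_compose[OF _ w(1)]) simp
      ultimately show ?thesis by blast
    qed
    then obtain G where G: "\<forall>i\<in>Basis. has_weak_deriv ?B [i] (\<lambda>y. k * \<psi> (r *\<^sub>R y)) (G i) \<and>
        G i \<in> borel_measurable borel \<and> local_energy P (P + 1) ?B (G i) \<le> 1"
      by metis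
    have uc: "continuous_on ?B (\<lambda>y. k * \<psi> (r *\<^sub>R y))"
      by (intro continuous_intros continuous_on_compose2[OF cont]) (use r in auto)
    have ud: "((\<lambda>y. k * \<psi> (r *\<^sub>R y)) has_derivative (\<lambda>h. 0)) (at 0)"
    proof -
      have "((\<lambda>y. r *\<^sub>R y) has_derivative (\<lambda>h. r *\<^sub>R h)) (at (0::real^2))" by (auto intro!: derivative_eq_intros)
      moreover have "(\<psi> has_derivative (\<lambda>h. 0)) (at (r *\<^sub>R 0))" using \<psi>' by simp
      ultimately have "((\<lambda>y. \<psi> (r *\<^sub>R y)) has_derivative (\<lambda>h. 0)) (at 0)"
        using diff_chain_at[of "\<lambda>y. r *\<^sub>R y" "\<lambda>h. r *\<^sub>R h" "0::real^2" \<psi> "\<lambda>h. 0"] by (simp add: o_def)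
      from has_derivative_mult_right[OF this, of k] show ?thesis by simp
    qed
    have u0: "k * \<psi> (r *\<^sub>R 0) = 0" using \<psi>0 by simp
    obtain F :: "real^2 \<Rightarrow> real^2" and H where F: "\<forall>i\<in>Basis. has_weak_deriv UNIV [i] (\<lambda>x. \<eta> x * (k * \<psi> (r *\<^sub>R x))) (\<lambda>x. h0 * (F x \<bullet> i))"
      "F \<in> borel_measurable borel" "\<forall>x. norm (F x) \<le> c0"
      and H: "(\<lambda>(x, y). H x y) \<in> borel_measurable (lborel \<Otimes>\<^sub>M lborel)" "\<forall>x y. H x y \<ge> 0"
        "\<forall>x y. H x y \<le> c * norm (x - y) powr ?g" "\<forall>x y. H x y \<noteq> 0 \<longrightarrow> norm (x - y) \<le> 4"
      and FH: "\<forall>x y. norm (F x - F y) \<le> H x y + c1 * min 1 (norm (x - y))"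
      and HE: "(\<integral>\<^sup>+y. (\<integral>\<^sup>+x. ennreal (H x y powr P / norm (x - y) powr (P + 1)) \<partial>lborel) \<partial>lborel) \<le> 1"
      using loc[THEN spec, THEN spec, THEN mp, OF conjI[OF uc conjI[OF u0 conjI[OF ud G]]]]
      by (elim exE conjE) (rule that)
    let ?\<phi> = "\<lambda>y. \<eta> y * rescaled r \<psi> y"
    have \<phi>: "?\<phi> = (\<lambda>x. A * (\<eta> x * (k * \<psi> (r *\<^sub>R x))))"
      using A r by (simp add: rescaled_def k_def fun_eq_iff)
    have wF: "has_weak_deriv UNIV [i] ?\<phi> (\<lambda>x. ((A * h0) *\<^sub>R F x) \<bullet> i)" if "i \<in> Basis" for i
      unfolding \<phi> using has_weak_deriv_cmult[OF F(1)[rule_format, OF that], of A] by (simp add: mult.assoc)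
    have wg: "weakly_differentiable_on ?\<phi> UNIV" "AE x in lebesgue. weak_gradient UNIV ?\<phi> x = (A * h0) *\<^sub>R F x"
      by (rule weak_gradient_eq_AE[OF \<rho>], erule wF)+
    have Ah: "A * h0 \<ge> 0" using A pos by simp
    have mult: "multiplier_norm (1 + \<sigma>) q ?\<phi> \<le> ennreal (A * h0 * m \<sigma> q)"
      if "0 < q" "q < P" "0 < \<sigma>" "\<sigma> < 2/3" for \<sigma> q
      unfolding m_def
      by (rule multiplier_norm_le_cutoff[OF \<rho> wg Ah P(1) that H HE pos(2) F(2,3) FH pos(3,4)])
    have "multiplier_norm (4/3) (3/2) ?\<phi> \<le> ennreal (A * h0 * m (1/3) (3/2))"
      using mult[of "3/2" "1/3"] P by simp
    moreover have "multiplier_norm (16/15) (15/14) ?\<phi> \<le> ennreal (A * h0 * m (1/15) (15/14))"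
      using mult[of "15/14" "1/15"] P by simp
    moreover have "grad_linf_norm ?\<phi> \<le> ennreal (A * h0 * c0)"
    proof (rule grad_linf_norm_le[OF wg(1)])
      show "AE x in lebesgue. norm (weak_gradient UNIV ?\<phi> x) \<le> A * h0 * c0"
        using wg(2)
      proof eventually_elim
        case (elim x)
        have "norm ((A * h0) *\<^sub>R F x) \<le> A * h0 * c0"
          using Ah F(3) by (simp add: mult_left_mono)
        then show ?case using elim by simp
      qed
    qed
    ultimately have "multiplier_norm (4/3) (3/2) ?\<phi> + multiplier_norm (16/15) (15/14) ?\<phi> + grad_linf_norm ?\<phi>
        \<le> ennreal (A * h0 * m (1/3) (3/2)) + ennreal (A * h0 * m (1/15) (15/14)) + ennreal (A * h0 * c0)"
      by (intro add_mono)
    also have "\<dots> = ennreal (A * h0 * m (1/3) (3/2) + A * h0 * m (1/15) (15/14) + A * h0 * c0)"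
      using Ah m0 pos by (simp add: ennreal_plus[symmetric] del: ennreal_plus)
    also have "A * h0 * m (1/3) (3/2) + A * h0 * m (1/15) (15/14) + A * h0 * c0 = C * (r powr ?g * N)"
      by (simp add: C_def A_def algebra_simps)
    finally show ?thesis .
  qed
  show ?thesis
  proof (intro exI[of _ "C + 1"] conjI allI impI)
    show "C + 1 \<ge> 0" using C by simp
    fix ra r :: real and \<psi> :: "real^2 \<Rightarrow> real"
    assume ra: "ra > 0" and "\<psi> \<in> sobolev_space (2 - 1 / P) P (ball 0 (2 * ra)) \<and>
       continuous_on (ball 0 (2 * ra)) \<psi> \<and> \<psi> 0 = 0 \<and> (\<psi> has_derivative (\<lambda>h. 0)) (at 0)"
      and "0 < r \<and> r < ra"
    then have cont0: "continuous_on (ball 0 (2 * ra)) \<psi>" and \<psi>: "\<psi> 0 = 0" "(\<psi> has_derivative (\<lambda>h. 0)) (at 0)"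
      and r: "0 < r" "r < ra" by auto
    have cont: "continuous_on (ball 0 (2 * r)) \<psi>"
      by (rule continuous_on_subset[OF cont0]) (use r in auto)
    let ?\<phi> = "\<lambda>y. \<eta> y * rescaled r \<psi> y"
    let ?L = "multiplier_norm (4/3) (3/2) ?\<phi> + multiplier_norm (16/15) (15/14) ?\<phi> + grad_linf_norm ?\<phi>"
    let ?E = "sobolev_energy (2 - 1 / P) P (ball 0 (2 * r)) \<psi>"
    have rg: "r powr ?g > 0" using r by simp
    \<comment> \<open>Adding 1 to the constant makes it positive, so that the right-hand side is infinite when the norm
      of \<open>\<psi>\<close> is.\<close>
    have "?L \<le> ennreal ((C + 1) * r powr ?g) * sobolev_norm (2 - 1 / P) P (ball 0 (2 * r)) \<psi>"
    proof (cases "\<psi> \<in> sobolev_space (2 - 1 / P) P (ball 0 (2 * r))")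
      case False
      have "ennreal t * \<infinity> = \<infinity>" if "t > 0" for t
        using that by (simp add: ennreal_mult_top)
      moreover have "(C + 1) * r powr ?g > 0" using C rg by simp
      ultimately show ?thesis using False unfolding sobolev_norm_def by (simp only: if_False infinity_ennreal_def top_greatest)
    next
      case True
      then have fin: "?E < \<infinity>" by (simp add: sobolev_space_def)
      define n where "n = enn2real ?E powr (1 / P)"
      have n0: "n \<ge> 0" by (simp add: n_def)
      have nP: "n powr P = enn2real ?E" using P by (simp add: n_def powr_powr)
      have norm: "sobolev_norm (2 - 1 / P) P (ball 0 (2 * r)) \<psi> = ennreal n"
        using True fin by (simp add: sobolev_norm_def ennreal_root_def n_def)
      have "?L \<le> ennreal ((C + 1) * r powr ?g * n)"
      proof (rule ennreal_le_epsilon)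
        fix e :: real assume e: "e > 0"
        define t where "t = e / ((C + 1) * r powr ?g)"
        have t: "t > 0" using e C rg by (simp add: t_def)
        have "?E = ennreal (n powr P)" unfolding nP using fin by simp
        also have "\<dots> \<le> ennreal ((n + t) powr P)"
          using n0 t P by (intro ennreal_leI powr_mono2) auto
        finally have "?L \<le> ennreal (C * (r powr ?g * (n + t)))"
          using n0 t by (intro main[OF r(1) cont \<psi> True]) auto
        also have "\<dots> \<le> ennreal ((C + 1) * r powr ?g * n + e)"
        proof (rule ennreal_leI)
          have "C * (r powr ?g * (n + t)) \<le> (C + 1) * (r powr ?g * (n + t))"
            using rg n0 t by (intro mult_right_mono) auto
          also have "\<dots> = (C + 1) * r powr ?g * n + e"
            using C rg by (simp add: t_def distrib_left)
          finally show "C * (r powr ?g * (n + t)) \<le> (C + 1) * r powr ?g * n + e" .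
        qed
        also have "\<dots> = ennreal ((C + 1) * r powr ?g * n) + ennreal e"
          using C n0 e by simp
        finally show "?L \<le> ennreal ((C + 1) * r powr ?g * n) + ennreal e" .
      qed
      also have "\<dots> = ennreal ((C + 1) * r powr ?g) * ennreal n" using C n0 by (simp add: ennreal_mult)
      finally show ?thesis unfolding norm .
    qed
    then show "let \<psi>h = (\<lambda>y. \<eta> y * rescaled r \<psi> y) in
       multiplier_norm (4/3) (3/2) \<psi>h + multiplier_norm (16/15) (15/14) \<psi>h + grad_linf_norm \<psi>h
       \<le> ennreal ((C + 1) * r powr (1 - 3 / P)) * sobolev_norm (2 - 1 / P) P (ball 0 (2 * r)) \<psi>"
      by (simp only: Let_def)
  qed
qed

end
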